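(* Let $d\ge2$ be an even integer, let $M\ge2$ and $1\le a\le M-1$ be integers, and let $z',z''\in\mathbb{C}^{*}$ be generic. Then \[ \begin{aligned} \overline D_d(a,M)+\overline D_d(a-1,M)&=\chi(a=1)+2(-1)^{\frac{da}2}q^{-\frac{d^2a^2}4}m\bigl((-1)^{1+\frac{dM}2}q^{\frac{d^2}4(M^2-2Ma)},q^{\frac{d^2M^2}2},z'\bigr)\\ &\quad+2(-1)^{\frac d2(a-1)+1}q^{-\frac{d^2}4(a^2-2a+1)}m\bigl((-1)^{1+\frac{dM}2}q^{\frac{d^2}4(M^2-2M(a-1))},q^{\frac{d^2M^2}2},z''\bigr)\\ &\quad+2\Psi^M_a\bigl((-1)^{\frac d2+1}q^{\frac{d^2}4},-1,z';q^{\frac{d^2}2}\bigr)-2\Psi^M_{a-1}\bigl((-1)^{\frac d2+1}q^{\frac{d^2}4},-1,z'';q^{\frac{d^2}2}\bigr)\\ &\quad+\frac2M(-1)^{\frac d2}q^{-\frac{d^2}4}\sum_{j=1}^{M-1}\zeta_M^{j-aj}(1-\zeta_M^j)\Psi_0^{\frac d2}\bigl(\zeta_M^{\frac{2j}d}q^{1-d},q,-1;q^2\bigr). \end{aligned} \]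
   Context: Let $q\in\mathbb{C}$ with $|q|<1$. Write $(x)_\infty=(x;q)_\infty=\prod_{k\ge0}(1-xq^k)$, and for a base $Q$ with $|Q|<1$ set $j(z;Q)=(z;Q)_\infty(Q/z;Q)_\infty(Q;Q)_\infty$ and $j(z_1,z_2;Q)=j(z_1;Q)j(z_2;Q)$. $\chi(X)=1$ if $X$ is true and $0$ otherwise. Appell–Lerch series: $m(x,Q,z)=\frac{1}{j(z;Q)}\sum_{r\in\mathbb{Z}}\frac{(-1)^rQ^{\binom r2}z^r}{1-Q^{r-1}xz}$ for nonzero $x,z$ with neither $z$ nor $xz$ an integral power of $Q$. For a base $Q$ and integers $n\ge1$, $k$: \[\Psi^n_k(x,z,z';Q)=-\frac{x^kz^{k+1}(Q^{n^2};Q^{n^2})_\infty^3}{j(z;Q)j(z';Q^{n^2})}\sum_{t=0}^{n-1}\frac{Q^{\binom{t+1}{2}+kt}(-z)^t\,j\bigl(-Q^{\binom{n+1}2+nk+nt}(-z)^n/z',\;Q^{nt}(xz)^nz';Q^{n^2}\bigr)}{j\bigl(-Q^{\binom n2-nk}(-x)^nz',\;Q^{nt}(xz)^n;Q^{n^2}\bigr)}.\] Roots of unity: $\zeta_M=e^{2\pi i/M}$ and $\zeta_M^{2j/d}=e^{4\pi ij/(dM)}$. "Generic" means the parameters do not produce poles in any Appell–Lerch series or theta quotient appearing. Overpartitions: an overpartition of $n$ is a partition of $n$ in which the first occurrence of each distinct part may be overlined; $\overline p(n)$ is their number, with $\sum_{n\ge0}\overline p(n)q^n=(-q)_\infty/(q)_\infty$.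 For an integer $d\ge1$ define \[\mathcal{O}_d(z;q)=\frac{(-q)_\infty}{(q)_\infty}\Bigl(1+2\sum_{n\ge1}\frac{(1-z)(1-z^{-1})(-1)^nq^{n^2+dn}}{(1-zq^{dn})(1-z^{-1}q^{dn})}\Bigr)=\sum_{m\in\mathbb{Z},\,n\ge0}\overline N_d(m,n)z^mq^n,\] $\overline N_d(a,M,n)=\sum_{k\equiv a\ (\mathrm{mod}\ M)}\overline N_d(k,n)$, and $\overline D_d(a,M)=\sum_{n\ge0}\bigl(\overline N_d(a,M,n)-\overline p(n)/M\bigr)q^n$ (for any integer $a$). *)

theory Defs
  imports
    "HOL-Analysis.Analysis"
    "HOL-Computational_Algebra.Formal_Laurent_Series"
    "HOL-Library.Multiset"
    "HOL-Number_Theory.Cong"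
begin

text \<open>The infinite \<open>q\<close>-Pochhammer symbol. It is polymorphic so that it covers both complex
  arguments (with \<open>norm q < 1\<close>) and formal power series in \<open>q\<close> (with the \<open>q\<close>-adic topology).\<close>

definition qpoch :: "'a::{t2_space,comm_ring_1} \<Rightarrow> 'a \<Rightarrow> 'a" where
  "qpoch x q = prodinf (\<lambda>k. 1 - x * q ^ k)"

definition jtheta :: "complex \<Rightarrow> complex \<Rightarrow> complex" where
  "jtheta z Q = qpoch z Q * qpoch (Q / z) Q * qpoch Q Q"

definition jtheta2 :: "complex \<Rightarrow> complex \<Rightarrow> complex \<Rightarrow> complex" where
  "jtheta2 z1 z2 Q = jtheta z1 Q * jtheta z2 Q"

text \<open>Appell--Lerch series \<open>m(x,Q,z)\<close>. The integer \<open>r * (r - 1)\<close> is even, so \<open>div\<close> is exact.\<close>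

definition appell_lerch :: "complex \<Rightarrow> complex \<Rightarrow> complex \<Rightarrow> complex" where
  "appell_lerch x Q z =
     1 / jtheta z Q *
     (\<Sum>\<^sub>\<infinity>r\<in>(UNIV::int set).
        (-1) powi r * Q powi (r * (r - 1) div 2) * z powi r / (1 - Q powi (r - 1) * x * z))"

definition appell_lerch_generic :: "complex \<Rightarrow> complex \<Rightarrow> complex \<Rightarrow> bool" where
  "appell_lerch_generic x Q z \<longleftrightarrow>
     x \<noteq> 0 \<and> z \<noteq> 0 \<and> (\<forall>r::int. z \<noteq> Q powi r \<and> x * z \<noteq> Q powi r)"

text \<open>\<open>Psi n k x z z' Q\<close> is \<open>\<Psi>\<^sup>n\<^sub>k(x,z,z';Q)\<close>: the superscript comes first.\<close>

definition Psi :: "nat \<Rightarrow> int \<Rightarrow> complex \<Rightarrow> complex \<Rightarrow> complex \<Rightarrow> complex \<Rightarrow> complex" where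
  "Psi n k x z z' Q =
     - (x powi k * z powi (k + 1) * qpoch (Q ^ (n\<^sup>2)) (Q ^ (n\<^sup>2)) ^ 3
          / (jtheta z Q * jtheta z' (Q ^ (n\<^sup>2)))) *
     (\<Sum>t = 0..<n.
        Q powi (int ((t + 1) choose 2) + k * int t) * (- z) ^ t
        * jtheta2 (- (Q powi (int ((n + 1) choose 2) + int n * k + int n * int t)) * (- z) ^ n / z')
                  (Q ^ (n * t) * (x * z) ^ n * z') (Q ^ (n\<^sup>2))
        / jtheta2 (- (Q powi (int (n choose 2) - int n * k)) * (- x) ^ n * z')
                  (Q ^ (n * t) * (x * z) ^ n) (Q ^ (n\<^sup>2)))"

text \<open>No denominator occurring in \<open>Psi n k x z z' Q\<close> vanishes.\<close>

definition Psi_generic :: "nat \<Rightarrow> int \<Rightarrow> complex \<Rightarrow> complex \<Rightarrow> complex \<Rightarrow> complex \<Rightarrow> bool" where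
  "Psi_generic n k x z z' Q \<longleftrightarrow>
     x \<noteq> 0 \<and> z \<noteq> 0 \<and> z' \<noteq> 0 \<and> jtheta z Q \<noteq> 0 \<and> jtheta z' (Q ^ (n\<^sup>2)) \<noteq> 0 \<and>
     (\<forall>t<n. jtheta2 (- (Q powi (int (n choose 2) - int n * k)) * (- x) ^ n * z')
                    (Q ^ (n * t) * (x * z) ^ n) (Q ^ (n\<^sup>2)) \<noteq> 0)"

definition zeta :: "nat \<Rightarrow> complex" where
  "zeta M = exp (2 * of_real pi * \<i> / of_nat M)"

text \<open>The pair \<open>(P, S)\<close> is the partition with multiset of parts \<open>P\<close> in which the first occurrence
  of exactly the parts in \<open>S\<close> is overlined.\<close>

definition overpartitions :: "nat \<Rightarrow> (nat multiset \<times> nat set) set" where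
  "overpartitions n = {(P, S). 0 \<notin># P \<and> sum_mset P = n \<and> S \<subseteq> set_mset P}"

definition pbar :: "nat \<Rightarrow> nat" where
  "pbar n = card (overpartitions n)"

text \<open>The series \<open>\<O>\<^sub>d(z;q)\<close>, polymorphic for the same reason as \<open>qpoch\<close>. The coefficients
  \<open>Nbar d m n\<close> of \<open>z\<^sup>m q\<^sup>n\<close> are read off from its expansion as a formal power series in \<open>q\<close>
  over the field of formal Laurent series in \<open>z\<close>; each coefficient of \<open>q\<^sup>n\<close> is in fact a Laurent
  polynomial in \<open>z\<close>.\<close>

definition overrank_gf :: "nat \<Rightarrow> 'a::{t2_space,comm_ring_1,inverse} \<Rightarrow> 'a \<Rightarrow> 'a" where
  "overrank_gf d z q =
     qpoch (- q) q / qpoch q q *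
     (1 + 2 * (\<Sum>i. let n = Suc i in
        (1 - z) * (1 - inverse z) * (-1) ^ n * q ^ (n\<^sup>2 + d * n)
        / ((1 - z * q ^ (d * n)) * (1 - inverse z * q ^ (d * n)))))"

definition overrank_fps :: "nat \<Rightarrow> complex fls fps" where
  "overrank_fps d = overrank_gf d (fps_const fls_X) fps_X"

definition Nbar :: "nat \<Rightarrow> int \<Rightarrow> nat \<Rightarrow> complex" where
  "Nbar d m n = fls_nth (fps_nth (overrank_fps d) n) m"

definition Nbar_res :: "nat \<Rightarrow> int \<Rightarrow> nat \<Rightarrow> nat \<Rightarrow> complex" where
  "Nbar_res d a M n = (\<Sum>\<^sub>\<infinity>k\<in>{k. [k = a] (mod int M)}. Nbar d k n)"

definition Dbar :: "nat \<Rightarrow> int \<Rightarrow> nat \<Rightarrow> complex \<Rightarrow> complex" where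
  "Dbar d a M q = (\<Sum>n. (Nbar_res d a M n - of_nat (pbar n) / of_nat M) * q ^ n)"

end

(*
Partial fractions turn (1 + z) O_d(z;q) into -(1 - z) plus 2 (1 - z) times the bilateral sum
F(z) = Sum_n (-1)^n q^(n^2) / (1 - z q^(dn)), divided by j(q;q^2), so Dbar_d(a,M) + Dbar_d(a-1,M)
is a finite Fourier transform of F over the nontrivial M-th roots of unity.

The engine is one identity, used twice: summing r over residue classes mod n writes
Sum_r (-1)^r Q^(r(r-1)/2) z^r y_r^k / (1 - y_r^n), y_r = Q^(r-1) x z, as a combination of
Appell--Lerch sums of base Q^(n^2) with a common first argument, and moving all of them to the same
argument z' produces one series m(.,.,z') and the theta quotients Psi^n_k. With n = d/2, k = 0 it
replaces F by m(.,.,-1) of base q^(d^2/2); with n = M and k = a, a - 1 it evaluates the Fourier sums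
of that series.

The change of the argument needs no complex analysis: the Laurent coefficients of the difference
satisfy the two-term recurrence of a theta function, so the difference is a constant multiple of one,
and the constant is read off at a zero.
*)
theory Submission
  imports Defs
begin


section \<open>Theta and Appell--Lerch sums over the integers\<close>

text \<open>Two adjacent residues are added because this multiplies the Fourier kernel by 1 + z; for
  a single residue, partial fractions would leave a factor 1/(1 + z) inside the sum over roots of
  unity. Reading off the constant at a zero of theta requires the value of Sum_r (-1)^r Q^(r(r-1)/2)
  / (1 - Q^r y), the partial fraction expansion of a reciprocal theta function. Both this expansion
  and the triple product are obtained from finite identities for Gaussian binomials by dominated
  convergence.

  A separate obstacle is that \<open>Dbar\<close> is built from a formal series over Laurent series
  in z, while the right-hand side is analytic. The bridge is one explicit finite expression for the
  coefficient of q^m, valid over every field: at the formal variable z it yields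
  \<open>Nbar\<close>, and at a root of unity it is the coefficient of a convergent power series.
  The root 1 contributes pbar(n)/M, which is exactly what the definition of \<open>Dbar\<close>
  subtracts.\<close>

definition theta_coeff :: "complex \<Rightarrow> int \<Rightarrow> complex" where
  "theta_coeff Q r = (-1) powi r * Q powi (r * (r - 1) div 2)"

lemma theta_coeff_0 [simp]: "theta_coeff Q 0 = 1"
  by (simp add: theta_coeff_def)

lemma theta_coeff_nz [simp]: "Q \<noteq> 0 \<Longrightarrow> theta_coeff Q r \<noteq> 0"
  by (simp add: theta_coeff_def)

lemma theta_coeff_add:
  assumes "Q \<noteq> 0"
  shows "theta_coeff Q (r + s) = theta_coeff Q r * theta_coeff Q s * Q powi (r * s)"
proof -
  have "(r + s) * (r + s - 1) = r * (r - 1) + s * (s - 1) + 2 * (r * s)"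
    by (simp add: algebra_simps)
  then have "(r + s) * (r + s - 1) div 2 = r * (r - 1) div 2 + s * (s - 1) div 2 + r * s"
    by (simp add: div_plus_div_distrib_dvd_left)
  then show ?thesis
    using assms by (simp add: theta_coeff_def power_int_add)
qed

lemma theta_coeff_Suc: "Q \<noteq> 0 \<Longrightarrow> theta_coeff Q (r + 1) = - (Q powi r) * theta_coeff Q r"
  by (subst theta_coeff_add) (simp_all add: theta_coeff_def)

lemma theta_coeff_reflect: "Q \<noteq> 0 \<Longrightarrow> theta_coeff Q (1 - r) = - theta_coeff Q r"
proof -
  have "(1 - r) * (1 - r - 1) = r * (r - 1)" by (simp add: algebra_simps)
  then show ?thesis
    unfolding theta_coeff_def by (simp add: power_int_diff field_simps)
qed

definition theta :: "complex \<Rightarrow> complex \<Rightarrow> complex" where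
  "theta Q z = (\<Sum>\<^sub>\<infinity>r\<in>UNIV. theta_coeff Q r * z powi r)"

text \<open>The numerator of m(x,Q,z) with its pole parameter made independent of \<open>z\<close>;
  \<open>y = x * z / Q\<close> recovers it. A term whose denominator vanishes counts as 0.\<close>

definition lerch :: "complex \<Rightarrow> complex \<Rightarrow> complex \<Rightarrow> complex" where
  "lerch Q y z = (\<Sum>\<^sub>\<infinity>r\<in>UNIV. theta_coeff Q r * z powi r / (1 - Q powi r * y))"

section \<open>Absolute convergence of bilateral series with Gaussian coefficients\<close>

lemma abs_summable_on_int:
  fixes f :: "int \<Rightarrow> 'a :: banach"
  assumes "summable (\<lambda>n. norm (f (int n)))" "summable (\<lambda>n. norm (f (- int n)))"
  shows "(\<lambda>r. norm (f r)) summable_on UNIV"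
proof -
  have 1: "(\<lambda>r. norm (f r)) summable_on {0..}"
  proof -
    have "(\<lambda>n. norm (f (int n))) summable_on UNIV"
      using assms(1) by (intro norm_summable_imp_summable_on) auto
    then have "(\<lambda>x. norm (f x)) summable_on range int"
      by (subst summable_on_reindex) (auto simp: o_def)
    also have "range int = {0..}"
      by (auto simp: image_iff elim: nonneg_int_cases)
    finally show ?thesis .
  qed
  have 2: "(\<lambda>r. norm (f r)) summable_on {..0}"
  proof -
    have "(\<lambda>n. norm (f (- int n))) summable_on UNIV"
      using assms(2) by (intro norm_summable_imp_summable_on) auto
    then have "(\<lambda>x. norm (f x)) summable_on range (\<lambda>n. - int n)"
      by (subst summable_on_reindex) (auto simp: o_def inj_on_def)
    also have "range (\<lambda>n. - int n) = {..0}"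
    proof safe
      fix x :: int assume "x \<le> 0"
      then have "x = - int (nat (- x))" by simp
      then show "x \<in> range (\<lambda>n. - int n)" by blast
    qed auto
    finally show ?thesis .
  qed
  have "UNIV = {0..} \<union> {..(0::int)}" by auto
  then show ?thesis
    using summable_on_union[OF 1 2] by simp
qed

lemma bounded_int_if_convergent:
  fixes f :: "int \<Rightarrow> 'a :: real_normed_vector"
  assumes "convergent (\<lambda>n. f (int n))" "convergent (\<lambda>n. f (- int n))"
  shows "\<exists>B. \<forall>r. norm (f r) \<le> B"
proof -
  obtain B1 B2 where B: "\<And>n. norm (f (int n)) \<le> B1" "\<And>n. norm (f (- int n)) \<le> B2"
    using assms[THEN convergent_imp_Bseq] unfolding Bseq_def by metis
  have "norm (f r) \<le> max B1 B2" for r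
    by (cases r rule: int_cases2) (use B in \<open>auto simp: le_max_iff_disj\<close>)
  then show ?thesis by blast
qed

lemma summable_gauss:
  fixes \<rho> t :: real
  assumes "0 < \<rho>" "\<rho> < 1" "0 < t"
  shows "summable (\<lambda>n::nat. \<rho> powi (int n * (int n - 1) div 2) * t ^ n)"
proof -
  define c where "c n = \<rho> powi (int n * (int n - 1) div 2) * t ^ n" for n :: nat
  have c_pos: "c n > 0" for n
    using assms by (simp add: c_def)
  have c_Suc: "c (Suc n) = (\<rho> ^ n * t) * c n" for n
  proof -
    have "int (Suc n) * (int (Suc n) - 1) = int n * (int n - 1) + int n * 2"
      by (simp add: algebra_simps)
    then have "int (Suc n) * (int (Suc n) - 1) div 2 = int n * (int n - 1) div 2 + int n"
      by simp
    then show ?thesis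
      using assms by (simp add: c_def power_int_add)
  qed
  have "(\<lambda>n. \<rho> ^ n * t) \<longlonglongrightarrow> 0 * t"
    using assms by (intro tendsto_intros) auto
  then have "eventually (\<lambda>n. \<rho> ^ n * t < 1/2) sequentially"
    by (rule order_tendstoD) auto
  then obtain N where N: "\<And>n. n \<ge> N \<Longrightarrow> \<rho> ^ n * t < 1/2"
    by (auto simp: eventually_sequentially)
  have "summable c"
  proof (rule summable_ratio_test)
    show "norm (c (Suc n)) \<le> 1/2 * norm (c n)" if "n \<ge> N" for n
      using N[OF that] c_pos[of n] assms unfolding c_Suc
      by (simp add: abs_mult mult_right_mono)
  qed auto
  then show ?thesis unfolding c_def .
qed

lemma theta_coeff_bound_summable:
  fixes b :: "int \<Rightarrow> complex"
  assumes Q: "norm Q < 1" "Q \<noteq> 0" and z: "z \<noteq> 0" and b: "\<And>r. norm (b r) \<le> B"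
  shows "(\<lambda>r. norm (theta_coeff Q r * z powi r * b r)) summable_on UNIV"
proof -
  have B: "B \<ge> 0" using b[of 0] norm_ge_zero order_trans by blast
  have nrm: "norm (theta_coeff Q r * z powi r * b r) \<le>
      norm Q powi (r * (r - 1) div 2) * norm z powi r * B" for r
    using b[of r] by (simp add: theta_coeff_def norm_mult norm_power_int mult_left_mono)
  show ?thesis
  proof (rule abs_summable_on_int)
    show "summable (\<lambda>n. norm ((theta_coeff Q (int n) * z powi int n * b (int n))))"
    proof (rule summable_comparison_test')
      show "summable (\<lambda>n. norm Q powi (int n * (int n - 1) div 2) * norm z ^ n * B)"
        using Q z by (intro summable_mult2 summable_gauss) auto
      show "norm (norm ((theta_coeff Q (int n) * z powi int n * b (int n)))) \<le>
          norm Q powi (int n * (int n - 1) div 2) * norm z ^ n * B" for n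
        using nrm[of "int n"] by simp
    qed
    show "summable (\<lambda>n. norm ((theta_coeff Q (- int n) * z powi (- int n) * b (- int n))))"
    proof (rule summable_comparison_test')
      show "summable (\<lambda>n. norm Q powi (int n * (int n - 1) div 2) * (norm Q / norm z) ^ n * B)"
        using Q z by (intro summable_mult2 summable_gauss) auto
      show "norm (norm ((theta_coeff Q (- int n) * z powi (- int n) * b (- int n)))) \<le>
          norm Q powi (int n * (int n - 1) div 2) * (norm Q / norm z) ^ n * B" for n
      proof -
        \<comment> \<open>On the negative side the quadratic exponent gains n, so the same Gaussian
          majorant applies with |Q|/|z| in place of |z|.\<close>
        have "(- int n) * (- int n - 1) = int n * (int n - 1) + int n * 2"
          by (simp add: algebra_simps)
        then have e: "(- int n) * (- int n - 1) div 2 = int n * (int n - 1) div 2 + int n"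
          by simp
        show ?thesis
          using nrm[of "- int n"] Q z unfolding e
          by (simp add: power_int_add power_int_minus power_divide field_simps)
      qed
    qed
  qed
qed

text \<open>The factor tends to 1 as r grows and, for nonzero \<open>y\<close>, to 0 as r decreases.
  At a pole division by 0 gives 0, so the bound, and with it the convergence of
  \<open>lerch\<close>, holds for every \<open>y\<close>.\<close>

lemma bounded_lerch_factor:
  assumes Q: "norm Q < 1" "Q \<noteq> 0"
  shows "\<exists>B. \<forall>r::int. norm (1 / (1 - Q powi r * y :: complex)) \<le> B"
proof (cases "y = 0")
  case False
  have lim: "(\<lambda>n. Q ^ n) \<longlonglongrightarrow> 0"
    using Q by (simp add: LIMSEQ_power_zero)
  show ?thesis
  proof (rule bounded_int_if_convergent)
    have "(\<lambda>n. 1 / (1 - Q ^ n * y)) \<longlonglongrightarrow> 1 / (1 - 0 * y)"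
      by (intro tendsto_intros lim) auto
    then show "convergent (\<lambda>n. 1 / (1 - Q powi int n * y))"
      by (auto simp: convergent_def)
    have "(\<lambda>n. Q ^ n / (Q ^ n - y)) \<longlonglongrightarrow> 0 / (0 - y)"
      by (intro tendsto_intros lim) (use False in auto)
    moreover have "Q ^ n / (Q ^ n - y) = 1 / (1 - Q powi (- int n) * y)" for n
      using Q by (cases "Q ^ n = y") (auto simp: power_int_minus field_simps)
    ultimately show "convergent (\<lambda>n. 1 / (1 - Q powi (- int n) * y))"
      by (auto simp: convergent_def)
  qed
qed (auto intro!: exI[of _ 1])

lemma theta_abs_summable:
  assumes "norm Q < 1" "Q \<noteq> 0" "z \<noteq> 0"
  shows "(\<lambda>r. norm (theta_coeff Q r * z powi r)) summable_on UNIV"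
  using theta_coeff_bound_summable[OF assms, of "\<lambda>_. 1" 1] by simp

lemma lerch_abs_summable:
  assumes "norm Q < 1" "Q \<noteq> 0" "z \<noteq> 0"
  shows "(\<lambda>r. norm (theta_coeff Q r * z powi r / (1 - Q powi r * y))) summable_on UNIV"
proof -
  obtain B where "\<And>r::int. norm (1 / (1 - Q powi r * y)) \<le> B"
    using bounded_lerch_factor[OF assms(1,2)] by blast
  from theta_coeff_bound_summable[OF assms this] show ?thesis by simp
qed

lemma theta_has_sum:
  assumes "norm Q < 1" "Q \<noteq> 0" "z \<noteq> 0"
  shows "((\<lambda>r. theta_coeff Q r * z powi r) has_sum theta Q z) UNIV"
  unfolding theta_def using abs_summable_summable[OF theta_abs_summable[OF assms]] by simp

lemma lerch_has_sum:
  assumes "norm Q < 1" "Q \<noteq> 0" "z \<noteq> 0"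
  shows "((\<lambda>r. theta_coeff Q r * z powi r / (1 - Q powi r * y)) has_sum lerch Q y z) UNIV"
  unfolding lerch_def using abs_summable_summable[OF lerch_abs_summable[OF assms]] by simp

section \<open>Index shifts, quasi-periodicity and zeros of theta\<close>

lemma has_sum_int_shift: "((\<lambda>r. f (r + c)) has_sum S) UNIV \<longleftrightarrow> (f has_sum S) (UNIV :: int set)"
  by (rule has_sum_reindex_bij_witness[of _ "\<lambda>r. r - c" "\<lambda>r. r + c"]) auto

lemma has_sum_int_reflect: "((\<lambda>r. f (c - r)) has_sum S) UNIV \<longleftrightarrow> (f has_sum S) (UNIV :: int set)"
  by (rule has_sum_reindex_bij_witness[of _ "\<lambda>r. c - r" "\<lambda>r. c - r"]) auto

lemma theta_mult_base:
  assumes "norm Q < 1" "Q \<noteq> 0" "z \<noteq> 0"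
  shows "theta Q (Q * z) = - theta Q z / z"
proof -
  have "((\<lambda>r. theta_coeff Q (r + 1) * z powi (r + 1)) has_sum theta Q z) UNIV"
    using theta_has_sum[OF assms] by (subst has_sum_int_shift)
  then have "((\<lambda>r. (- 1 / z) * (theta_coeff Q (r + 1) * z powi (r + 1))) has_sum
      (- 1 / z) * theta Q z) UNIV"
    by (rule has_sum_cmult_right)
  moreover have "(- 1 / z) * (theta_coeff Q (r + 1) * z powi (r + 1)) =
      theta_coeff Q r * (Q * z) powi r" for r
    using assms by (simp add: theta_coeff_Suc power_int_add power_int_mult_distrib)
  ultimately show ?thesis
    using has_sum_unique[OF theta_has_sum[of Q "Q * z"]] assms by simp
qed

lemma theta_mult_base_powi:
  assumes "norm Q < 1" "Q \<noteq> 0" "z \<noteq> 0"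
  shows "theta Q (Q powi k * z) = theta Q z / (theta_coeff Q k * z powi k)"
proof -
  have "((\<lambda>r. theta_coeff Q (r + k) * z powi (r + k)) has_sum theta Q z) UNIV"
    using theta_has_sum[OF assms] by (subst has_sum_int_shift)
  then have "((\<lambda>r. 1 / (theta_coeff Q k * z powi k) * (theta_coeff Q (r + k) * z powi (r + k))) has_sum
      1 / (theta_coeff Q k * z powi k) * theta Q z) UNIV"
    by (rule has_sum_cmult_right)
  moreover have "1 / (theta_coeff Q k * z powi k) * (theta_coeff Q (r + k) * z powi (r + k)) =
      theta_coeff Q r * (Q powi k * z) powi r" for r
    using assms by (simp add: theta_coeff_add power_int_add power_int_mult_distrib power_int_mult mult.commute)
  ultimately show ?thesis
    using has_sum_unique[OF theta_has_sum[of Q "Q powi k * z"]] assms by simp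
qed

text \<open>The reflection r -> 1 - r negates every coefficient, so the sum equals its own
  negative.\<close>

lemma theta_one:
  assumes "norm Q < 1" "Q \<noteq> 0"
  shows "theta Q 1 = 0"
proof -
  have h: "(theta_coeff Q has_sum theta Q 1) UNIV"
    using theta_has_sum[OF assms, of 1] by simp
  then have "((\<lambda>r. theta_coeff Q (1 - r)) has_sum theta Q 1) UNIV"
    by (subst has_sum_int_reflect)
  then have "((\<lambda>r. - theta_coeff Q r) has_sum theta Q 1) UNIV"
    using assms by (simp add: theta_coeff_reflect)
  then have "theta Q 1 = - theta Q 1"
    using has_sum_uminusI[OF h] has_sum_unique by blast
  then show ?thesis by simp
qed

lemma theta_powi:
  assumes "norm Q < 1" "Q \<noteq> 0"
  shows "theta Q (Q powi k) = 0"
  using theta_mult_base_powi[OF assms, of 1 k] theta_one[OF assms] by simp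

text \<open>Fubini along (r, s) -> (r + s, r). For two absolutely convergent Laurent series this
  gives the coefficients of the product as convergent bilateral sums.\<close>

lemma int_cauchy_product:
  fixes f g :: "int \<Rightarrow> complex"
  assumes f: "(\<lambda>r. norm (f r)) summable_on UNIV" and g: "(\<lambda>r. norm (g r)) summable_on UNIV"
  shows "(\<lambda>r. f r * g (n - r)) summable_on UNIV"
    and "((\<lambda>n. \<Sum>\<^sub>\<infinity>r\<in>UNIV. f r * g (n - r)) has_sum infsum f UNIV * infsum g UNIV) UNIV"
proof -
  define h where "h = (\<lambda>(r, s). f r * g s)"
  have "(\<lambda>p. norm (h p)) summable_on (UNIV \<times> UNIV)"
  proof (rule summable_on_SigmaI)
    show "((\<lambda>s. norm (h (r, s))) has_sum norm (f r) * infsum (\<lambda>s. norm (g s)) UNIV) UNIV" for r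
      unfolding h_def using g by (auto simp: norm_mult intro!: has_sum_cmult_right)
    show "(\<lambda>r. norm (f r) * infsum (\<lambda>s. norm (g s)) UNIV) summable_on UNIV"
      using f by (rule summable_on_cmult_left)
  qed auto
  then have h: "h summable_on (UNIV \<times> UNIV)"
    by (rule abs_summable_summable)
  have sums: "(f has_sum infsum f UNIV) UNIV" "(g has_sum infsum g UNIV) UNIV"
    using f g abs_summable_summable has_sum_infsum by blast+
  have "(h has_sum infsum f UNIV * infsum g UNIV) (UNIV \<times> UNIV)"
    by (rule has_sum_SigmaI[OF _ _ h, where g = "\<lambda>r. f r * infsum g UNIV"])
       (auto simp: h_def intro!: has_sum_cmult_right has_sum_cmult_left sums)
  then have "((\<lambda>(n, r). f r * g (n - r)) has_sum infsum f UNIV * infsum g UNIV) (UNIV \<times> UNIV)"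
    by (subst has_sum_reindex_bij_witness[of _ "\<lambda>(r, s). (r + s, r)" "\<lambda>(n, r). (r, n - r)"
          "UNIV \<times> UNIV" h])
       (auto simp: h_def)
  then have s: "((\<lambda>(n, r). f r * g (n - r)) has_sum infsum f UNIV * infsum g UNIV) (UNIV \<times> UNIV)" .
  then have s': "(\<lambda>(n, r). f r * g (n - r)) summable_on (UNIV \<times> UNIV)"
    by (rule has_sum_imp_summable)
  show inner: "(\<lambda>r. f r * g (n - r)) summable_on UNIV" for n
    using summable_on_SigmaD1[OF s', of n] by simp
  show "((\<lambda>n. \<Sum>\<^sub>\<infinity>r\<in>UNIV. f r * g (n - r)) has_sum infsum f UNIV * infsum g UNIV) UNIV"
    by (rule has_sum_SigmaD[OF s]) (use inner in auto)
qed

text \<open>The algebraic form of the fact that theta functions with a given multiplier span a line: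
  the quotient of \<open>h\<close> by the theta coefficients is invariant under n -> n + 1.\<close>

lemma theta_coeff_recurrence:
  assumes Q: "Q \<noteq> 0" "w \<noteq> 0" and h: "\<And>n. h (n + 1) = - (Q powi n) * w * h n"
  shows "h n = h 0 * (theta_coeff Q n * w powi n)"
proof -
  define k where "k n = h n / (theta_coeff Q n * w powi n)" for n
  have k_Suc: "k (n + 1) = k n" for n
    using Q unfolding k_def h by (simp add: theta_coeff_Suc power_int_add)
  have "k n = k 0"
  proof (induction n rule: int_induct[where k = 0])
    case (step2 i)
    then show ?case using k_Suc[of "i - 1"] by simp
  qed (simp_all add: k_Suc)
  then show ?thesis
    using Q by (simp add: k_def field_simps)
qed

text \<open>Fixing the pole parameters \<open>y0\<close>, \<open>y1\<close> and varying \<open>u\<close>, instead of varying the first argument of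
  the Appell--Lerch series, makes both sides Laurent series in \<open>u\<close> without poles.\<close>

lemma lerch_change_of_argument_aux:
  assumes Q: "norm Q < 1" "Q \<noteq> 0"
    and y: "theta Q y0 \<noteq> 0" "theta Q y1 \<noteq> 0" and nz: "y0 \<noteq> 0" "y1 \<noteq> 0" "u \<noteq> 0"
  shows "theta Q (y0 * u) * lerch Q y1 (y1 * u) - theta Q (y1 * u) * lerch Q y0 (y0 * u) =
    - (lerch Q y0 1 * theta Q (y1 / y0) / theta Q y1) * theta Q (y0 * y1 * u)"
proof -
  have reg: "1 - Q powi r * y \<noteq> 0" if "theta Q y \<noteq> 0" for r y
  proof
    assume "1 - Q powi r * y = 0"
    then have "y = Q powi (- r)"
      using Q by (simp add: power_int_minus field_simps)
    then show False using theta_powi[OF Q] that by simp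
  qed
  define f where "f y u r = theta_coeff Q r * (y * u) powi r / (1 - Q powi r * y)" for y u r
  define g where "g y u r = theta_coeff Q r * (y * u) powi r" for y u r
  have f_sum: "(\<lambda>r. norm (f y u r)) summable_on UNIV" if "y \<noteq> 0" "u \<noteq> 0" for y u
    unfolding f_def using lerch_abs_summable[of Q "y * u" y] Q that by simp
  have g_sum: "(\<lambda>r. norm (g y u r)) summable_on UNIV" if "y \<noteq> 0" "u \<noteq> 0" for y u
    unfolding g_def using theta_abs_summable[of Q "y * u"] Q that by simp
  \<comment> \<open>\<open>c a b n\<close> is the coefficient of u^n in
    \<open>theta Q (a * u) * lerch Q b (b * u)\<close>, and \<open>t a b n\<close> the one in
    \<open>theta Q (a * u) * theta Q (b * u)\<close>.\<close>
  define c where "c a b n = (\<Sum>\<^sub>\<infinity>r\<in>UNIV. f b 1 r * g a 1 (n - r))" for a b n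
  define t where "t a b n = (\<Sum>\<^sub>\<infinity>r\<in>UNIV. g b 1 r * g a 1 (n - r))" for a b n
  have t_comm: "t a b n = t b a n" for a b n
    unfolding t_def
    by (rule infsum_reindex_bij_witness[of _ "\<lambda>r. n - r" "\<lambda>r. n - r"]) auto
  \<comment> \<open>From 1/(1 - Q^r b) = 1 + Q^r b/(1 - Q^r b): the power Q^r cancels against
    Q^(n-r), which leaves a two-term recurrence with inhomogeneity \<open>t\<close>. As
    \<open>t\<close> is symmetric in \<open>a\<close> and \<open>b\<close>, the difference
    \<open>h\<close> below satisfies the homogeneous recurrence.\<close>
  have c_Suc: "c a b (n + 1) = - (Q powi n) * (a * b) * c a b n + t a b (n + 1)"
    if ab: "theta Q b \<noteq> 0" "a \<noteq> 0" "b \<noteq> 0" for a b n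
  proof -
    have e: "f b 1 r * g a 1 (n + 1 - r) =
        - (Q powi n) * (a * b) * (f b 1 r * g a 1 (n - r)) + g b 1 r * g a 1 (n + 1 - r)" for r
    proof -
      have g1: "g a 1 (n + 1 - r) = - (Q powi n / Q powi r) * a * g a 1 (n - r)"
        using theta_coeff_Suc[OF Q(2), of "n - r"] Q ab
        by (simp add: g_def power_int_add power_int_diff algebra_simps)
      show ?thesis
        unfolding g1 using reg[OF ab(1), of r] Q
        by (simp add: f_def g_def field_simps)
    qed
    have s1: "((\<lambda>r. f b 1 r * g a 1 (n - r)) has_sum c a b n) UNIV"
      unfolding c_def using ab by (intro has_sum_infsum int_cauchy_product f_sum g_sum) auto
    have s2: "((\<lambda>r. g b 1 r * g a 1 (n + 1 - r)) has_sum t a b (n + 1)) UNIV"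
      unfolding t_def using ab by (intro has_sum_infsum int_cauchy_product f_sum g_sum) auto
    show ?thesis
      using has_sum_add[OF has_sum_cmult_right[OF s1, of "- (Q powi n) * (a * b)"] s2]
      unfolding c_def[of a b "n + 1"] e by (rule infsumI)
  qed
  have c_u: "((\<lambda>n. c a b n * u powi n) has_sum theta Q (a * u) * lerch Q b (b * u)) UNIV"
    if "a \<noteq> 0" "b \<noteq> 0" "u \<noteq> 0" for a b u
  proof -
    have "((\<lambda>n. \<Sum>\<^sub>\<infinity>r\<in>UNIV. f b u r * g a u (n - r)) has_sum
        infsum (f b u) UNIV * infsum (g a u) UNIV) UNIV"
      using that by (intro int_cauchy_product f_sum g_sum)
    moreover have "f b u r * g a u (n - r) = f b 1 r * g a 1 (n - r) * u powi n" for r n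
    proof -
      have "f b u r = f b 1 r * u powi r" "g a u (n - r) = g a 1 (n - r) * u powi (n - r)"
        by (simp_all add: f_def g_def power_int_mult_distrib)
      moreover have "u powi r * u powi (n - r) = u powi n"
        using that by (simp flip: power_int_add)
      ultimately show ?thesis by (simp add: algebra_simps)
    qed
    ultimately have "((\<lambda>n. c a b n * u powi n) has_sum infsum (f b u) UNIV * infsum (g a u) UNIV) UNIV"
      unfolding c_def by (simp only: infsum_cmult_left')
    moreover have "infsum (f b u) UNIV = lerch Q b (b * u)" "infsum (g a u) UNIV = theta Q (a * u)"
      by (simp_all add: f_def[abs_def] g_def[abs_def] theta_def lerch_def)
    ultimately show ?thesis by (simp add: mult.commute)
  qed
  define h where "h n = c y0 y1 n - c y1 y0 n" for n
  have h: "h n = h 0 * (theta_coeff Q n * (y0 * y1) powi n)" for n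
  proof (rule theta_coeff_recurrence)
    show "h (n + 1) = - (Q powi n) * (y0 * y1) * h n" for n
      unfolding h_def c_Suc[OF y(2) nz(1,2)] c_Suc[OF y(1) nz(2,1)] t_comm[of y1 y0]
      by (simp add: algebra_simps)
  qed (use Q nz in auto)
  have G: "theta Q (y0 * u) * lerch Q y1 (y1 * u) - theta Q (y1 * u) * lerch Q y0 (y0 * u) =
      h 0 * theta Q (y0 * y1 * u)" if u: "u \<noteq> 0" for u
  proof -
    have "((\<lambda>n. h n * u powi n) has_sum
        theta Q (y0 * u) * lerch Q y1 (y1 * u) - theta Q (y1 * u) * lerch Q y0 (y0 * u)) UNIV"
      using has_sum_add[OF c_u[OF nz(1,2) u] has_sum_uminusI[OF c_u[OF nz(2,1) u]]]
      by (simp add: h_def algebra_simps)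
    moreover have "((\<lambda>n. h 0 * (theta_coeff Q n * (y0 * y1 * u) powi n)) has_sum
        h 0 * theta Q (y0 * y1 * u)) UNIV"
      using Q nz u by (intro has_sum_cmult_right theta_has_sum) auto
    moreover have "h n * u powi n = h 0 * (theta_coeff Q n * (y0 * y1 * u) powi n)" for n
      by (subst h) (simp add: power_int_mult_distrib)
    ultimately show ?thesis
      using has_sum_unique by simp
  qed
  \<comment> \<open>At \<open>u = 1 / y0\<close> the factor \<open>theta Q (y0 * u)\<close> is theta
    at 1 and vanishes, so a single product survives and determines \<open>h 0\<close>. This is how
    \<open>lerch Q y0 1\<close> enters.\<close>
  have "- (theta Q (y1 / y0) * lerch Q y0 1) = h 0 * theta Q y1"
    using G[of "1 / y0"] nz theta_one[OF Q] by simp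
  then have "h 0 = - (lerch Q y0 1 * theta Q (y1 / y0) / theta Q y1)"
    using y by (simp add: field_simps)
  then show ?thesis using G[OF nz(3)] by simp
qed

section \<open>Jacobi's triple product and the partial fractions of the inverse theta function\<close>

text \<open>Tannery's theorem over an arbitrary index set. It serves both for letting the Gaussian
  binomials tend to infinity and for removing the bound on the parts of overpartitions.\<close>

lemma tendsto_infsum_dominated:
  fixes f :: "nat \<Rightarrow> 'a \<Rightarrow> complex"
  assumes lim: "\<And>x. x \<in> A \<Longrightarrow> (\<lambda>n. f n x) \<longlonglongrightarrow> g x"
    and bound: "\<And>n x. x \<in> A \<Longrightarrow> norm (f n x) \<le> M x"
    and M: "M summable_on A"
  shows "(\<lambda>n. infsum (f n) A) \<longlonglongrightarrow> infsum g A"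
proof (rule LIMSEQ_I)
  fix e :: real assume e: "e > 0"
  have g_bound: "norm (g x) \<le> M x" if "x \<in> A" for x
    using tendsto_norm[OF lim[OF that]] by (rule LIMSEQ_le_const2) (use bound[OF that] in auto)
  obtain F where F: "finite F" "F \<subseteq> A" "dist (sum M F) (infsum M A) \<le> e / 4"
    using infsum_finite_approximation[OF M, of "e / 4"] e by auto
  have tail: "norm (infsum h A - sum h F) \<le> e / 4" if h: "\<And>x. x \<in> A \<Longrightarrow> norm (h x) \<le> M x"
    for h :: "'a \<Rightarrow> complex"
  proof -
    have hA: "h summable_on A"
      using Infinite_Sum.abs_summable_on_comparison_test'[OF M h] by (rule abs_summable_summable)
    have hAF: "h summable_on (A - F)" and MAF: "M summable_on (A - F)"
      by (auto intro: summable_on_subset[OF hA] summable_on_subset[OF M])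
    have "infsum h A = infsum h F + infsum h (A - F)" "infsum M A = infsum M F + infsum M (A - F)"
      using infsum_Un_disjoint[OF summable_on_finite[OF F(1)] hAF]
        infsum_Un_disjoint[OF summable_on_finite[OF F(1)] MAF] F(2) by (auto simp: Un_absorb1)
    moreover have "norm (infsum h (A - F)) \<le> infsum M (A - F)"
      using h by (intro norm_infsum_le[OF has_sum_infsum[OF hAF] has_sum_infsum[OF MAF]]) auto
    ultimately show ?thesis using F by (simp add: dist_real_def)
  qed
  have "(\<lambda>n. sum (f n) F) \<longlonglongrightarrow> sum g F"
    using lim F by (intro tendsto_sum) auto
  then obtain N where N: "\<And>n. n \<ge> N \<Longrightarrow> norm (sum (f n) F - sum g F) < e / 2"
    using e by (meson LIMSEQ_D half_gt_zero)
  have "norm (infsum (f n) A - infsum g A) < e" if "n \<ge> N" for n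
  proof -
    have "infsum (f n) A - infsum g A = (infsum (f n) A - sum (f n) F) +
        (sum (f n) F - sum g F) - (infsum g A - sum g F)" by simp
    also have "norm \<dots> \<le> norm (infsum (f n) A - sum (f n) F) +
        norm (sum (f n) F - sum g F) + norm (infsum g A - sum g F)"
      by (intro order_trans[OF norm_triangle_ineq4] add_right_mono norm_triangle_ineq)
    also have "\<dots> < e"
      using tail[of "f n"] tail[of g] N[OF that] bound g_bound by fastforce
    finally show ?thesis .
  qed
  then show "\<exists>N. \<forall>n\<ge>N. norm (infsum (f n) A - infsum g A) < e" by blast
qed

lemma qpoch_convergent:
  fixes x Q :: complex
  assumes "norm Q < 1"
  shows "convergent_prod (\<lambda>k. 1 - x * Q ^ k)"
proof (intro abs_convergent_prod_imp_convergent_prod summable_imp_abs_convergent_prod)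
  show "summable (\<lambda>i. norm (1 - x * Q ^ i - 1))"
    using assms by (simp add: norm_mult norm_power summable_mult)
qed

lemma qpoch_LIMSEQ:
  fixes x Q :: complex
  assumes "norm Q < 1"
  shows "(\<lambda>n. \<Prod>k<n. 1 - x * Q ^ k) \<longlonglongrightarrow> qpoch x Q"
  using convergent_prod_LIMSEQ[OF qpoch_convergent[OF assms]]
  unfolding qpoch_def by (subst filterlim_sequentially_Suc[symmetric]) (simp add: lessThan_Suc_atMost)

lemma qpoch_nonzero:
  fixes x Q :: complex
  assumes "norm Q < 1" "\<And>k. x * Q ^ k \<noteq> 1"
  shows "qpoch x Q \<noteq> 0"
  unfolding qpoch_def using assms by (intro prodinf_nonzero qpoch_convergent) auto

lemma power_neq_1: "norm (Q :: complex) < 1 \<Longrightarrow> n > 0 \<Longrightarrow> Q ^ n \<noteq> 1"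
  using power_less_one_iff[of "norm Q" n] by (metis norm_ge_zero norm_one norm_power less_irrefl)

section \<open>Gaussian binomials: finite q-binomial theorem and finite partial fractions\<close>

definition qfact :: "complex \<Rightarrow> nat \<Rightarrow> complex" where
  "qfact Q n = (\<Prod>k<n. 1 - Q ^ Suc k)"

lemma qfact_0 [simp]: "qfact Q 0 = 1"
  and qfact_Suc: "qfact Q (Suc n) = (1 - Q ^ Suc n) * qfact Q n"
  by (simp_all add: qfact_def mult.commute)

lemma qfact_nz [simp]: "norm Q < 1 \<Longrightarrow> qfact Q n \<noteq> 0"
  using power_neq_1[of Q] by (auto simp: qfact_def simp del: power_Suc)

lemma qfact_LIMSEQ: "norm Q < 1 \<Longrightarrow> qfact Q \<longlonglongrightarrow> qpoch Q Q"
  using qpoch_LIMSEQ[of Q Q] by (simp add: qfact_def[abs_def])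

lemma qpoch_base_nz: "norm Q < 1 \<Longrightarrow> qpoch Q Q \<noteq> (0 :: complex)"
  using power_neq_1[of Q "Suc k" for k] by (intro qpoch_nonzero) auto

definition qbinom :: "complex \<Rightarrow> nat \<Rightarrow> nat \<Rightarrow> complex" where
  "qbinom Q N k = (if k \<le> N then qfact Q N / (qfact Q k * qfact Q (N - k)) else 0)"

lemma qbinom_0 [simp]: "norm Q < 1 \<Longrightarrow> qbinom Q N 0 = 1"
  by (simp add: qbinom_def)

lemma qbinom_gt [simp]: "k > N \<Longrightarrow> qbinom Q N k = 0"
  by (simp add: qbinom_def)

text \<open>Of the two q-Pascal rules this one is chosen because Q^(N-k) combines with the factor
  -Q^k from \<open>theta_coeff_Suc\<close> to -Q^N, which no longer depends on k and can be pulled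
  out of sums.\<close>

lemma qbinom_Suc:
  assumes Q: "norm Q < 1" and k: "k \<le> N"
  shows "qbinom Q (Suc N) (Suc k) = qbinom Q N (Suc k) + Q ^ (N - k) * qbinom Q N k"
proof (cases "k = N")
  case True
  then show ?thesis using Q by (simp add: qbinom_def)
next
  case False
  then obtain m where m: "N = Suc (k + m)"
    using k by (metis less_imp_Suc_add order_le_less)
  have "1 - Q ^ Suc m \<noteq> 0" "1 - Q ^ Suc k \<noteq> 0"
    using power_neq_1[OF Q, of "Suc m"] power_neq_1[OF Q, of "Suc k"] by auto
  then have "(1 - Q ^ Suc (Suc (k + m))) / ((1 - Q ^ Suc k) * (1 - Q ^ Suc m)) =
      1 / (1 - Q ^ Suc k) + Q ^ Suc m / (1 - Q ^ Suc m)"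
    by (simp add: divide_simps) (simp add: algebra_simps power_add)
  then have "qfact Q N / (qfact Q k * qfact Q m) * ((1 - Q ^ Suc (Suc (k + m))) / ((1 - Q ^ Suc k) * (1 - Q ^ Suc m))) =
      qfact Q N / (qfact Q k * qfact Q m) * (1 / (1 - Q ^ Suc k) + Q ^ Suc m / (1 - Q ^ Suc m))"
    by simp
  moreover have "qbinom Q (Suc N) (Suc k) =
      qfact Q N / (qfact Q k * qfact Q m) * ((1 - Q ^ Suc (Suc (k + m))) / ((1 - Q ^ Suc k) * (1 - Q ^ Suc m)))"
    using m by (simp add: qbinom_def qfact_Suc Suc_diff_le mult_ac del: power_Suc)
  moreover have "qbinom Q N (Suc k) + Q ^ (N - k) * qbinom Q N k =
      qfact Q N / (qfact Q k * qfact Q m) * (1 / (1 - Q ^ Suc k) + Q ^ Suc m / (1 - Q ^ Suc m))"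
    using m by (simp add: qbinom_def qfact_Suc Suc_diff_le distrib_left add_divide_distrib mult_ac del: power_Suc)
  ultimately show ?thesis by simp
qed

lemma qbinomial_theorem:
  assumes Q: "norm Q < 1" "Q \<noteq> 0"
  shows "(\<Prod>k<N. 1 - x * Q ^ k) = (\<Sum>k\<le>N. theta_coeff Q (int k) * qbinom Q N k * x ^ k)"
proof (induction N)
  case (Suc N)
  let ?c = "\<lambda>k. theta_coeff Q (int k)"
  have c_Suc: "?c (Suc k) = - (Q ^ k) * ?c k" for k
    using theta_coeff_Suc[OF Q(2), of "int k"] by (simp add: add.commute)
  have e: "?c (Suc k) * qbinom Q (Suc N) (Suc k) * x ^ Suc k =
     ?c (Suc k) * qbinom Q N (Suc k) * x ^ Suc k - (x * Q ^ N) * (?c k * qbinom Q N k * x ^ k)"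
    if "k \<le> N" for k
  proof -
    have "Q ^ k * Q ^ (N - k) = Q ^ N" using that by (simp flip: power_add)
    then have "?c (Suc k) * (Q ^ (N - k) * qbinom Q N k) = - (Q ^ N) * ?c k * qbinom Q N k"
      unfolding c_Suc by (simp add: mult_ac)
    then show ?thesis
      unfolding qbinom_Suc[OF Q(1) that] by (simp add: algebra_simps)
  qed
  have "(\<Sum>k\<le>Suc N. ?c k * qbinom Q (Suc N) k * x ^ k) =
      1 + (\<Sum>k\<le>N. ?c (Suc k) * qbinom Q (Suc N) (Suc k) * x ^ Suc k)"
    using Q by (subst sum.atMost_Suc_shift) simp
  also have "\<dots> = 1 + (\<Sum>k\<le>N. ?c (Suc k) * qbinom Q N (Suc k) * x ^ Suc k) -
      (x * Q ^ N) * (\<Sum>k\<le>N. ?c k * qbinom Q N k * x ^ k)"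
    using e by (simp add: sum_subtractf sum_distrib_left)
  also have "1 + (\<Sum>k\<le>N. ?c (Suc k) * qbinom Q N (Suc k) * x ^ Suc k) =
      (\<Sum>k\<le>Suc N. ?c k * qbinom Q N k * x ^ k)"
    using Q by (subst sum.atMost_Suc_shift) simp
  also have "\<dots> = (\<Sum>k\<le>N. ?c k * qbinom Q N k * x ^ k)"
    by simp
  finally show ?case
    using Suc.IH by (simp add: algebra_simps)
qed (use Q in simp)

text \<open>For \<open>N = 2 * n\<close>, \<open>m = n + 1\<close> and \<open>y / Q ^ n\<close> in place of \<open>y\<close>, centring the index turns the sum
  into a truncation of \<open>lerch Q y 1\<close>.\<close>

lemma qbinom_partial_fractions:
  assumes Q: "norm Q < 1" "Q \<noteq> 0" and y: "\<And>k. k \<le> N \<Longrightarrow> y * Q ^ k \<noteq> 1" and m: "m \<le> N"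
  shows "(\<Sum>k\<le>N. theta_coeff Q (int k) * qbinom Q N k * (Q ^ k / Q ^ (m * k)) / (1 - y * Q ^ k)) =
    y ^ m * qfact Q N / (\<Prod>k\<le>N. 1 - y * Q ^ k)"
  using m
proof (induction m)
  case 0
  have "(\<Sum>k\<le>N. theta_coeff Q (int k) * qbinom Q N k * Q ^ k / (1 - y * Q ^ k)) =
      qfact Q N / (\<Prod>k\<le>N. 1 - y * Q ^ k)"
    using y
  \<comment> \<open>One half of the Pascal rule keeps the poles of \<open>y\<close>, the other has
    those of \<open>y * Q\<close>; hence the generalisation over \<open>y\<close>.\<close>
  proof (induction N arbitrary: y)
    case 0
    then show ?case using Q by (simp add: qbinom_def)
  next
    case (Suc N)
    let ?c = "\<lambda>k. theta_coeff Q (int k)"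
    have c_Suc: "?c (Suc k) = - (Q ^ k) * ?c k" for k
      using theta_coeff_Suc[OF Q(2), of "int k"] by (simp add: add.commute)
    have e: "?c (Suc k) * qbinom Q (Suc N) (Suc k) * Q ^ Suc k / (1 - y * Q ^ Suc k) =
       ?c (Suc k) * qbinom Q N (Suc k) * Q ^ Suc k / (1 - y * Q ^ Suc k) -
       Q ^ Suc N * (?c k * qbinom Q N k * Q ^ k / (1 - (y * Q) * Q ^ k))"
      if "k \<le> N" for k
    proof -
      have "Q ^ k * Q ^ (N - k) = Q ^ N" using that by (simp flip: power_add)
      then have "?c (Suc k) * (Q ^ (N - k) * qbinom Q N k) = - (Q ^ N) * ?c k * qbinom Q N k"
        unfolding c_Suc by (simp add: mult_ac)
      then have "?c (Suc k) * qbinom Q (Suc N) (Suc k) * Q ^ Suc k =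
          ?c (Suc k) * qbinom Q N (Suc k) * Q ^ Suc k - Q ^ Suc N * (?c k * qbinom Q N k * Q ^ k)"
        unfolding qbinom_Suc[OF Q(1) that] by (simp add: algebra_simps)
      then show ?thesis
        by (simp add: diff_divide_distrib mult.assoc)
    qed
    have IH: "(\<Sum>k\<le>N. ?c k * qbinom Q N k * Q ^ k / (1 - (y * Q) * Q ^ k)) =
        qfact Q N / (\<Prod>k\<le>N. 1 - (y * Q) * Q ^ k)"
      using Suc.prems[of "Suc _"] by (intro Suc.IH) (auto simp: mult.assoc)
    have IH0: "(\<Sum>k\<le>N. ?c k * qbinom Q N k * Q ^ k / (1 - y * Q ^ k)) =
        qfact Q N / (\<Prod>k\<le>N. 1 - y * Q ^ k)"
      using Suc.prems by (intro Suc.IH) auto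
    have "(\<Sum>k\<le>Suc N. ?c k * qbinom Q (Suc N) k * Q ^ k / (1 - y * Q ^ k)) =
        1 / (1 - y) + (\<Sum>k\<le>N. ?c (Suc k) * qbinom Q (Suc N) (Suc k) * Q ^ Suc k / (1 - y * Q ^ Suc k))"
      using Q by (subst sum.atMost_Suc_shift) simp
    also have "\<dots> = 1 / (1 - y) + (\<Sum>k\<le>N. ?c (Suc k) * qbinom Q N (Suc k) * Q ^ Suc k / (1 - y * Q ^ Suc k)) -
       Q ^ Suc N * (\<Sum>k\<le>N. ?c k * qbinom Q N k * Q ^ k / (1 - (y * Q) * Q ^ k))"
      using e by (simp add: sum_subtractf sum_distrib_left del: power_Suc)
    also have "1 / (1 - y) + (\<Sum>k\<le>N. ?c (Suc k) * qbinom Q N (Suc k) * Q ^ Suc k / (1 - y * Q ^ Suc k)) =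
       (\<Sum>k\<le>Suc N. ?c k * qbinom Q N k * Q ^ k / (1 - y * Q ^ k))"
      using Q by (subst sum.atMost_Suc_shift) simp
    also have "\<dots> = (\<Sum>k\<le>N. ?c k * qbinom Q N k * Q ^ k / (1 - y * Q ^ k))"
      by simp
    finally have S: "(\<Sum>k\<le>Suc N. ?c k * qbinom Q (Suc N) k * Q ^ k / (1 - y * Q ^ k)) =
        qfact Q N / (\<Prod>k\<le>N. 1 - y * Q ^ k) - Q ^ Suc N * (qfact Q N / (\<Prod>k\<le>N. 1 - (y * Q) * Q ^ k))"
      unfolding IH IH0 .
    \<comment> \<open>\<open>P\<close> is the common middle part: the two products differ only in
      the end factors 1 - y and 1 - y Q^(N+1), and combining the fractions produces the missing
      numerator 1 - Q^(N+1).\<close>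
    define P where "P = (\<Prod>k<N. 1 - y * Q ^ Suc k)"
    have P1: "(\<Prod>k\<le>N. 1 - y * Q ^ k) = (1 - y) * P"
      unfolding P_def lessThan_Suc_atMost[symmetric] by (subst prod.lessThan_Suc_shift) simp
    have P2: "(\<Prod>k\<le>N. 1 - (y * Q) * Q ^ k) = P * (1 - y * Q ^ Suc N)"
      unfolding P_def lessThan_Suc_atMost[symmetric] by (simp add: mult.assoc)
    have P3: "(\<Prod>k\<le>Suc N. 1 - y * Q ^ k) = (1 - y) * P * (1 - y * Q ^ Suc N)"
      using P1 by simp
    have nz: "P \<noteq> 0" "1 - y \<noteq> 0" "1 - y * Q ^ Suc N \<noteq> 0"
      using Suc.prems[of "Suc _"] Suc.prems[of 0] Suc.prems[of "Suc N"]
      unfolding P_def by (auto simp del: power_Suc)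
    show ?case
      unfolding S unfolding P1 P2 P3 qfact_Suc using nz
      by (simp add: divide_simps del: power_Suc) (simp add: algebra_simps)
  qed
  then show ?case by simp
next
  case (Suc m)
  let ?c = "\<lambda>k. theta_coeff Q (int k) * qbinom Q N k"
  have e: "?c k * (Q ^ k / Q ^ (Suc m * k)) / (1 - y * Q ^ k) =
      y * (?c k * (Q ^ k / Q ^ (m * k)) / (1 - y * Q ^ k)) + ?c k * (1 / Q ^ m) ^ k" if "k \<le> N" for k
  proof -
    define A where "A = ?c k / Q ^ (m * k)"
    have "Q ^ k / Q ^ (Suc m * k) = 1 / Q ^ (m * k)"
      using Q by (simp add: power_add)
    then have "?c k * (Q ^ k / Q ^ (Suc m * k)) / (1 - y * Q ^ k) = A * (1 / (1 - y * Q ^ k))"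
      by (simp add: A_def)
    also have "1 / (1 - y * Q ^ k) = y * Q ^ k / (1 - y * Q ^ k) + 1"
      using y[OF that] by (simp add: field_simps)
    also have "A * (y * Q ^ k / (1 - y * Q ^ k) + 1) =
        y * (?c k * (Q ^ k / Q ^ (m * k)) / (1 - y * Q ^ k)) + A"
      by (simp add: A_def distrib_left add_divide_distrib mult_ac)
    also have "A = ?c k * (1 / Q ^ m) ^ k"
      by (simp add: A_def power_divide flip: power_mult)
    finally show ?thesis .
  qed
  \<comment> \<open>Raising \<open>m\<close> by one splits off a sum without denominators. It is the
    q-binomial theorem at x = Q^(-m), whose factor with index \<open>m\<close> is 0 because m <
    N.\<close>
  have "(\<Sum>k\<le>N. ?c k * (1 / Q ^ m) ^ k) = (\<Prod>k<N. 1 - 1 / Q ^ m * Q ^ k)"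
    by (rule qbinomial_theorem[OF Q, symmetric])
  also have "\<dots> = 0"
    using Suc.prems Q by (intro prod_zero) (auto intro!: bexI[of _ m])
  finally have "(\<Sum>k\<le>N. ?c k * (Q ^ k / Q ^ (Suc m * k)) / (1 - y * Q ^ k)) =
      y * (\<Sum>k\<le>N. ?c k * (Q ^ k / Q ^ (m * k)) / (1 - y * Q ^ k))"
    using e by (simp add: sum.distrib sum_distrib_left)
  then show ?case using Suc by simp
qed


text \<open>The row \<open>2 * n\<close> indexed from its middle and extended by 0 to all integers:
  finite sums then become bilateral sums over a fixed index set, with termwise limit 1/(Q;Q) as n
  grows.\<close>

definition central_qbinom :: "complex \<Rightarrow> nat \<Rightarrow> int \<Rightarrow> complex" where
  "central_qbinom Q n r = (if \<bar>r\<bar> \<le> int n then qbinom Q (2 * n) (nat (int n + r)) else 0)"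

lemma central_qbinom_LIMSEQ:
  assumes Q: "norm Q < 1"
  shows "(\<lambda>n. central_qbinom Q n r) \<longlonglongrightarrow> 1 / qpoch Q Q"
proof -
  have lims: "filterlim (\<lambda>n. 2 * n :: nat) at_top sequentially"
    by (rule filterlim_subseq) (simp add: strict_mono_def)
  have lims': "filterlim (\<lambda>n. nat (int n + s)) at_top sequentially" for s
    unfolding filterlim_at_top
  proof
    fix Z
    show "eventually (\<lambda>n. Z \<le> nat (int n + s)) sequentially"
      by (rule eventually_sequentiallyI[of "Z + nat \<bar>s\<bar>"]) linarith
  qed
  have "(\<lambda>n. qfact Q (2 * n) / (qfact Q (nat (int n + r)) * qfact Q (nat (int n - r)))) \<longlonglongrightarrow>
      qpoch Q Q / (qpoch Q Q * qpoch Q Q)"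
    using qpoch_base_nz[OF Q]
    by (intro tendsto_intros filterlim_compose[OF qfact_LIMSEQ[OF Q]] lims lims'
        lims'[of "- r", simplified]) auto
  moreover have "eventually (\<lambda>n. qfact Q (2 * n) / (qfact Q (nat (int n + r)) * qfact Q (nat (int n - r))) =
      central_qbinom Q n r) sequentially"
  proof (rule eventually_sequentiallyI)
    fix n assume n: "nat \<bar>r\<bar> \<le> n"
    then have "nat (int n + r) \<le> 2 * n" "2 * n - nat (int n + r) = nat (int n - r)"
      by linarith+
    then show "qfact Q (2 * n) / (qfact Q (nat (int n + r)) * qfact Q (nat (int n - r))) =
        central_qbinom Q n r"
      using n by (simp add: central_qbinom_def qbinom_def)
  qed
  ultimately have "(\<lambda>n. central_qbinom Q n r) \<longlonglongrightarrow> qpoch Q Q / (qpoch Q Q * qpoch Q Q)"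
    by (rule Lim_transform_eventually)
  then show ?thesis using qpoch_base_nz[OF Q] by simp
qed

text \<open>The uniform constant needed for domination. It exists because \<open>qfact\<close> and
  its reciprocal both converge to finite limits.\<close>

lemma central_qbinom_bounded:
  assumes Q: "norm Q < 1"
  shows "\<exists>C. \<forall>n r. norm (central_qbinom Q n r) \<le> C"
proof -
  have "(\<lambda>n. inverse (qfact Q n)) \<longlonglongrightarrow> inverse (qpoch Q Q)"
    using qpoch_base_nz[OF Q] by (intro tendsto_intros qfact_LIMSEQ Q)
  then obtain B where B: "\<And>n. norm (inverse (qfact Q n)) \<le> B"
    using convergent_imp_Bseq[of "\<lambda>n. inverse (qfact Q n)"] unfolding convergent_def Bseq_def by metis
  obtain A where A: "\<And>n. norm (qfact Q n) \<le> A"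
    using convergent_imp_Bseq[of "qfact Q"] qfact_LIMSEQ[OF Q] unfolding convergent_def Bseq_def by metis
  have A0: "A \<ge> 0" and B0: "B \<ge> 0"
    using A[of 0] B[of 0] norm_ge_zero order_trans by blast+
  have "norm (qbinom Q N k) \<le> A * (B * B)" for N k
  proof (cases "k \<le> N")
    case True
    then have "qbinom Q N k = qfact Q N * (inverse (qfact Q k) * inverse (qfact Q (N - k)))"
      by (simp add: qbinom_def field_simps)
    then show ?thesis
      by (simp only: norm_mult) (intro mult_mono A B A0 B0 mult_nonneg_nonneg norm_ge_zero)
  qed (use A0 B0 in auto)
  then have "norm (central_qbinom Q n r) \<le> A * (B * B)" for n r
    using A0 B0 by (simp add: central_qbinom_def)
  then show ?thesis by blast
qed

lemma sum_central:
  fixes f :: "int \<Rightarrow> complex"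
  shows "(\<Sum>k\<le>2 * n. qbinom Q (2 * n) k * f (int k - int n)) =
    (\<Sum>\<^sub>\<infinity>r\<in>UNIV. central_qbinom Q n r * f r)"
proof -
  have "(\<Sum>k\<le>2 * n. qbinom Q (2 * n) k * f (int k - int n)) =
      (\<Sum>r\<in>{- int n..int n}. central_qbinom Q n r * f r)"
    by (rule sum.reindex_bij_witness[of _ "\<lambda>r. nat (int n + r)" "\<lambda>k. int k - int n"])
       (auto simp: central_qbinom_def)
  also have "\<dots> = (\<Sum>\<^sub>\<infinity>r\<in>{- int n..int n}. central_qbinom Q n r * f r)"
    by simp
  also have "\<dots> = (\<Sum>\<^sub>\<infinity>r\<in>UNIV. central_qbinom Q n r * f r)"
    by (rule infsum_cong_neutral) (auto simp: central_qbinom_def)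
  finally show ?thesis .
qed

lemma central_qbinom_infsum_LIMSEQ:
  assumes Q: "norm Q < 1" and f: "(\<lambda>r. norm (f r)) summable_on (UNIV :: int set)"
  shows "(\<lambda>n. \<Sum>\<^sub>\<infinity>r\<in>UNIV. central_qbinom Q n r * f r) \<longlonglongrightarrow> infsum f UNIV / qpoch Q Q"
proof -
  obtain C where C: "\<And>n r. norm (central_qbinom Q n r) \<le> C"
    using central_qbinom_bounded[OF Q] by blast
  have "(\<lambda>n. \<Sum>\<^sub>\<infinity>r\<in>UNIV. central_qbinom Q n r * f r) \<longlonglongrightarrow> (\<Sum>\<^sub>\<infinity>r\<in>UNIV. 1 / qpoch Q Q * f r)"
  proof (rule tendsto_infsum_dominated)
    show "(\<lambda>n. central_qbinom Q n r * f r) \<longlonglongrightarrow> 1 / qpoch Q Q * f r" for r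
      by (intro tendsto_intros central_qbinom_LIMSEQ Q)
    show "norm (central_qbinom Q n r * f r) \<le> C * norm (f r)" for n r
      by (simp add: norm_mult mult_right_mono C)
    show "(\<lambda>r. C * norm (f r)) summable_on UNIV"
      using f by (rule summable_on_cmult_right)
  qed
  then show ?thesis unfolding infsum_cmult_right' by simp
qed

lemma theta_coeff_central:
  assumes "Q \<noteq> 0"
  shows "theta_coeff Q (int k) / Q ^ (n * k) =
    theta_coeff Q (int n) / Q ^ (n * n) * theta_coeff Q (int k - int n)"
proof -
  have "theta_coeff Q (int n + (int k - int n)) =
      theta_coeff Q (int n) * theta_coeff Q (int k - int n) * Q powi (int n * (int k - int n))"
    by (rule theta_coeff_add[OF assms])
  moreover have "Q powi (int n * (int k - int n)) = Q ^ (n * k) / Q ^ (n * n)"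
    using assms by (simp add: right_diff_distrib power_int_diff flip: of_nat_mult)
  ultimately show ?thesis using assms by (simp add: field_simps)
qed

text \<open>The factors with negative powers of Q are turned over: 1 - z/Q^(n+1) equals -(z/Q^(n+1))
  (1 - Q^(n+1)/z), and the monomials accumulate to a theta coefficient.\<close>

lemma prod_central:
  assumes "Q \<noteq> 0" "z \<noteq> 0"
  shows "(\<Prod>k<n. 1 - z / Q ^ n * Q ^ k) =
    theta_coeff Q (int n) * z ^ n / Q ^ (n * n) * (\<Prod>k<n. 1 - Q / z * Q ^ k)"
proof (induction n)
  case (Suc n)
  have c: "theta_coeff Q (int (Suc n)) = - (Q ^ n) * theta_coeff Q (int n)"
    using theta_coeff_Suc[OF assms(1), of "int n"] by (simp add: add.commute)
  have "(\<Prod>k<Suc n. 1 - z / Q ^ Suc n * Q ^ k) =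
      (1 - z / Q ^ Suc n) * (\<Prod>k<n. 1 - z / Q ^ n * Q ^ k)"
    using assms by (subst prod.lessThan_Suc_shift) (simp add: field_simps)
  also have "\<dots> = (1 - z / Q ^ Suc n) * (theta_coeff Q (int n) * z ^ n / Q ^ (n * n) *
      (\<Prod>k<n. 1 - Q / z * Q ^ k))"
    by (simp only: Suc.IH)
  also have "1 - z / Q ^ Suc n = - (z / Q ^ Suc n) * (1 - Q / z * Q ^ n)"
    using assms by (simp add: field_simps)
  also have "- (z / Q ^ Suc n) * (1 - Q / z * Q ^ n) * (theta_coeff Q (int n) * z ^ n / Q ^ (n * n) *
      (\<Prod>k<n. 1 - Q / z * Q ^ k)) =
      theta_coeff Q (int (Suc n)) * z ^ Suc n / Q ^ (Suc n * Suc n) * (\<Prod>k<Suc n. 1 - Q / z * Q ^ k)"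
    unfolding c using assms by (simp add: power_add field_simps)
  finally show ?case .
qed simp

lemma prod_central_full:
  assumes "Q \<noteq> 0" "z \<noteq> 0"
  shows "(\<Prod>k<n + m. 1 - z / Q ^ n * Q ^ k) =
    theta_coeff Q (int n) * z ^ n / Q ^ (n * n) * (\<Prod>k<n. 1 - Q / z * Q ^ k) * (\<Prod>k<m. 1 - z * Q ^ k)"
proof -
  have "(\<Prod>k<n + m. 1 - z / Q ^ n * Q ^ k) =
      (\<Prod>k<n. 1 - z / Q ^ n * Q ^ k) * (\<Prod>k<m. 1 - z / Q ^ n * Q ^ (n + k))"
    by (induction m) (simp_all add: mult.assoc)
  also have "(\<Prod>k<m. 1 - z / Q ^ n * Q ^ (n + k)) = (\<Prod>k<m. 1 - z * Q ^ k)"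
    using assms by (simp add: power_add)
  finally show ?thesis unfolding prod_central[OF assms] .
qed

text \<open>The q-binomial theorem with 2n factors at z/Q^n is a finite symmetric version of the
  identity. Recentring gives both sides the same nonzero monomial factor; after cancelling it, n
  tends to infinity.\<close>

theorem jacobi_triple_product:
  assumes Q: "norm Q < 1" "Q \<noteq> 0" and z: "z \<noteq> 0"
  shows "theta Q z = jtheta z Q"
proof -
  have fin: "(\<Sum>\<^sub>\<infinity>r\<in>UNIV. central_qbinom Q n r * (theta_coeff Q r * z powi r)) =
      (\<Prod>k<n. 1 - Q / z * Q ^ k) * (\<Prod>k<n. 1 - z * Q ^ k)" for n
  proof -
    let ?c = "theta_coeff Q (int n) * z ^ n / Q ^ (n * n)"
    have "(\<Prod>k<n + n. 1 - z / Q ^ n * Q ^ k) =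
        (\<Sum>k\<le>2 * n. theta_coeff Q (int k) * qbinom Q (2 * n) k * (z / Q ^ n) ^ k)"
      using qbinomial_theorem[OF Q, of "z / Q ^ n" "2 * n"] by (simp add: mult_2)
    also have "\<dots> = (\<Sum>k\<le>2 * n. ?c * (qbinom Q (2 * n) k * (theta_coeff Q (int k - int n) * z powi (int k - int n))))"
    proof (rule sum.cong)
      fix k
      have "theta_coeff Q (int k) * qbinom Q (2 * n) k * (z / Q ^ n) ^ k =
          qbinom Q (2 * n) k * z ^ k * (theta_coeff Q (int k) / Q ^ (n * k))"
        by (simp add: power_divide power_mult)
      also have "z ^ k = z ^ n * z powi (int k - int n)"
        using z by (simp add: power_int_diff)
      finally show "theta_coeff Q (int k) * qbinom Q (2 * n) k * (z / Q ^ n) ^ k =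
          ?c * (qbinom Q (2 * n) k * (theta_coeff Q (int k - int n) * z powi (int k - int n)))"
        unfolding theta_coeff_central[OF Q(2), of k n] by (simp add: mult_ac)
    qed simp
    also have "\<dots> = ?c * (\<Sum>\<^sub>\<infinity>r\<in>UNIV. central_qbinom Q n r * (theta_coeff Q r * z powi r))"
      by (simp only: sum_distrib_left[symmetric] sum_central[of Q n "\<lambda>r. theta_coeff Q r * z powi r"])
    finally have "?c * ((\<Prod>k<n. 1 - Q / z * Q ^ k) * (\<Prod>k<n. 1 - z * Q ^ k)) =
        ?c * (\<Sum>\<^sub>\<infinity>r\<in>UNIV. central_qbinom Q n r * (theta_coeff Q r * z powi r))"
      by (simp only: prod_central_full[OF Q(2) z] mult.assoc)
    moreover have "?c \<noteq> 0" using Q z by simp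
    ultimately show ?thesis by (simp only: mult_cancel_left simp_thms)
  qed
  have "(\<lambda>n. (\<Prod>k<n. 1 - Q / z * Q ^ k) * (\<Prod>k<n. 1 - z * Q ^ k)) \<longlonglongrightarrow> theta Q z / qpoch Q Q"
    using central_qbinom_infsum_LIMSEQ[OF Q(1) theta_abs_summable[OF Q z]]
    unfolding fin theta_def .
  moreover have "(\<lambda>n. (\<Prod>k<n. 1 - Q / z * Q ^ k) * (\<Prod>k<n. 1 - z * Q ^ k)) \<longlonglongrightarrow>
      qpoch (Q / z) Q * qpoch z Q"
    by (intro tendsto_mult qpoch_LIMSEQ Q)
  ultimately have "theta Q z / qpoch Q Q = qpoch (Q / z) Q * qpoch z Q"
    by (rule LIMSEQ_unique)
  then show ?thesis
    using qpoch_base_nz[OF Q(1)] by (simp add: jtheta_def field_simps)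
qed

lemma jtheta_nonzero:
  assumes Q: "norm Q < 1" "Q \<noteq> 0" and z: "z \<noteq> 0" "\<And>r::int. z \<noteq> Q powi r"
  shows "jtheta z Q \<noteq> 0"
proof -
  have "z * Q ^ k \<noteq> 1" "Q / z * Q ^ k \<noteq> 1" for k
    using z(2)[of "- int k"] z(2)[of "int (Suc k)"] Q z(1)
    by (auto simp: power_int_minus field_simps power_int_of_nat simp del: of_nat_Suc)
  then show ?thesis
    using Q by (simp add: jtheta_def qpoch_nonzero qpoch_base_nz)
qed

text \<open>The partial fraction expansion of a reciprocal theta function, as the limit of
  \<open>qbinom_partial_fractions\<close>. It supplies the constant in the change of
  argument.\<close>

lemma lerch_at_one:
  assumes Q: "norm Q < 1" "Q \<noteq> 0" and y: "y \<noteq> 0" "\<And>r::int. y \<noteq> Q powi r"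
  shows "lerch Q y 1 = y * qpoch Q Q ^ 3 / jtheta y Q"
proof -
  have reg: "1 - y * Q powi r \<noteq> 0" for r
    using y(2)[of "- r"] Q by (auto simp: power_int_minus field_simps)
  have reg': "1 - Q / y * Q ^ k \<noteq> 0" "1 - y * Q ^ k \<noteq> 0" for k
    using y(2)[of "- int k"] y(2)[of "int (Suc k)"] Q y(1)
    by (auto simp: power_int_minus field_simps power_int_of_nat simp del: of_nat_Suc)
  \<comment> \<open>The instance is \<open>N = 2 * n\<close> with \<open>m = n + 1\<close>, and m
    \<le> N holds from n = 1 on; the limit only sees large n.\<close>
  have fin: "(\<Sum>\<^sub>\<infinity>r\<in>UNIV. central_qbinom Q n r * (theta_coeff Q r / (1 - y * Q powi r))) =
      y * qfact Q (2 * n) / ((\<Prod>k<n. 1 - Q / y * Q ^ k) * (\<Prod>k<Suc n. 1 - y * Q ^ k))"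
    if n: "n \<ge> 1" for n
  proof -
    let ?c = "theta_coeff Q (int n) / Q ^ (n * n)"
    have "(\<Sum>k\<le>2 * n. theta_coeff Q (int k) * qbinom Q (2 * n) k * (Q ^ k / Q ^ (Suc n * k)) / (1 - y / Q ^ n * Q ^ k)) =
        (y / Q ^ n) ^ Suc n * qfact Q (2 * n) / (\<Prod>k\<le>2 * n. 1 - y / Q ^ n * Q ^ k)"
    proof (rule qbinom_partial_fractions[OF Q])
      show "y / Q ^ n * Q ^ k \<noteq> 1" for k
        using reg[of "int k - int n"] Q by (simp add: power_int_diff field_simps)
    qed (use n in auto)
    also have "(\<Prod>k\<le>2 * n. 1 - y / Q ^ n * Q ^ k) = (\<Prod>k<n + Suc n. 1 - y / Q ^ n * Q ^ k)"
      by (rule prod.cong) auto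
    also have "\<dots> = ?c * y ^ n * ((\<Prod>k<n. 1 - Q / y * Q ^ k) * (\<Prod>k<Suc n. 1 - y * Q ^ k))"
      using prod_central_full[OF Q(2) y(1), of n "Suc n"] by (simp add: mult_ac)
    also have "(\<Sum>k\<le>2 * n. theta_coeff Q (int k) * qbinom Q (2 * n) k * (Q ^ k / Q ^ (Suc n * k)) / (1 - y / Q ^ n * Q ^ k)) =
        (\<Sum>k\<le>2 * n. ?c * (qbinom Q (2 * n) k * (theta_coeff Q (int k - int n) / (1 - y * Q powi (int k - int n)))))"
    proof (rule sum.cong)
      fix k
      have "y / Q ^ n * Q ^ k = y * Q powi (int k - int n)"
        using Q by (simp add: power_int_diff)
      moreover have "theta_coeff Q (int k) * qbinom Q (2 * n) k * (Q ^ k / Q ^ (Suc n * k)) =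
          qbinom Q (2 * n) k * (theta_coeff Q (int k) / Q ^ (n * k))"
        using Q by (simp add: power_add)
      ultimately show "theta_coeff Q (int k) * qbinom Q (2 * n) k * (Q ^ k / Q ^ (Suc n * k)) / (1 - y / Q ^ n * Q ^ k) =
          ?c * (qbinom Q (2 * n) k * (theta_coeff Q (int k - int n) / (1 - y * Q powi (int k - int n))))"
        unfolding theta_coeff_central[OF Q(2), of k n] by (simp add: mult_ac)
    qed simp
    also have "\<dots> = ?c * (\<Sum>\<^sub>\<infinity>r\<in>UNIV. central_qbinom Q n r * (theta_coeff Q r / (1 - y * Q powi r)))"
      by (simp only: sum_distrib_left[symmetric] sum_central[of Q n "\<lambda>r. theta_coeff Q r / (1 - y * Q powi r)"])
    finally have eq: "?c * (\<Sum>\<^sub>\<infinity>r\<in>UNIV. central_qbinom Q n r * (theta_coeff Q r / (1 - y * Q powi r))) =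
        (y / Q ^ n) ^ Suc n * qfact Q (2 * n) /
        (?c * y ^ n * ((\<Prod>k<n. 1 - Q / y * Q ^ k) * (\<Prod>k<Suc n. 1 - y * Q ^ k)))" .
    \<comment> \<open>One factor \<open>?c\<close> comes from recentring the sum, the other from the
      product in the denominator. Their product is exactly the power of Q contained in
      \<open>(y / Q ^ n) ^ Suc n\<close>, so only y remains.\<close>
    have sq: "?c * ?c = 1 / Q ^ (n * Suc n)"
    proof -
      have "theta_coeff Q (int n) * theta_coeff Q (int n) = Q powi (2 * (int n * (int n - 1) div 2))"
        unfolding mult_2 power_int_add[OF disjI1[OF Q(2)]] by (simp add: theta_coeff_def)
      also have "2 * (int n * (int n - 1) div 2) = int (n * n) - int n"
        by (simp add: algebra_simps)
      also have "Q powi (int (n * n) - int n) = Q ^ (n * n) / Q ^ n"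
        using Q by (simp add: power_int_diff flip: of_nat_mult)
      finally have "theta_coeff Q (int n) * theta_coeff Q (int n) = Q ^ (n * n) / Q ^ n" .
      then show ?thesis using Q by (simp add: power_add)
    qed
    have c_nz: "?c \<noteq> 0" using Q by simp
    have *: "s = y * a / P" if "c * s = (y / q) ^ Suc n * a / (c * y ^ n * P)" "c * c = 1 / q ^ Suc n"
       "c \<noteq> 0" "q \<noteq> 0" for c s q a P :: complex
    proof -
      have "(c * c) * s = c * ((y / q) ^ Suc n * a / (c * y ^ n * P))"
        using that(1) by (simp add: mult.assoc)
      also have "\<dots> = y * a / P * (1 / q ^ Suc n)"
        using that y by (simp add: power_divide)
      finally have "1 / q ^ Suc n * s = 1 / q ^ Suc n * (y * a / P)"
        unfolding that(2) by (simp only: mult.commute)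
      moreover have "1 / q ^ Suc n \<noteq> 0" using that by simp
      ultimately show ?thesis by (simp only: mult_cancel_left simp_thms)
    qed
    show ?thesis
      using Q by (intro *[OF eq sq[unfolded power_mult[of Q n "Suc n"]] c_nz]) auto
  qed
  have "(\<lambda>n. \<Sum>\<^sub>\<infinity>r\<in>UNIV. central_qbinom Q n r * (theta_coeff Q r / (1 - y * Q powi r))) \<longlonglongrightarrow>
      lerch Q y 1 / qpoch Q Q"
    using central_qbinom_infsum_LIMSEQ[OF Q(1) lerch_abs_summable[OF Q, of 1 y]]
    by (simp add: lerch_def mult.commute)
  moreover have "(\<lambda>n. \<Sum>\<^sub>\<infinity>r\<in>UNIV. central_qbinom Q n r * (theta_coeff Q r / (1 - y * Q powi r))) \<longlonglongrightarrow>
      y * qpoch Q Q / (qpoch (Q / y) Q * qpoch y Q)"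
  proof (rule Lim_transform_eventually)
    have "filterlim (\<lambda>n. 2 * n :: nat) at_top sequentially"
      by (rule filterlim_subseq) (simp add: strict_mono_def)
    then show "(\<lambda>n. y * qfact Q (2 * n) / ((\<Prod>k<n. 1 - Q / y * Q ^ k) * (\<Prod>k<Suc n. 1 - y * Q ^ k))) \<longlonglongrightarrow>
        y * qpoch Q Q / (qpoch (Q / y) Q * qpoch y Q)"
      using reg' Q qpoch_LIMSEQ[OF Q(1), of y, THEN LIMSEQ_Suc]
      by (intro tendsto_intros qpoch_LIMSEQ filterlim_compose[OF qfact_LIMSEQ]) (auto simp: qpoch_nonzero)
    show "eventually (\<lambda>n. y * qfact Q (2 * n) / ((\<Prod>k<n. 1 - Q / y * Q ^ k) * (\<Prod>k<Suc n. 1 - y * Q ^ k)) =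
        (\<Sum>\<^sub>\<infinity>r\<in>UNIV. central_qbinom Q n r * (theta_coeff Q r / (1 - y * Q powi r)))) sequentially"
      by (rule eventually_sequentiallyI[of 1]) (simp only: fin)
  qed
  ultimately have "lerch Q y 1 / qpoch Q Q = y * qpoch Q Q / (qpoch (Q / y) Q * qpoch y Q)"
    by (rule LIMSEQ_unique)
  then show ?thesis
    using qpoch_base_nz[OF Q(1)]
    by (simp add: jtheta_def field_simps power3_eq_cube)
qed

section \<open>Splitting into residue classes\<close>

lemma jtheta_nonzero_not_powi:
  assumes "norm Q < 1" "Q \<noteq> 0" "y \<noteq> 0" "jtheta y Q \<noteq> 0"
  shows "y \<noteq> Q powi r"
  using theta_powi[OF assms(1,2), of r] jacobi_triple_product[OF assms(1-3)] assms(4) by auto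

text \<open>The substitution \<open>u = Q / x\<close> makes both series share the first argument
  \<open>x\<close>. The formula is for \<open>lerch\<close> and not for the quotient m, because
  \<open>Psi_generic\<close> does not state that theta is nonzero at the arguments \<open>z1\<close>
  to which it is applied.\<close>

lemma lerch_change_of_argument:
  assumes Q: "norm Q < 1" "Q \<noteq> 0" and nz: "x \<noteq> 0" "z0 \<noteq> 0" "z1 \<noteq> 0"
    and th: "jtheta (x * z0) Q \<noteq> 0" "jtheta (x * z1 / Q) Q \<noteq> 0" "jtheta z0 Q \<noteq> 0"
  shows "lerch Q (x * z1 / Q) z1 =
    jtheta z1 Q / jtheta z0 Q * lerch Q (x * z0 / Q) z0 +
    qpoch Q Q ^ 3 * jtheta (z1 / z0) Q * jtheta (x * z1 / Q * z0) Q /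
      (jtheta z0 Q * jtheta (x * z0) Q * jtheta (x * z1 / Q) Q)"
proof -
  define y0 y1 u where "y0 = x * z0 / Q" "y1 = x * z1 / Q" "u = Q / x"
  note defs = this
  have nz': "y0 \<noteq> 0" "y1 \<noteq> 0" "u \<noteq> 0" using nz Q by (auto simp: defs)
  have J: "theta Q w = jtheta w Q" if "w \<noteq> 0" for w
    by (rule jacobi_triple_product[OF Q that])
  \<comment> \<open>\<open>x * z0\<close> is \<open>Q * y0\<close>; the quasi-periodicity factor -y0
    cancels the \<open>y0\<close> in the value of \<open>lerch Q y0 1\<close>.\<close>
  have y0: "jtheta y0 Q = - y0 * jtheta (x * z0) Q"
  proof -
    have "jtheta (Q * y0) Q = - jtheta y0 Q / y0"
      using theta_mult_base[OF Q nz'(1)] J[of y0] J[of "Q * y0"] nz' Q by simp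
    moreover have "Q * y0 = x * z0" using Q by (simp add: defs)
    ultimately show ?thesis using nz' by (simp add: field_simps)
  qed
  have th': "jtheta y0 Q \<noteq> 0" "jtheta y1 Q \<noteq> 0" using y0 nz' th by (auto simp: defs)
  have e: "y0 * u = z0" "y1 * u = z1" "y1 / y0 = z1 / z0" "y0 * y1 * u = x * z1 / Q * z0"
    using nz Q by (auto simp: defs)
  have "jtheta z0 Q * lerch Q y1 z1 - jtheta z1 Q * lerch Q y0 z0 =
      - (lerch Q y0 1 * jtheta (z1 / z0) Q / jtheta y1 Q) * jtheta (x * z1 / Q * z0) Q"
    using lerch_change_of_argument_aux[OF Q _ _ nz'] th' nz nz' Q J unfolding e
    by simp
  also have "lerch Q y0 1 = y0 * qpoch Q Q ^ 3 / jtheta y0 Q"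
    using lerch_at_one[OF Q nz'(1)] jtheta_nonzero_not_powi[OF Q nz'(1) th'(1)] by blast
  also have "\<dots> = - (qpoch Q Q ^ 3 / jtheta (x * z0) Q)"
    unfolding y0 using nz' by simp
  finally have "jtheta z0 Q * lerch Q y1 z1 = jtheta z1 Q * lerch Q y0 z0 +
      qpoch Q Q ^ 3 * jtheta (z1 / z0) Q * jtheta (x * z1 / Q * z0) Q / (jtheta (x * z0) Q * jtheta y1 Q)"
    by (simp add: field_simps)
  then have "lerch Q y1 z1 = (jtheta z1 Q * lerch Q y0 z0 +
      qpoch Q Q ^ 3 * jtheta (z1 / z0) Q * jtheta (x * z1 / Q * z0) Q / (jtheta (x * z0) Q * jtheta y1 Q)) / jtheta z0 Q"
    using th(3) by (metis nonzero_mult_div_cancel_left)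
  then show ?thesis
    using defs by (simp add: add_divide_distrib mult_ac)
qed

lemma appell_lerch_eq_lerch:
  assumes "Q \<noteq> 0"
  shows "appell_lerch x Q z = lerch Q (x * z / Q) z / jtheta z Q"
proof -
  have "Q powi (r - 1) * x * z = Q powi r * (x * z / Q)" for r
    using assms by (simp add: power_int_diff)
  then show ?thesis
    by (simp add: appell_lerch_def lerch_def theta_coeff_def)
qed

lemma choose_two_double: "2 * (n choose 2) = n * (n - 1)"
proof -
  have "even (n * (n - 1))" by (cases n) auto
  then show ?thesis unfolding choose_two by (rule dvd_mult_div_cancel)
qed

lemma theta_coeff_nat: "theta_coeff Q (int n) = (-1) ^ n * Q ^ (n choose 2)"
proof -
  have "int n * (int n - 1) div 2 = int (n choose 2)"
    by (cases n) (simp_all add: choose_two zdiv_int algebra_simps)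
  then show ?thesis by (simp add: theta_coeff_def)
qed

text \<open>Along multiples of \<open>n\<close> the Gaussian exponent is again Gaussian, of base
  Q^(n^2), up to a linear term. The sign -((-1)^n) makes up for the (-1)^s already contained in
  \<open>theta_coeff\<close>.\<close>

lemma theta_coeff_mult:
  assumes "Q \<noteq> 0"
  shows "theta_coeff Q (int n * s) =
    theta_coeff (Q ^ n\<^sup>2) s * (- ((-1) ^ n) * Q ^ (n choose 2)) powi s"
proof -
  define e where "e = s * (s - 1) div 2"
  define c where "c = int (n choose 2)"
  have e: "s * (s - 1) = 2 * e" by (simp add: e_def)
  have c: "int n * (int n - 1) = 2 * c"
    by (cases n) (simp_all add: c_def choose_two zdiv_int algebra_simps)
  have "int n * s * (int n * s - 1) = int n ^ 2 * (s * (s - 1)) + s * (int n * (int n - 1))"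
    by (simp add: algebra_simps power2_eq_square)
  also have "\<dots> = 2 * (int (n ^ 2) * e + c * s)"
    unfolding e c by simp
  finally have *: "int n * s * (int n * s - 1) div 2 = int (n ^ 2) * e + c * s"
    by simp
  have "Q powi (int (n ^ 2) * e + c * s) = (Q ^ n\<^sup>2) powi e * (Q ^ (n choose 2)) powi s"
    by (simp only: power_int_add[OF disjI1[OF assms]] power_int_mult c_def power_int_of_nat)
  moreover have "(-1 :: complex) powi (int n * s) = (-1) powi s * (- ((-1) ^ n)) powi s" for s
  proof -
    have "(-1 :: complex) powi (int n * s) = ((-1) ^ n) powi s"
      by (simp add: power_int_mult)
    also have "(-1) ^ n = (-1) * (- ((-1 :: complex) ^ n))" by simp
    finally show ?thesis by (simp only: power_int_mult_distrib)
  qed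
  ultimately show ?thesis
    unfolding theta_coeff_def * power_int_mult_distrib e_def by (simp only: mult_ac)
qed

lemma has_sum_int_residues:
  fixes f :: "int \<Rightarrow> complex"
  assumes n: "n > 0" and f: "\<And>t. t < n \<Longrightarrow> ((\<lambda>s. f (int n * s + int t)) has_sum S t) UNIV"
  shows "(f has_sum (\<Sum>t<n. S t)) UNIV"
proof -
  have "(f has_sum S t) {r. r mod int n = int t}" if t: "t < n" for t
  proof -
    have r: "int n * (r div int n) + int t = r" if "r mod int n = int t" for r
      using mult_div_mod_eq[of "int n" r] that by simp
    have "((\<lambda>s. f (int n * s + int t)) has_sum S t) UNIV \<longleftrightarrow> (f has_sum S t) {r. r mod int n = int t}"
      using n t r
      by (intro has_sum_reindex_bij_witness[of _ "\<lambda>r. r div int n" "\<lambda>s. int n * s + int t"]) auto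
    then show ?thesis using f[OF t] by blast
  qed
  then have "(f has_sum (\<Sum>t\<in>{..<n}. S t)) (\<Union>t\<in>{..<n}. {r. r mod int n = int t})"
    by (intro sum_has_sum) (auto simp: disjoint_family_on_def)
  also have "(\<Union>t\<in>{..<n}. {r. r mod int n = int t}) = UNIV"
  proof safe
    fix r :: int
    have "r mod int n = int (nat (r mod int n))" "nat (r mod int n) < n"
      using n by (auto simp: nat_less_iff)
    then show "r \<in> (\<Union>t\<in>{..<n}. {r. r mod int n = int t})" by blast
  qed auto
  finally show ?thesis .
qed

text \<open>Each residue class is a constant times some \<open>lerch P (Y t) (Z t)\<close>, and
  moving it to \<open>z'\<close> produces theta at \<open>Z t\<close> times one common m. These
  multiples are summed indirectly: the same dissection of the series without denominators shows that
  they add up to a multiple of theta at Q^k z, hence of j(z;Q). The theta quotients of the moves are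
  the summands of \<open>Psi\<close>.\<close>

theorem lerch_average_Psi:
  assumes Q: "norm Q < 1" "Q \<noteq> 0" and n: "n > 0"
    and nz: "x \<noteq> 0" "z \<noteq> 0" "z' \<noteq> 0"
    and generic: "Psi_generic n (int k) x z z' Q"
  shows "((\<lambda>r. theta_coeff Q r * z powi r * (Q powi (r - 1) * (x * z)) ^ k /
        (1 - (Q powi (r - 1) * (x * z)) ^ n)) has_sum
      jtheta z Q * ((- x) ^ k / Q ^ (Suc k choose 2) *
        appell_lerch (- (Q powi (int (n choose 2) - int n * int k)) * (- x) ^ n) (Q ^ n\<^sup>2) z' +
        Psi n (int k) x z z' Q)) UNIV"
proof -
  define P where "P = Q ^ n\<^sup>2"
  define X where "X = - (Q powi (int (n choose 2) - int n * int k)) * (- x) ^ n"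
  define Y where "Y t = Q ^ (n * t) * (x * z) ^ n" for t
  define Z where "Z t = - (Q powi (int ((n + 1) choose 2) + int n * int k + int n * int t)) * (- z) ^ n" for t
  define c where "c t = (-1) ^ Suc t * Q ^ (Suc t choose 2) * Q ^ (t * k) * z ^ Suc t * (x * z) ^ k" for t
  have P: "norm P < 1" "P \<noteq> 0"
    using Q n by (auto simp: P_def norm_power power_less_one_iff)
  have X_nz: "X \<noteq> 0" and Y_nz: "Y t \<noteq> 0" and Z_nz: "Z t \<noteq> 0" for t
    using Q nz by (auto simp: X_def Y_def Z_def)
  have gen: "jtheta z Q \<noteq> 0" "jtheta z' P \<noteq> 0" "jtheta (X * z') P \<noteq> 0" "\<And>t. t < n \<Longrightarrow> jtheta (Y t) P \<noteq> 0"
    using generic n by (auto simp: Psi_generic_def jtheta2_def P_def X_def Y_def)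
  have Z_alt: "Z t = (- ((-1) ^ n) * Q ^ (n choose 2)) * Q ^ (n * Suc t) * z ^ n * Q ^ (n * k)" for t
  proof -
    have "int ((n + 1) choose 2) + int n * int k + int n * int t = int ((n choose 2) + n * Suc t + n * k)"
      by (simp add: numeral_2_eq_2)
    then have "Z t = - (Q ^ ((n choose 2) + n * Suc t + n * k)) * (- z) ^ n"
      unfolding Z_def by (simp only: power_int_of_nat)
    also have "(- z) ^ n = (-1) ^ n * z ^ n"
      by (rule power_minus)
    finally show ?thesis by (simp add: power_add mult_ac)
  qed
  \<comment> \<open>This relation makes the first argument \<open>X\<close> common to all classes:
    the pole parameter \<open>Y t\<close> is \<open>X * Z t / P\<close> for every
    \<open>t\<close>.\<close>
  have XZ: "X * Z t / P = Y t" for t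
  proof -
    have 1: "Q powi (int (n choose 2) - int n * int k) = Q ^ (n choose 2) / Q ^ (n * k)"
      using Q by (simp add: power_int_diff flip: of_nat_mult)
    have "(-1 :: complex) ^ n * (-1) ^ n = 1" by simp
    then have "X * Z t = Q ^ (n choose 2) * Q ^ (n choose 2) * Q ^ (n * Suc t) * (x * z) ^ n * ((-1) ^ n * (-1) ^ n)"
      unfolding X_def Z_alt 1 power_minus[of x] using Q by (simp add: power_mult_distrib mult_ac)
    also have "\<dots> = (Q ^ (n choose 2) * Q ^ (n choose 2) * Q ^ n) * Y t"
      by (simp add: Y_def power_add mult_ac)
    also have "Q ^ (n choose 2) * Q ^ (n choose 2) * Q ^ n = P"
    proof -
      have "(n choose 2) + (n choose 2) + n = n\<^sup>2"
        using choose_two_double[of n] by (cases n) (simp_all add: power2_eq_square)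
      then show ?thesis by (simp add: P_def flip: power_add)
    qed
    finally show ?thesis using P by simp
  qed
  \<comment> \<open>The classes start at r = 1 and not at 0: then r - 1 = n s + t, and the pole
    parameter is the theta argument Q^(nt) (xz)^n in the denominators of \<open>Psi\<close>.\<close>
  have split_term: "theta_coeff Q (int n * s + int t + 1) * z powi (int n * s + int t + 1) *
      (Q powi (int n * s + int t) * (x * z)) ^ k = c t * (theta_coeff P s * Z t powi s)" for s t
  proof -
    have 1: "theta_coeff Q (int n * s + int t + 1) =
        theta_coeff P s * (- ((-1) ^ n) * Q ^ (n choose 2)) powi s * ((-1) ^ Suc t * Q ^ (Suc t choose 2)) * (Q ^ (n * Suc t)) powi s"
    proof -
      have "theta_coeff Q (int n * s + int (Suc t)) =
          theta_coeff Q (int n * s) * theta_coeff Q (int (Suc t)) * Q powi (int n * s * int (Suc t))"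
        by (rule theta_coeff_add[OF Q(2)])
      also have "int n * s * int (Suc t) = int (n * Suc t) * s" by (simp add: algebra_simps)
      also have "Q powi (int (n * Suc t) * s) = (Q ^ (n * Suc t)) powi s"
        by (simp only: power_int_mult power_int_of_nat)
      finally show ?thesis
        unfolding theta_coeff_nat theta_coeff_mult[OF Q(2)] P_def by (simp add: ac_simps)
    qed
    have 2: "z powi (int n * s + int t + 1) = (z ^ n) powi s * z ^ Suc t"
      using nz by (simp add: power_int_add power_int_mult)
    have 3: "(Q powi (int n * s + int t) * (x * z)) ^ k = (Q ^ (n * k)) powi s * Q ^ (t * k) * (x * z) ^ k"
    proof -
      have "(Q powi (int n * s)) ^ k = Q powi (int n * s * int k)"
        by (simp only: power_int_mult power_int_of_nat)
      also have "\<dots> = Q powi (int (n * k) * s)" by (simp add: mult_ac)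
      also have "\<dots> = (Q ^ (n * k)) powi s"
        by (simp only: power_int_mult power_int_of_nat)
      finally show ?thesis
        using Q by (simp add: power_int_add power_mult_distrib power_mult)
    qed
    show ?thesis
      unfolding 1 2 3 Z_alt c_def power_int_mult_distrib by (simp add: mult_ac)
  qed
  have denom: "(Q powi (int n * s + int t) * (x * z)) ^ n = P powi s * Y t" for s t
  proof -
    have "(Q powi (int n * s)) ^ n = Q powi (int n * s * int n)"
      by (simp only: power_int_mult power_int_of_nat)
    also have "\<dots> = Q powi (int (n * n) * s)" by (simp add: mult_ac)
    also have "\<dots> = P powi s"
      by (simp only: power_int_mult power_int_of_nat P_def power2_eq_square)
    finally show ?thesis
      using Q by (simp add: power_int_add power_mult_distrib power_mult Y_def flip: power_mult mult.commute[of t])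
  qed
  define f where "f r = theta_coeff Q r * z powi r * (Q powi (r - 1) * (x * z)) ^ k" for r
  have main: "((\<lambda>r. f r / (1 - (Q powi (r - 1) * (x * z)) ^ n)) has_sum (\<Sum>t<n. c t * lerch P (Y t) (Z t))) UNIV"
  proof (subst has_sum_int_shift[of _ 1, symmetric], rule has_sum_int_residues[OF n])
    show "((\<lambda>s. f (int n * s + int t + 1) / (1 - (Q powi (int n * s + int t + 1 - 1) * (x * z)) ^ n)) has_sum
        c t * lerch P (Y t) (Z t)) UNIV" for t
      using has_sum_cmult_right[OF lerch_has_sum[OF P Z_nz], of "c t" t "Y t"]
      by (simp add: f_def split_term denom)
  qed
  have "(f has_sum (\<Sum>t<n. c t * theta P (Z t))) UNIV"
  proof (subst has_sum_int_shift[of _ 1, symmetric], rule has_sum_int_residues[OF n])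
    show "((\<lambda>s. f (int n * s + int t + 1)) has_sum c t * theta P (Z t)) UNIV" for t
      using has_sum_cmult_right[OF theta_has_sum[OF P Z_nz], of "c t" t]
      by (simp add: f_def split_term)
  qed
  moreover have "(f has_sum (- x) ^ k / Q ^ (Suc k choose 2) * jtheta z Q) UNIV"
  proof -
    have "((\<lambda>r. (x * z / Q) ^ k * (theta_coeff Q r * (Q powi int k * z) powi r)) has_sum
        (x * z / Q) ^ k * theta Q (Q powi int k * z)) UNIV"
      using Q nz by (intro has_sum_cmult_right theta_has_sum) auto
    also have "(\<lambda>r. (x * z / Q) ^ k * (theta_coeff Q r * (Q powi int k * z) powi r)) = f"
    proof
      fix r
      have "(Q powi r) ^ k = (Q ^ k) powi r"
        using power_int_mult[of Q r "int k"] power_int_mult[of Q "int k" r] by (simp add: mult.commute)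
      then show "(x * z / Q) ^ k * (theta_coeff Q r * (Q powi int k * z) powi r) = f r"
        using Q by (simp add: f_def power_int_diff power_divide power_mult_distrib power_int_mult_distrib)
    qed
    also have "(x * z / Q) ^ k * theta Q (Q powi int k * z) = (- x) ^ k / Q ^ (Suc k choose 2) * jtheta z Q"
    proof -
      have "(-1 :: complex) ^ k * (-1) ^ k = 1" by simp
      then have s: "1 / (-1 :: complex) ^ k = (-1) ^ k"
        by (simp add: field_simps)
      have "(x * z / Q) ^ k * theta Q (Q powi int k * z) =
          (1 / (-1) ^ k) * x ^ k / (Q ^ (k choose 2) * Q ^ k) * jtheta z Q"
        unfolding theta_mult_base_powi[OF Q nz(2)] theta_coeff_nat jacobi_triple_product[OF Q nz(2)]
        using nz Q by (simp add: power_mult_distrib power_divide field_simps)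
      then show ?thesis
        unfolding s power_minus[of x] by (simp add: numeral_2_eq_2 power_add mult_ac)
    qed
    finally show ?thesis .
  qed
  ultimately have theta_sum: "(\<Sum>t<n. c t * theta P (Z t)) = (- x) ^ k / Q ^ (Suc k choose 2) * jtheta z Q"
    by (rule has_sum_unique)
  define J where "J = qpoch P P ^ 3"
  have change: "lerch P (Y t) (Z t) = theta P (Z t) * appell_lerch X P z' +
      J * jtheta (Z t / z') P * jtheta (Y t * z') P / (jtheta z' P * jtheta (X * z') P * jtheta (Y t) P)"
    if "t < n" for t
    using lerch_change_of_argument[OF P X_nz nz(3) Z_nz[of t] gen(3) _ gen(2)] gen(4)[OF that]
    unfolding XZ appell_lerch_eq_lerch[OF P(2)] jacobi_triple_product[OF P Z_nz] J_def
    by simp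
  have "(\<Sum>t<n. c t * lerch P (Y t) (Z t)) =
      (\<Sum>t<n. c t * theta P (Z t) * appell_lerch X P z' + c t *
      (J * jtheta (Z t / z') P * jtheta (Y t * z') P / (jtheta z' P * jtheta (X * z') P * jtheta (Y t) P)))"
    by (intro sum.cong) (simp_all add: change distrib_left mult_ac)
  also have "\<dots> = (- x) ^ k / Q ^ (Suc k choose 2) * jtheta z Q * appell_lerch X P z' +
      (\<Sum>t<n. c t * (J * jtheta (Z t / z') P * jtheta (Y t * z') P / (jtheta z' P * jtheta (X * z') P * jtheta (Y t) P)))"
    by (simp only: sum.distrib sum_distrib_right[symmetric] theta_sum)
  also have "(\<Sum>t<n. c t * (J * jtheta (Z t / z') P * jtheta (Y t * z') P / (jtheta z' P * jtheta (X * z') P * jtheta (Y t) P))) =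
      jtheta z Q * Psi n (int k) x z z' Q"
  proof -
    define S where "S t = Q powi (int ((t + 1) choose 2) + int k * int t) * (- z) ^ t *
        jtheta2 (Z t / z') (Y t * z') P / jtheta2 (X * z') (Y t) P" for t
    have Psi: "Psi n (int k) x z z' Q = - (x ^ k * z ^ Suc k * J / (jtheta z Q * jtheta z' P)) * (\<Sum>t<n. S t)"
    proof -
      have "z powi (int k + 1) = z ^ Suc k"
        using power_int_of_nat[of z "Suc k"] by (simp add: add.commute)
      then show ?thesis
        unfolding Psi_def S_def Z_def Y_def X_def P_def J_def
        by (simp only: atLeast0LessThan power_int_of_nat)
    qed
    have "jtheta z Q * (- (x ^ k * z ^ Suc k * J / (jtheta z Q * jtheta z' P)) * S t) =
        c t * (J * jtheta (Z t / z') P * jtheta (Y t * z') P / (jtheta z' P * jtheta (X * z') P * jtheta (Y t) P))"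
      if "t < n" for t
    proof -
      have "Q powi (int ((t + 1) choose 2) + int k * int t) = Q ^ (Suc t choose 2) * Q ^ (t * k)"
        using Q by (simp add: power_int_add mult.commute flip: of_nat_mult)
      then have "S t = Q ^ (Suc t choose 2) * Q ^ (t * k) * ((-1) ^ t * z ^ t) *
        (jtheta (Z t / z') P * jtheta (Y t * z') P) / (jtheta (X * z') P * jtheta (Y t) P)"
        unfolding S_def jtheta2_def power_minus[of z] by simp
      then show ?thesis
        using gen(1) by (simp add: c_def power_mult_distrib mult_ac)
    qed
    then show ?thesis
      unfolding Psi by (simp add: sum_distrib_left)
  qed
  finally have "(\<Sum>t<n. c t * lerch P (Y t) (Z t)) =
      jtheta z Q * ((- x) ^ k / Q ^ (Suc k choose 2) * appell_lerch X P z' + Psi n (int k) x z z' Q)"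
    by (simp add: algebra_simps)
  then show ?thesis
    using main by (simp add: f_def X_def P_def)
qed

section \<open>Averaging over roots of unity\<close>

lemma has_sum_sum:
  fixes f :: "'i \<Rightarrow> 'a \<Rightarrow> 'b :: topological_comm_monoid_add"
  assumes "\<And>i. i \<in> I \<Longrightarrow> (f i has_sum S i) A"
  shows "((\<lambda>x. \<Sum>i\<in>I. f i x) has_sum (\<Sum>i\<in>I. S i)) A"
  using assms by (induction I rule: infinite_finite_induct) (auto intro!: has_sum_add)

lemma zeta_power: "zeta M ^ n = exp (2 * of_real pi * \<i> * of_nat n / of_nat M)"
  unfolding zeta_def by (simp add: mult_ac flip: exp_of_nat_mult)

lemma zeta_power_self: "M > 0 \<Longrightarrow> zeta M ^ M = 1"
  using complex_root_unity[of M 1] by (simp add: zeta_power)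

lemma zeta_nz [simp]: "zeta M \<noteq> 0"
  by (simp add: zeta_def)

lemma norm_zeta [simp]: "norm (zeta M) = 1"
  by (simp add: zeta_def norm_exp_eq_Re)

lemma zeta_powi_eq_1_iff:
  assumes "M > 0"
  shows "zeta M powi c = 1 \<longleftrightarrow> int M dvd c"
proof -
  define r where "r = nat (c mod int M)"
  have r: "int r = c mod int M" using assms by (simp add: r_def)
  have "zeta M powi c = zeta M powi (int M * (c div int M) + int r)"
    using r by simp
  also have "\<dots> = zeta M powi (int M * (c div int M)) * zeta M ^ r"
    by (simp only: power_int_add zeta_nz simp_thms power_int_of_nat)
  also have "zeta M powi (int M * (c div int M)) = 1"
    by (simp add: power_int_mult zeta_power_self assms)
  finally have "zeta M powi c = zeta M ^ r" by simp
  moreover have "zeta M ^ r = 1 \<longleftrightarrow> M dvd r"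
    unfolding zeta_power using complex_root_unity_eq_1[of M r] assms by simp
  moreover have "M dvd r \<longleftrightarrow> int M dvd c"
    by (metis dvd_mod_iff dvd_refl int_dvd_int_iff r)
  ultimately show ?thesis by simp
qed

lemma zeta_orthogonality:
  assumes "M > 0"
  shows "(\<Sum>j<M. zeta M powi (c * int j)) = (if int M dvd c then of_nat M else 0)"
proof -
  have e: "zeta M powi (c * int j) = (zeta M powi c) ^ j" for j
    by (simp add: power_int_mult)
  show ?thesis
  proof (cases "int M dvd c")
    case True
    then have "zeta M powi c = 1" using zeta_powi_eq_1_iff[OF assms] by simp
    then show ?thesis using True by (simp add: e)
  next
    case False
    then have ne: "zeta M powi c \<noteq> 1" using zeta_powi_eq_1_iff[OF assms] by simp
    have "(zeta M powi c) ^ M = zeta M powi (int M * c)"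
      by (simp add: power_int_power' mult.commute)
    also have "\<dots> = 1" by (simp add: power_int_mult zeta_power_self assms)
    finally show ?thesis
      using False ne by (simp add: e geometric_sum)
  qed
qed

text \<open>All M-th roots of unity give the same (zeta^j y)^M = y^M, so each fraction is a
  geometric sum of length M over the common denominator 1 - y^M, and orthogonality keeps the power
  y^k alone.\<close>

lemma zeta_fourier_geometric:
  assumes M: "M > 0" and k: "k < M" and y: "y ^ M \<noteq> 1"
  shows "(\<Sum>j<M. zeta M powi (- (int k * int j)) / (1 - zeta M ^ j * y)) = of_nat M * y ^ k / (1 - y ^ M)"
proof -
  have geo: "1 / (1 - zeta M ^ j * y) = (\<Sum>l<M. (zeta M ^ j * y) ^ l) / (1 - y ^ M)" for j
  proof -
    have "(zeta M ^ j) ^ M = (zeta M ^ M) ^ j" by (simp add: mult.commute flip: power_mult)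
    then have p: "(zeta M ^ j * y) ^ M = y ^ M"
      using zeta_power_self[OF M] by (simp add: power_mult_distrib)
    then have "zeta M ^ j * y \<noteq> 1" using y by auto
    moreover have "1 - y ^ M = (1 - zeta M ^ j * y) * (\<Sum>l<M. (zeta M ^ j * y) ^ l)"
      using one_diff_power_eq[of "zeta M ^ j * y" M] p by simp
    ultimately show ?thesis using y by (simp add: field_simps)
  qed
  have "(\<Sum>j<M. zeta M powi (- (int k * int j)) / (1 - zeta M ^ j * y)) =
      (\<Sum>j<M. \<Sum>l<M. zeta M powi ((int l - int k) * int j) * (y ^ l / (1 - y ^ M)))"
  proof (rule sum.cong)
    fix j
    have "zeta M powi (- (int k * int j)) / (1 - zeta M ^ j * y) =
        zeta M powi (- (int k * int j)) * ((\<Sum>l<M. (zeta M ^ j * y) ^ l) / (1 - y ^ M))"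
      by (simp only: geo[symmetric]) simp
    also have "\<dots> = (\<Sum>l<M. zeta M powi (- (int k * int j)) * (zeta M ^ j) ^ l * (y ^ l / (1 - y ^ M)))"
      by (simp add: sum_distrib_left sum_divide_distrib power_mult_distrib mult.assoc)
    also have "\<dots> = (\<Sum>l<M. zeta M powi ((int l - int k) * int j) * (y ^ l / (1 - y ^ M)))"
    proof (rule sum.cong)
      fix l
      have "(zeta M ^ j) ^ l = zeta M powi (int l * int j)"
        by (simp add: mult.commute power_int_mult flip: power_mult)
      moreover have "- (int k * int j) + int l * int j = (int l - int k) * int j"
        by (simp add: algebra_simps)
      ultimately have "zeta M powi (- (int k * int j)) * (zeta M ^ j) ^ l = zeta M powi ((int l - int k) * int j)"
        by (simp flip: power_int_add)
      then show "zeta M powi (- (int k * int j)) * (zeta M ^ j) ^ l * (y ^ l / (1 - y ^ M)) =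
          zeta M powi ((int l - int k) * int j) * (y ^ l / (1 - y ^ M))" by simp
    qed simp
    finally show "zeta M powi (- (int k * int j)) / (1 - zeta M ^ j * y) =
        (\<Sum>l<M. zeta M powi ((int l - int k) * int j) * (y ^ l / (1 - y ^ M)))" .
  qed simp
  also have "\<dots> = (\<Sum>l<M. (\<Sum>j<M. zeta M powi ((int l - int k) * int j)) * (y ^ l / (1 - y ^ M)))"
    unfolding sum_distrib_right by (rule sum.swap)
  also have "\<dots> = (\<Sum>l<M. if l = k then of_nat M * (y ^ l / (1 - y ^ M)) else 0)"
  proof (rule sum.cong)
    fix l assume "l \<in> {..<M}"
    then have "int M dvd int l - int k \<longleftrightarrow> l = k"
      using k mod_eq_dvd_iff[of "int l" "int M" "int k"] by simp
    then show "(\<Sum>j<M. zeta M powi ((int l - int k) * int j)) * (y ^ l / (1 - y ^ M)) =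
        (if l = k then of_nat M * (y ^ l / (1 - y ^ M)) else 0)"
      by (simp add: zeta_orthogonality[OF M])
  qed simp
  also have "\<dots> = of_nat M * y ^ k / (1 - y ^ M)"
    using k by simp
  finally show ?thesis .
qed

text \<open>The Fourier sum is taken inside the bilateral series, which turns its denominators into
  the shape treated by \<open>lerch_average_Psi\<close>; \<open>S\<close> stands for the closed form
  obtained there.\<close>

lemma appell_lerch_average:
  assumes Q: "norm Q < 1" "Q \<noteq> 0" and M: "M > 0" and k: "k < M" and z: "z \<noteq> 0"
    and reg: "\<And>r. (Q powi (r - 1) * (x * z)) ^ M \<noteq> 1"
    and S: "((\<lambda>r. theta_coeff Q r * z powi r * (Q powi (r - 1) * (x * z)) ^ k /
        (1 - (Q powi (r - 1) * (x * z)) ^ M)) has_sum jtheta z Q * S) UNIV"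
    and j: "jtheta z Q \<noteq> 0"
  shows "(\<Sum>j<M. zeta M powi (- (int k * int j)) * appell_lerch (zeta M ^ j * x) Q z) = of_nat M * S"
proof -
  have e: "Q powi r * (zeta M ^ j * x * z / Q) = zeta M ^ j * (Q powi (r - 1) * (x * z))" for r j
    using Q by (simp add: power_int_diff)
  have "((\<lambda>r. \<Sum>j<M. zeta M powi (- (int k * int j)) *
        (theta_coeff Q r * z powi r / (1 - Q powi r * (zeta M ^ j * x * z / Q)))) has_sum
      (\<Sum>j<M. zeta M powi (- (int k * int j)) * lerch Q (zeta M ^ j * x * z / Q) z)) UNIV"
    by (intro has_sum_sum has_sum_cmult_right lerch_has_sum Q z)
  also have "(\<lambda>r. \<Sum>j<M. zeta M powi (- (int k * int j)) *
        (theta_coeff Q r * z powi r / (1 - Q powi r * (zeta M ^ j * x * z / Q)))) =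
      (\<lambda>r. of_nat M * (theta_coeff Q r * z powi r * (Q powi (r - 1) * (x * z)) ^ k /
        (1 - (Q powi (r - 1) * (x * z)) ^ M)))"
  proof
    fix r
    have "(\<Sum>j<M. zeta M powi (- (int k * int j)) *
        (theta_coeff Q r * z powi r / (1 - Q powi r * (zeta M ^ j * x * z / Q)))) =
      theta_coeff Q r * z powi r * (\<Sum>j<M. zeta M powi (- (int k * int j)) / (1 - zeta M ^ j * (Q powi (r - 1) * (x * z))))"
      unfolding e by (simp add: sum_distrib_left mult_ac)
    then show "(\<Sum>j<M. zeta M powi (- (int k * int j)) *
        (theta_coeff Q r * z powi r / (1 - Q powi r * (zeta M ^ j * x * z / Q)))) =
      of_nat M * (theta_coeff Q r * z powi r * (Q powi (r - 1) * (x * z)) ^ k /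
        (1 - (Q powi (r - 1) * (x * z)) ^ M))"
      unfolding zeta_fourier_geometric[OF M k reg] by simp
  qed
  finally have "(\<Sum>j<M. zeta M powi (- (int k * int j)) * lerch Q (zeta M ^ j * x * z / Q) z) =
      of_nat M * (jtheta z Q * S)"
    using has_sum_cmult_right[OF S, of "of_nat M"] has_sum_unique by blast
  moreover have "(\<Sum>j<M. zeta M powi (- (int k * int j)) * appell_lerch (zeta M ^ j * x) Q z) =
      (\<Sum>j<M. zeta M powi (- (int k * int j)) * lerch Q (zeta M ^ j * x * z / Q) z) / jtheta z Q"
    by (simp add: appell_lerch_eq_lerch[OF Q(2)] sum_divide_distrib)
  ultimately show ?thesis using j by simp
qed

text \<open>After the shift r -> r + 1 this is a - a/(1 - t) = -t a/(1 - t) term by term; the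
  leftover theta series divided by j(z;Q) is the 1.\<close>

lemma appell_lerch_mult_base:
  assumes Q: "norm Q < 1" "Q \<noteq> 0" and nz: "x \<noteq> 0" "z \<noteq> 0"
    and reg: "\<And>r. Q powi r * (x * z) \<noteq> 1" and j: "jtheta z Q \<noteq> 0"
  shows "appell_lerch (Q * x) Q z = 1 - x * appell_lerch x Q z"
proof -
  have "((\<lambda>r. theta_coeff Q (r + 1) * z powi (r + 1) / (1 - Q powi (r + 1) * (x * z / Q))) has_sum
      lerch Q (x * z / Q) z) UNIV"
    by (subst has_sum_int_shift) (intro lerch_has_sum Q nz)
  then have "((\<lambda>r. x * (theta_coeff Q (r + 1) * z powi (r + 1) / (1 - Q powi (r + 1) * (x * z / Q)))) has_sum
      x * lerch Q (x * z / Q) z) UNIV"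
    by (rule has_sum_cmult_right)
  moreover have "((\<lambda>r. theta_coeff Q r * z powi r + - (theta_coeff Q r * z powi r / (1 - Q powi r * (x * z)))) has_sum
      theta Q z + - lerch Q (x * z) z) UNIV"
    by (intro has_sum_add has_sum_uminusI theta_has_sum lerch_has_sum Q nz)
  moreover have "x * (theta_coeff Q (r + 1) * z powi (r + 1) / (1 - Q powi (r + 1) * (x * z / Q))) =
      theta_coeff Q r * z powi r + - (theta_coeff Q r * z powi r / (1 - Q powi r * (x * z)))" for r
  proof -
    have 1: "Q powi (r + 1) * (x * z / Q) = Q powi r * (x * z)"
      using Q by (simp add: power_int_add)
    have "a - a / (1 - t) = - (t * a / (1 - t))" if "t \<noteq> 1" for a t :: complex
      using that by (simp add: field_simps)
    then have "theta_coeff Q r * z powi r + - (theta_coeff Q r * z powi r / (1 - Q powi r * (x * z))) =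
       - (Q powi r * (x * z) * (theta_coeff Q r * z powi r) / (1 - Q powi r * (x * z)))"
      using reg[of r] by simp
    then show ?thesis
      unfolding 1 theta_coeff_Suc[OF Q(2)] using nz by (simp add: power_int_add mult_ac)
  qed
  ultimately have "x * lerch Q (x * z / Q) z = theta Q z - lerch Q (x * z) z"
    using has_sum_unique by (metis (no_types, lifting) ext diff_conv_add_uminus)
  moreover have "Q * x * z / Q = x * z" using Q by simp
  ultimately show ?thesis
    using j unfolding appell_lerch_eq_lerch[OF Q(2)] jacobi_triple_product[OF Q nz(2)]
    by (simp add: diff_divide_distrib)
qed

section \<open>Infinite products for the overpartition prefactor\<close>

lemma qpoch_mult_minus:
  assumes "norm q < 1"
  shows "qpoch q q * qpoch (- q) q = qpoch (q\<^sup>2) (q\<^sup>2 :: complex)"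
proof -
  have "(1 - q * q ^ k) * (1 - - q * q ^ k) = 1 - q\<^sup>2 * (q\<^sup>2) ^ k" for k
    by (simp add: algebra_simps power2_eq_square power_mult_distrib)
  then show ?thesis
    unfolding qpoch_def using prodinf_mult[OF qpoch_convergent[OF assms, of q] qpoch_convergent[OF assms, of "- q"]]
    by simp
qed

lemma qpoch_even_odd:
  assumes "norm q < 1"
  shows "qpoch q (q\<^sup>2) * qpoch (q\<^sup>2) (q\<^sup>2) = qpoch q (q :: complex)"
proof -
  have q2: "norm (q\<^sup>2) < 1" using assms by (simp add: norm_power power_less_one_iff)
  have "(\<Prod>k<n. 1 - q * (q\<^sup>2) ^ k) * (\<Prod>k<n. 1 - q\<^sup>2 * (q\<^sup>2) ^ k) = qfact q (2 * n)" for n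
    by (induction n) (simp_all add: qfact_Suc mult_ac power2_eq_square power_mult_distrib power_mult)
  then have "(\<lambda>n. qfact q (2 * n)) \<longlonglongrightarrow> qpoch q (q\<^sup>2) * qpoch (q\<^sup>2) (q\<^sup>2)"
    using tendsto_mult[OF qpoch_LIMSEQ[OF q2, of q] qpoch_LIMSEQ[OF q2, of "q\<^sup>2"]] by simp
  moreover have "filterlim (\<lambda>n. 2 * n :: nat) at_top sequentially"
    by (rule filterlim_subseq) (simp add: strict_mono_def)
  then have "(\<lambda>n. qfact q (2 * n)) \<longlonglongrightarrow> qpoch q q"
    by (rule filterlim_compose[OF qfact_LIMSEQ[OF assms]])
  ultimately show ?thesis by (rule LIMSEQ_unique)
qed

text \<open>Here j(q;q^2) = (q;q^2)^2 (q^2;q^2), and Euler's identity (q;q^2) (-q;q) = 1 follows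
  from the two preceding product formulas.\<close>

lemma overpartition_quotient:
  assumes "norm q < 1" "q \<noteq> 0"
  shows "qpoch (- q) q / qpoch q q = 1 / jtheta q ((q :: complex)\<^sup>2)"
proof -
  define a b where "a = qpoch q (q\<^sup>2)" "b = qpoch (q\<^sup>2) (q\<^sup>2)"
  have q2: "norm (q\<^sup>2) < 1" using assms by (simp add: norm_power power_less_one_iff)
  have ab: "a * b = qpoch q q" using qpoch_even_odd[OF assms(1)] by (simp add: a_b_def)
  have nz: "a * b \<noteq> 0" unfolding ab by (rule qpoch_base_nz[OF assms(1)])
  have "a * b * qpoch (- q) q = b" using qpoch_mult_minus[OF assms(1)] ab by (simp add: a_b_def)
  then have "a * qpoch (- q) q = 1" using nz by (simp add: mult_ac)
  moreover have "jtheta q (q\<^sup>2) = a * a * b"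
    using assms by (simp add: jtheta_def a_b_def power2_eq_square)
  ultimately show ?thesis
    using nz unfolding ab[symmetric] by (simp add: field_simps)
qed

lemma has_sum_int_symmetric_sums:
  fixes f :: "int \<Rightarrow> complex"
  assumes "(f has_sum S) UNIV"
  shows "(\<lambda>i. f (int (Suc i)) + f (- int (Suc i))) sums (S - f 0)"
proof -
  have summ: "f summable_on A" for A
    using has_sum_imp_summable[OF assms] summable_on_subset by blast
  have pos: "((\<lambda>i. f (int (Suc i))) has_sum infsum f {1..}) UNIV"
    using has_sum_infsum[OF summ[of "{1..}"]]
    by (subst has_sum_reindex_bij_witness[of UNIV "\<lambda>r. nat (r - 1)" "\<lambda>i. int (Suc i)" "{1..}" f]) auto
  have neg: "((\<lambda>i. f (- int (Suc i))) has_sum infsum f {..-1}) UNIV"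
    using has_sum_infsum[OF summ[of "{..-1}"]]
    by (subst has_sum_reindex_bij_witness[of UNIV "\<lambda>r. nat (- r - 1)" "\<lambda>i. - int (Suc i)" "{..-1}" f]) auto
  have "((\<lambda>r. f r) has_sum (infsum f {1..} + infsum f {..-1})) ({1..} \<union> {..-1})"
    by (intro has_sum_Un_disjoint has_sum_infsum summ) auto
  then have "(f has_sum (f 0 + (infsum f {1..} + infsum f {..-1}))) (insert 0 ({1..} \<union> {..-1}))"
    by (intro has_sum_insert) auto
  also have "insert 0 ({1..} \<union> {..-1}) = (UNIV :: int set)" by auto
  finally have "S = f 0 + (infsum f {1..} + infsum f {..-1})"
    using has_sum_unique[OF assms] by blast
  then show ?thesis
    using has_sum_imp_sums[OF has_sum_add[OF pos neg]] by simp
qed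

section \<open>The generating function as an Appell--Lerch series\<close>

lemma theta_coeff_square:
  assumes "q \<noteq> 0"
  shows "theta_coeff (q\<^sup>2) r * q powi r = (-1) powi r * q powi (r * r)"
proof -
  have "(q\<^sup>2) powi (r * (r - 1) div 2) = q powi (2 * (r * (r - 1) div 2))"
    unfolding power_int_power of_nat_numeral ..
  also have "2 * (r * (r - 1) div 2) = r * r - r"
    by (simp add: algebra_simps)
  finally show ?thesis
    using assms by (simp add: theta_coeff_def power_int_diff)
qed

text \<open>Serves to exclude poles: absolute values force the exponents to agree, and then the
  unimodular factor is 1.\<close>

lemma norm_powi_inj:
  fixes q :: complex
  assumes "norm q < 1" "q \<noteq> 0" and u: "norm u = 1" and eq: "u * q powi a = q powi b"
  shows "a = b" "u = 1"
proof -
  have "norm q powi a = norm q powi b"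
    using arg_cong[OF eq, of norm] u by (simp add: norm_mult norm_power_int)
  then show "a = b"
    using assms(1,2) power_int_strict_decreasing[of a b "norm q"] power_int_strict_decreasing[of b a "norm q"]
    by (cases a b rule: linorder_cases) auto
  then show "u = 1" using eq assms by simp
qed

text \<open>Up to the factor \<open>1 - \<omega>\<close>, 1 + \<omega> times the n-th rank term is
  the pair of terms n and -n of the bilateral series minus one theta coefficient. The theta
  coefficients sum to j(q;q^2), up to the term at 0, and this cancels the prefactor.\<close>

lemma overrank_gf_eq:
  fixes q \<omega> :: complex
  assumes q: "norm q < 1" "q \<noteq> 0" and d: "d > 0" and \<omega>: "norm \<omega> = 1" "\<omega> \<noteq> 1"
    and H: "((\<lambda>r. theta_coeff (q\<^sup>2) r * q powi r / (1 - (q ^ d) powi r * \<omega>)) has_sum H) UNIV"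
  shows "(1 + \<omega>) * overrank_gf d \<omega> q = - (1 - \<omega>) + 2 * (1 - \<omega>) * (H / jtheta q (q\<^sup>2))"
proof -
  define b where "b r = theta_coeff (q\<^sup>2) r * q powi r" for r
  define j where "j = jtheta q (q\<^sup>2)"
  have q2: "norm (q\<^sup>2) < 1" "q\<^sup>2 \<noteq> 0" using q by (auto simp: norm_power power_less_one_iff)
  have \<omega>_nz: "\<omega> \<noteq> 0" using \<omega> by auto
  have j_nz: "j \<noteq> 0"
    unfolding j_def using qpoch_base_nz[OF q(1)] overpartition_quotient[OF q] qpoch_base_nz[OF q2(1)]
      qpoch_mult_minus[OF q(1)] by auto
  have b_nat: "b (int n) = (-1) ^ n * q ^ n\<^sup>2" "b (- int n) = (-1) ^ n * q ^ n\<^sup>2" for n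
  proof -
    show "b (int n) = (-1) ^ n * q ^ n\<^sup>2"
      unfolding b_def theta_coeff_square[OF q(2)] by (simp add: power2_eq_square flip: of_nat_mult)
    have "(-1 :: complex) powi (- int n) = (-1) ^ n"
      by (simp add: power_int_minus flip: power_inverse)
    then show "b (- int n) = (-1) ^ n * q ^ n\<^sup>2"
      unfolding b_def theta_coeff_square[OF q(2)] by (simp add: power2_eq_square flip: of_nat_mult)
  qed
  have "(b has_sum j) UNIV"
    using theta_has_sum[OF q2 q(2)] jacobi_triple_product[OF q2 q(2)] by (simp add: b_def[abs_def] j_def)
  from has_sum_int_symmetric_sums[OF this]
  have b_sums: "(\<lambda>i. b (int (Suc i))) sums ((j - 1) / 2)"
  proof -
    assume *: "(\<lambda>i. b (int (Suc i)) + b (- int (Suc i))) sums (j - b 0)"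
    have "b (int (Suc i)) + b (- int (Suc i)) = 2 * b (int (Suc i))" for i
      unfolding b_nat by simp
    moreover have "b 0 = 1" by (simp add: b_def)
    ultimately have "(\<lambda>i. 2 * b (int (Suc i))) sums (j - 1)"
      using * by simp
    from sums_divide[OF this, of 2] show ?thesis by simp
  qed
  define g where "g r = b r / (1 - (q ^ d) powi r * \<omega>)" for r
  have g_sums: "(\<lambda>i. g (int (Suc i)) + g (- int (Suc i))) sums (H - 1 / (1 - \<omega>))"
    using has_sum_int_symmetric_sums[OF H] by (simp add: g_def b_def)
  define T where "T i = (let n = Suc i in
        (1 - \<omega>) * (1 - inverse \<omega>) * (-1) ^ n * q ^ (n\<^sup>2 + d * n)
        / ((1 - \<omega> * q ^ (d * n)) * (1 - inverse \<omega> * q ^ (d * n))))" for i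
  have T: "(1 + \<omega>) * T i = (1 - \<omega>) * (g (int (Suc i)) + g (- int (Suc i)) - b (int (Suc i)))" for i
  proof -
    define n where "n = Suc i"
    define X where "X = q ^ (d * n)"
    define B where "B = (-1) ^ n * q ^ n\<^sup>2"
    have X_nz: "X \<noteq> 0" using q by (simp add: X_def)
    have "norm X < 1" using q d unfolding X_def norm_power by (simp add: power_less_one_iff n_def)
    then have ne: "1 - \<omega> * X \<noteq> 0" "\<omega> - X \<noteq> 0"
      using \<omega> by (auto simp: norm_mult dest: arg_cong[of _ _ norm])
    have "(q ^ d) powi int n = X" "(q ^ d) powi (- int n) = 1 / X"
      by (simp_all add: X_def power_int_minus power_mult field_simps)
    then have g: "g (int n) = B / (1 - \<omega> * X)" "g (- int n) = B / (1 - \<omega> / X)"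
      unfolding g_def b_nat B_def by (simp_all add: mult.commute)
    have Tn: "T i = (1 - \<omega>) * (1 - 1 / \<omega>) * B * X / ((1 - \<omega> * X) * (1 - X / \<omega>))"
      by (simp add: T_def Let_def X_def B_def n_def power_add divide_inverse mult_ac)
    have "1 - \<omega> / X = (X - \<omega>) / X" "1 - X / \<omega> = (\<omega> - X) / \<omega>" "1 - 1 / \<omega> = (\<omega> - 1) / \<omega>"
      using X_nz \<omega>_nz by (simp_all add: field_simps)
    note e = this
    have ne': "X - \<omega> \<noteq> 0" using ne by auto
    have "(1 + \<omega>) * T i = (1 - \<omega>) * B * ((1 + \<omega>) * (\<omega> - 1) * X / ((1 - \<omega> * X) * (\<omega> - X)))"
      unfolding Tn e using \<omega>_nz by (simp add: mult_ac)
    also have "(1 + \<omega>) * (\<omega> - 1) * X / ((1 - \<omega> * X) * (\<omega> - X)) =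
        1 / (1 - \<omega> * X) + X / (X - \<omega>) - 1"
      using ne ne' by (simp add: divide_simps) (simp add: algebra_simps)
    also have "(1 - \<omega>) * B * (1 / (1 - \<omega> * X) + X / (X - \<omega>) - 1) =
        (1 - \<omega>) * (g (int n) + g (- int n) - b (int n))"
      unfolding g e b_nat B_def[symmetric] by (simp add: algebra_simps)
    finally show ?thesis by (simp only: n_def)
  qed
  define R where "R = (1 - \<omega>) * (H - 1 / (1 - \<omega>) - (j - 1) / 2)"
  have R_sums: "(\<lambda>i. (1 + \<omega>) * T i) sums R"
    unfolding T R_def by (intro sums_mult sums_diff g_sums b_sums)
  \<comment> \<open>At \<omega> = -1 the series \<open>T\<close> cannot be recovered by division,
    but there \<open>R_sums\<close> is a sum of zeros and forces R = 0.\<close>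
  have "(1 + \<omega>) * suminf T = R"
  proof (cases "1 + \<omega> = 0")
    case True
    then have "(\<lambda>i. 0) sums R" using R_sums by simp
    then have "R = 0" using sums_zero sums_unique2 by blast
    then show ?thesis using True by simp
  next
    case False
    then have "T sums (R / (1 + \<omega>))"
      using sums_divide[OF R_sums, of "1 + \<omega>"] by simp
    then show ?thesis using False by (simp add: sums_unique[symmetric])
  qed
  moreover have "overrank_gf d \<omega> q = 1 / j * (1 + 2 * suminf T)"
    unfolding overrank_gf_def overpartition_quotient[OF q] j_def T_def[abs_def] ..
  moreover have "(1 + \<omega>) * (1 / j * (1 + 2 * suminf T)) = 1 / j * ((1 + \<omega>) + 2 * ((1 + \<omega>) * suminf T))"
    by (simp add: algebra_simps add_divide_distrib)
  ultimately have "(1 + \<omega>) * overrank_gf d \<omega> q = 1 / j * ((1 + \<omega>) + 2 * R)"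
    by simp
  also have "(1 + \<omega>) + 2 * R = 2 * (1 - \<omega>) * H - (1 - \<omega>) * j"
    using \<omega> by (simp add: R_def field_simps)
  finally show ?thesis
    using j_nz by (simp add: j_def field_simps)
qed

text \<open>For \<open>n = N\<close>, \<open>k = 0\<close> and x = w q^(1-2N) the dissected series
  has denominators 1 - \<omega> q^(2N(r-N)), so its index is shifted by N. The shift multiplies the
  theta coefficient by a constant and by t = q^(2Nr), and \<omega> t/(1 - \<omega> t) = 1/(1 -
  \<omega> t) - 1 brings back \<open>H\<close> minus a theta value. The resulting 1 is absorbed by
  m(PX,P,-1) = 1 - X m(X,P,-1), which also turns the exponent -N^2 of \<open>X\<close> into
  N^2.\<close>

lemma overrank_sum_decomposition:
  fixes q \<omega> w :: complex
  assumes q: "norm q < 1" "q \<noteq> 0" and N: "N > 0" and \<omega>: "norm \<omega> = 1" "\<omega> \<noteq> 1" and w: "w ^ N = \<omega>"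
    and H: "((\<lambda>r. theta_coeff (q\<^sup>2) r * q powi r / (1 - (q ^ (2 * N)) powi r * \<omega>)) has_sum H) UNIV"
  shows "H / jtheta q (q\<^sup>2) =
    appell_lerch (\<omega> * ((-1) ^ (N + 1) * q ^ N\<^sup>2)) (q ^ (2 * N\<^sup>2)) (-1) +
    (-1) ^ N * \<omega> * q powi (- int (N\<^sup>2)) * Psi N 0 (w * q powi (1 - int (2 * N))) q (-1) (q\<^sup>2)"
proof -
  define P where "P = q ^ (2 * N\<^sup>2)"
  define x where "x = w * q powi (1 - int (2 * N))"
  define X where "X = - ((q\<^sup>2) powi (int (N choose 2) - int N * int 0)) * (- x) ^ N"
  define j where "j = jtheta q (q\<^sup>2)"
  have q2: "norm (q\<^sup>2) < 1" "q\<^sup>2 \<noteq> 0" using q by (auto simp: norm_power power_less_one_iff)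
  have P: "norm P < 1" "P \<noteq> 0" using q N by (auto simp: P_def norm_power power_less_one_iff)
  have P': "(q\<^sup>2) ^ N\<^sup>2 = P" by (simp add: P_def power_mult)
  have P_powi: "P powi r = q powi (2 * int N ^ 2 * r)" for r
    unfolding P_def power_int_power by simp
  have q2_powi: "(q\<^sup>2) powi r = q powi (2 * r)" for r
    unfolding power_int_power by simp
  have \<omega>_nz: "\<omega> \<noteq> 0" using \<omega> by auto
  then have w_nz: "w \<noteq> 0" using w N by auto
  have x_nz: "x \<noteq> 0" using w_nz q by (simp add: x_def)
  have x_pow: "x ^ N = \<omega> * q powi (int N - 2 * int N ^ 2)"
    by (simp add: x_def power_mult_distrib w power_int_power' algebra_simps power2_eq_square)
  have X: "X = (-1) ^ (N + 1) * \<omega> * q powi (- int (N\<^sup>2))"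
  proof -
    have e: "2 * int (N choose 2) + (int N - 2 * int N ^ 2) = - int (N\<^sup>2)"
    proof -
      have "2 * int (N choose 2) = int (N * (N - 1))"
        using choose_two_double[of N] by (metis of_nat_mult of_nat_numeral)
      also have "\<dots> = int N ^ 2 - int N"
        using N by (cases N) (simp_all add: power2_eq_square algebra_simps)
      finally show ?thesis by simp
    qed
    have "q powi (2 * int (N choose 2)) * q powi (int N - 2 * int N ^ 2) = q powi (- int (N\<^sup>2))"
      by (simp only: power_int_add[OF disjI1[OF q(2)], symmetric] e)
    then show ?thesis
      unfolding X_def power_minus[of x] x_pow q2_powi by (simp add: mult_ac)
  qed
  have X_nz: "X \<noteq> 0" using \<omega>_nz q by (simp add: X)
  \<comment> \<open>The exponent N^2 (2r - 1) is an odd multiple of N^2 and never 0, so absolute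
    values alone exclude this pole.\<close>
  have XP: "P powi r * (X * (- 1)) \<noteq> 1" for r
  proof
    assume "P powi r * (X * (- 1)) = 1"
    then have "((-1) ^ N * \<omega>) * q powi (2 * int N ^ 2 * r - int (N\<^sup>2)) = q powi 0"
      using q by (simp add: X P_powi power_int_diff power_int_minus field_simps)
    from norm_powi_inj(1)[OF q _ this] \<omega> have "int N ^ 2 * (2 * r - 1) = 0"
      by (simp add: norm_mult norm_power algebra_simps)
    then show False using N by (simp, presburger)
  qed
  have j_nz: "j \<noteq> 0"
    unfolding j_def
  proof (rule jtheta_nonzero[OF q2 q(2)])
    fix r
    show "q \<noteq> (q\<^sup>2) powi r"
    proof
      assume "q = (q\<^sup>2) powi r"
      then have "1 * q powi 1 = q powi (2 * r)" by (simp add: q2_powi)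
      from norm_powi_inj(1)[OF q _ this] show False by (simp, presburger)
    qed
  qed
  have j1_nz: "jtheta (- 1) P \<noteq> 0"
  proof (rule jtheta_nonzero[OF P])
    fix r
    show "- 1 \<noteq> P powi r"
    proof
      assume "- 1 = P powi r"
      then have "(- 1) * q powi 0 = q powi (2 * int N ^ 2 * r)" by (simp add: P_powi)
      from norm_powi_inj(2)[OF q _ this] show False by simp
    qed
  qed simp
  have generic: "Psi_generic N (int 0) x q (- 1) (q\<^sup>2)"
  proof -
    have "jtheta (X * (- 1)) P \<noteq> 0"
      using X_nz P XP[of "- r" for r] by (intro jtheta_nonzero) (auto simp: power_int_minus field_simps)
    \<comment> \<open>Here the exponents may agree; the pole is excluded by
      \<open>\<omega> \<noteq> 1\<close>.\<close>
    moreover have "jtheta ((q\<^sup>2) ^ (N * t) * (x * q) ^ N) P \<noteq> 0" for t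
    proof (rule jtheta_nonzero[OF P])
      fix r
      show "(q\<^sup>2) ^ (N * t) * (x * q) ^ N \<noteq> P powi r"
      proof
        assume "(q\<^sup>2) ^ (N * t) * (x * q) ^ N = P powi r"
        moreover have "(q\<^sup>2) ^ (N * t) * (x * q) ^ N =
            \<omega> * q powi (int (2 * (N * t)) + (int N - 2 * int N ^ 2) + int N)"
          unfolding power_mult_distrib x_pow power_int_add[OF disjI1[OF q(2)]] power_int_of_nat
          by (simp add: mult_ac flip: power_mult)
        ultimately have "\<omega> * q powi (int (2 * (N * t)) + (int N - 2 * int N ^ 2) + int N) = q powi (2 * int N ^ 2 * r)"
          by (simp only: P_powi)
        from norm_powi_inj(2)[OF q \<omega>(1) this] \<omega> show False by simp
      qed
    qed (use q x_nz in auto)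
    ultimately show ?thesis
      unfolding Psi_generic_def jtheta2_def P' X_def[symmetric]
      using x_nz q j_nz j1_nz by (simp add: j_def)
  qed
  define K where "K = j * (appell_lerch X P (- 1) + Psi N 0 x q (- 1) (q\<^sup>2))"
  have K: "((\<lambda>r. theta_coeff (q\<^sup>2) r * q powi r / (1 - ((q\<^sup>2) powi (r - 1) * (x * q)) ^ N)) has_sum K) UNIV"
    using lerch_average_Psi[OF q2 N x_nz q(2) _ generic]
    by (simp add: K_def j_def P' X_def binomial_eq_0)
  define b where "b r = theta_coeff (q\<^sup>2) r * q powi r" for r
  have b_sum: "(b has_sum j) UNIV"
    using theta_has_sum[OF q2 q(2)] jacobi_triple_product[OF q2 q(2)] by (simp add: b_def[abs_def] j_def)
  define s where "s = (-1) ^ N * q ^ N\<^sup>2"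
  define t where "t r = (q ^ (2 * N)) powi r" for r
  have t_reg: "1 - t r * \<omega> \<noteq> 0" for r
  proof
    assume "1 - t r * \<omega> = 0"
    then have "\<omega> * q powi (2 * int N * r) = q powi 0"
      by (simp add: t_def power_int_power mult.commute)
    from norm_powi_inj(2)[OF q \<omega>(1) this] \<omega> show False by simp
  qed
  have "((\<lambda>r. b (r + int N) / (1 - ((q\<^sup>2) powi (r + int N - 1) * (x * q)) ^ N)) has_sum K) UNIV"
    using K by (subst (asm) has_sum_int_shift[of _ "int N", symmetric]) (simp add: b_def)
  moreover have "b (r + int N) = s * (b r * t r)" for r
  proof -
    have "(r + int N) * (r + int N) = r * r + int (N\<^sup>2) + int (2 * N) * r"
      by (simp add: algebra_simps power2_eq_square)
    then have "q powi ((r + int N) * (r + int N)) = q powi (r * r) * q ^ N\<^sup>2 * t r"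
      using q by (simp only: power_int_add power_int_of_nat power_int_mult t_def simp_thms)
    then show ?thesis
      unfolding b_def theta_coeff_square[OF q(2)] s_def by (simp add: power_int_add mult_ac)
  qed
  moreover have "((q\<^sup>2) powi (r + int N - 1) * (x * q)) ^ N = t r * \<omega>" for r
  proof -
    have e: "2 * (r + int N - 1) * int N + (int N - 2 * int N ^ 2) + int N = int (2 * N) * r"
      by (simp add: algebra_simps power2_eq_square)
    have "((q\<^sup>2) powi (r + int N - 1) * (x * q)) ^ N =
        q powi (2 * (r + int N - 1) * int N + (int N - 2 * int N ^ 2) + int N) * \<omega>"
      unfolding power_mult_distrib x_pow q2_powi power_int_add[OF disjI1[OF q(2)]] power_int_power'
      by (simp add: mult_ac)
    also have "\<dots> = t r * \<omega>"
      unfolding e by (simp add: t_def power_int_power)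
    finally show ?thesis .
  qed
  ultimately have "((\<lambda>r. \<omega> * (s * (b r * t r) / (1 - t r * \<omega>))) has_sum \<omega> * K) UNIV"
    by (intro has_sum_cmult_right) simp
  moreover have "((\<lambda>r. s * (b r / (1 - t r * \<omega>) + - b r)) has_sum s * (H + - j)) UNIV"
    using H by (intro has_sum_cmult_right has_sum_add has_sum_uminusI b_sum) (simp add: b_def t_def)
  moreover have "\<omega> * (s * (b r * t r) / (1 - t r * \<omega>)) = s * (b r / (1 - t r * \<omega>) + - b r)" for r
    using t_reg[of r] by (simp add: field_simps)
  ultimately have K_eq: "\<omega> * K = s * (H + - j)"
    using has_sum_unique by fastforce
  have s_inv: "s * ((-1) ^ N * q powi (- int (N\<^sup>2))) = 1"
    using q by (simp add: s_def power_int_minus mult_ac flip: of_nat_power)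
  have "(-1) ^ N * q powi (- int (N\<^sup>2)) * (\<omega> * K) = s * ((-1) ^ N * q powi (- int (N\<^sup>2))) * (H + - j)"
    unfolding K_eq by (simp only: mult_ac)
  then have "H - j = (-1) ^ N * q powi (- int (N\<^sup>2)) * (\<omega> * K)"
    unfolding s_inv by simp
  then have "H / j = 1 + (-1) ^ N * q powi (- int (N\<^sup>2)) * \<omega> * (K / j)"
    using j_nz by (simp add: field_simps)
  also have "K / j = appell_lerch X P (- 1) + Psi N 0 x q (- 1) (q\<^sup>2)"
    using j_nz by (simp add: K_def)
  also have "1 + (-1) ^ N * q powi (- int (N\<^sup>2)) * \<omega> * (appell_lerch X P (- 1) + Psi N 0 x q (- 1) (q\<^sup>2)) =
      (1 - X * appell_lerch X P (- 1)) + (-1) ^ N * \<omega> * q powi (- int (N\<^sup>2)) * Psi N 0 x q (- 1) (q\<^sup>2)"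
    by (simp add: X algebra_simps)
  also have "1 - X * appell_lerch X P (- 1) = appell_lerch (P * X) P (- 1)"
    using appell_lerch_mult_base[OF P X_nz _ XP j1_nz] by simp
  also have "P * X = \<omega> * ((-1) ^ (N + 1) * q ^ N\<^sup>2)"
  proof -
    have "P * q powi (- int (N\<^sup>2)) = q ^ N\<^sup>2"
      using q by (simp add: P_def power_int_minus mult_2 power_add flip: of_nat_power)
    then show ?thesis unfolding X by (simp add: mult_ac)
  qed
  finally show ?thesis
    by (simp add: j_def P_def x_def)
qed

text \<open>The averaging formula for base q^(2N^2) at the argument -1 left behind by the first
  dissection. Raised to the power M, the pole parameters have exponents N^2 (2r - 1) M, which are
  nonzero; what remains is arithmetic of exponents.\<close>

lemma appell_lerch_average_closed_form:
  fixes q z' :: complex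
  assumes q: "norm q < 1" "q \<noteq> 0" and N: "N > 0" and M: "M > 0" and k: "k < M"
    and generic: "Psi_generic M (int k) ((-1) ^ (N + 1) * q ^ N\<^sup>2) (-1) z' (q ^ (2 * N\<^sup>2))"
  shows "(\<Sum>j<M. zeta M powi (- (int k * int j)) *
      appell_lerch (zeta M ^ j * ((-1) ^ (N + 1) * q ^ N\<^sup>2)) (q ^ (2 * N\<^sup>2)) (-1)) =
    of_nat M * ((-1) powi (int N * int k) * q powi (- (int (N\<^sup>2) * int k ^ 2)) *
      appell_lerch ((-1) ^ (1 + N * M) * q powi (int (N\<^sup>2) * (int M ^ 2 - 2 * int M * int k)))
        (q ^ (2 * N\<^sup>2 * M\<^sup>2)) z' +
      Psi M (int k) ((-1) ^ (N + 1) * q ^ N\<^sup>2) (-1) z' (q ^ (2 * N\<^sup>2)))"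
proof -
  define P where "P = q ^ (2 * N\<^sup>2)"
  define X where "X = (-1) ^ (N + 1) * q ^ N\<^sup>2"
  have P: "norm P < 1" "P \<noteq> 0" using q N by (auto simp: P_def norm_power power_less_one_iff)
  have X_nz: "X \<noteq> 0" using q by (simp add: X_def)
  have P_powi: "P powi r = q powi (2 * int N ^ 2 * r)" for r
    unfolding P_def power_int_power by simp
  have gen: "Psi_generic M (int k) X (-1) z' P"
    using generic by (simp only: P_def X_def)
  then have z': "z' \<noteq> 0" "jtheta (-1) P \<noteq> 0" by (simp_all add: Psi_generic_def)
  have mX: "- X = (-1) ^ N * q ^ N\<^sup>2" by (simp add: X_def)
  have reg: "(P powi (r - 1) * (X * (-1))) ^ M \<noteq> 1" for r
  proof
    assume "(P powi (r - 1) * (X * (-1))) ^ M = 1"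
    moreover have "P powi (r - 1) * (X * (-1)) = (-1) ^ N * q powi (2 * int N ^ 2 * (r - 1) + int (N\<^sup>2))"
      using q mX by (simp add: P_powi power_int_add flip: of_nat_power)
    ultimately have "((-1) ^ N) ^ M * q powi ((2 * int N ^ 2 * (r - 1) + int (N\<^sup>2)) * int M) = q powi 0"
      by (simp add: power_mult_distrib power_int_power')
    moreover have "norm (((-1 :: complex) ^ N) ^ M) = 1" by (simp add: norm_power)
    ultimately have "(2 * int N ^ 2 * (r - 1) + int (N\<^sup>2)) * int M = 0"
      using norm_powi_inj(1)[OF q] by blast
    moreover have "2 * int N ^ 2 * (r - 1) + int (N\<^sup>2) = int N ^ 2 * (2 * r - 1)"
      by (simp add: algebra_simps)
    ultimately show False using M N by (simp, presburger)
  qed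
  have two_choose: "2 * int (n choose 2) = int n ^ 2 - int n" for n
  proof -
    have "2 * int (n choose 2) = int (n * (n - 1))"
      using choose_two_double[of n] by (metis of_nat_mult of_nat_numeral)
    also have "\<dots> = int n ^ 2 - int n"
      by (cases n) (simp_all add: power2_eq_square algebra_simps)
    finally show ?thesis .
  qed
  \<comment> \<open>(-X)^k contributes N^2 k and the power of P contributes -N^2 k (k + 1), which
    leaves the pure square -N^2 k^2.\<close>
  have coeff: "(- X) ^ k / P ^ (Suc k choose 2) = (-1) powi (int N * int k) * q powi (- (int (N\<^sup>2) * int k ^ 2))"
  proof -
    have e: "int (N\<^sup>2) * int k - int N ^ 2 * (2 * int (Suc k choose 2)) = - (int (N\<^sup>2) * int k ^ 2)"
      unfolding two_choose by (simp add: algebra_simps power2_eq_square)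
    have "P ^ (Suc k choose 2) = q powi (int N ^ 2 * (2 * int (Suc k choose 2)))"
      using P_powi[of "int (Suc k choose 2)"] by (simp add: mult_ac)
    moreover have "(q ^ N\<^sup>2) ^ k = q powi (int (N\<^sup>2) * int k)"
      by (simp only: power_int_of_nat power_mult flip: of_nat_mult)
    moreover have "((-1 :: complex) ^ N) ^ k = (-1) powi (int N * int k)"
      by (simp only: power_int_of_nat power_mult flip: of_nat_mult)
    ultimately have "(- X) ^ k / P ^ (Suc k choose 2) = (-1) powi (int N * int k) *
        (q powi (int (N\<^sup>2) * int k) / q powi (int N ^ 2 * (2 * int (Suc k choose 2))))"
      unfolding mX power_mult_distrib by simp
    also have "q powi (int (N\<^sup>2) * int k) / q powi (int N ^ 2 * (2 * int (Suc k choose 2))) =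
        q powi (- (int (N\<^sup>2) * int k ^ 2))"
      by (simp only: power_int_diff[OF disjI1[OF q(2)], symmetric] e)
    finally show ?thesis .
  qed
  have arg: "- (P powi (int (M choose 2) - int M * int k)) * (- X) ^ M =
      (-1) ^ (1 + N * M) * q powi (int (N\<^sup>2) * (int M ^ 2 - 2 * int M * int k))"
  proof -
    have e: "2 * int N ^ 2 * (int (M choose 2) - int M * int k) + int (N\<^sup>2) * int M =
        int (N\<^sup>2) * (int M ^ 2 - 2 * int M * int k)"
    proof -
      have "2 * int N ^ 2 * (int (M choose 2) - int M * int k) =
          int N ^ 2 * (2 * int (M choose 2) - 2 * int M * int k)" by (simp add: algebra_simps)
      then show ?thesis unfolding two_choose by (simp add: algebra_simps)
    qed
    have "(q ^ N\<^sup>2) ^ M = q powi (int (N\<^sup>2) * int M)"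
      by (simp only: power_int_of_nat power_mult flip: of_nat_mult)
    then have "- (P powi (int (M choose 2) - int M * int k)) * (- X) ^ M =
        (-1) ^ (1 + N * M) * (q powi (2 * int N ^ 2 * (int (M choose 2) - int M * int k)) * q powi (int (N\<^sup>2) * int M))"
      unfolding mX power_mult_distrib P_powi by (simp add: power_mult)
    also have "q powi (2 * int N ^ 2 * (int (M choose 2) - int M * int k)) * q powi (int (N\<^sup>2) * int M) =
        q powi (int (N\<^sup>2) * (int M ^ 2 - 2 * int M * int k))"
      by (simp only: power_int_add[OF disjI1[OF q(2)], symmetric] e)
    finally show ?thesis .
  qed
  have PM: "P ^ M\<^sup>2 = q ^ (2 * N\<^sup>2 * M\<^sup>2)"
    by (simp only: P_def power_mult)
  show ?thesis
    using appell_lerch_average[OF P M k _ reg lerch_average_Psi[OF P M X_nz _ z'(1) gen] z'(2)]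
    unfolding coeff arg PM unfolding P_def X_def by simp
qed

text \<open>Since 1 - z vanishes at z = 1, the trivial root can be added to the sums. Then
  \<open>e a j * (1 - zeta M ^ j)\<close> is the difference of the kernels of residues a and a - 1,
  so the m-part splits into two complete Fourier sums, which can be evaluated at independent points
  \<open>z'\<close> and \<open>z''\<close>.\<close>

lemma rank_residue_identity:
  fixes d M :: nat and a :: int and q z' z'' :: complex
  assumes q: "norm q < 1" "q \<noteq> 0"
    and d: "d = 2 * N" "N > 0"
    and a: "a = int (Suc k)" "Suc k < M"
    and generic': "Psi_generic M a ((-1) ^ (N + 1) * q ^ N\<^sup>2) (-1) z' (q ^ (2 * N\<^sup>2))"
    and generic'': "Psi_generic M (a - 1) ((-1) ^ (N + 1) * q ^ N\<^sup>2) (-1) z'' (q ^ (2 * N\<^sup>2))"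
  shows "1 / of_nat M * (\<Sum>j = 1..M - 1. zeta M powi (- (a * int j)) *
      ((1 + zeta M ^ j) * overrank_gf d (zeta M ^ j) q)) =
      of_bool (a = 1)
    + 2 * (-1) powi (int N * a) * q powi (- (int (N\<^sup>2) * a ^ 2))
        * appell_lerch ((-1) ^ (1 + N * M) * q powi (int (N\<^sup>2) * (int M ^ 2 - 2 * int M * a)))
            (q ^ (2 * N\<^sup>2 * M\<^sup>2)) z'
    + 2 * (-1) powi (int N * (a - 1) + 1) * q powi (- (int (N\<^sup>2) * (a ^ 2 - 2 * a + 1)))
        * appell_lerch ((-1) ^ (1 + N * M) * q powi (int (N\<^sup>2) * (int M ^ 2 - 2 * int M * (a - 1))))
            (q ^ (2 * N\<^sup>2 * M\<^sup>2)) z''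
    + 2 * Psi M a ((-1) ^ (N + 1) * q ^ N\<^sup>2) (-1) z' (q ^ (2 * N\<^sup>2))
    - 2 * Psi M (a - 1) ((-1) ^ (N + 1) * q ^ N\<^sup>2) (-1) z'' (q ^ (2 * N\<^sup>2))
    + 2 / of_nat M * (-1) ^ N * q powi (- int (N\<^sup>2))
        * (\<Sum>j = 1..M - 1. zeta M powi (int j - a * int j) * (1 - zeta M ^ j)
             * Psi N 0 (exp (4 * of_real pi * \<i> * of_nat j / (of_nat d * of_nat M)) * q powi (1 - int d))
                 q (-1) (q ^ 2))"
proof -
  define X where "X = (-1) ^ (N + 1) * q ^ N\<^sup>2"
  define P where "P = q ^ (2 * N\<^sup>2)"
  define A where "A j = appell_lerch (zeta M ^ j * X) P (-1)" for j
  define B where "B j = Psi N 0 (exp (4 * of_real pi * \<i> * of_nat j / (of_nat d * of_nat M)) * q powi (1 - int d))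
                 q (-1) (q ^ 2)" for j
  define e where "e c j = zeta M powi (- (c * int j))" for c j
  define s where "s = (-1) ^ N * q powi (- int (N\<^sup>2))"
  have M: "M > 0" using a by simp
  have q2: "norm (q\<^sup>2) < 1" "q\<^sup>2 \<noteq> 0" using q by (auto simp: norm_power power_less_one_iff)
  have qd: "norm (q ^ d) < 1" "q ^ d \<noteq> 0" using q d by (auto simp: norm_power power_less_one_iff)
  have gf: "(1 + zeta M ^ j) * overrank_gf d (zeta M ^ j) q =
      - (1 - zeta M ^ j) + 2 * (1 - zeta M ^ j) * A j + 2 * (s * (zeta M ^ j * ((1 - zeta M ^ j) * B j)))"
    if j: "j \<in> {1..M - 1}" for j
  proof -
    have \<omega>: "norm (zeta M ^ j) = 1" "zeta M ^ j \<noteq> 1"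
    proof -
      show "norm (zeta M ^ j) = 1" by (simp add: norm_power)
      have "\<not> M dvd j" using j by (auto dest: dvd_imp_le)
      then show "zeta M ^ j \<noteq> 1"
        using zeta_powi_eq_1_iff[OF M, of "int j"] by simp
    qed
    \<comment> \<open>As d = 2N, this is an N-th root of \<open>zeta M ^ j\<close>, the
      \<open>w\<close> required by the decomposition.\<close>
    define w where "w = exp (4 * of_real pi * \<i> * of_nat j / (of_nat d * of_nat M))"
    have w: "w ^ N = zeta M ^ j"
      unfolding w_def zeta_power exp_of_nat_mult[symmetric] using d M by (simp add: field_simps)
    obtain C where C: "\<And>r::int. norm (1 / (1 - (q ^ d) powi r * zeta M ^ j)) \<le> C"
      using bounded_lerch_factor[OF qd] by blast
    obtain H where H: "((\<lambda>r. theta_coeff (q\<^sup>2) r * q powi r / (1 - (q ^ d) powi r * zeta M ^ j)) has_sum H) UNIV"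
      using abs_summable_summable[OF theta_coeff_bound_summable[OF q2 q(2),
          of "\<lambda>r. 1 / (1 - (q ^ d) powi r * zeta M ^ j)" C]] C
      by (auto simp: summable_on_def)
    have "H / jtheta q (q\<^sup>2) = A j + s * zeta M ^ j * B j"
      using overrank_sum_decomposition[OF q d(2) \<omega> w H[unfolded d(1)]]
      by (simp add: A_def B_def X_def P_def s_def w_def d(1) mult_ac)
    then show ?thesis
      using overrank_gf_eq[OF q _ \<omega> H] d by (simp add: algebra_simps)
  qed
  have ee: "e a j * zeta M ^ j = e (int k) j" for j
  proof -
    have "e a j * zeta M ^ j = zeta M powi (- (a * int j) + int j)"
      unfolding e_def by (simp only: power_int_add zeta_nz simp_thms power_int_of_nat)
    also have "- (a * int j) + int j = - (int k * int j)"
      using a by (simp add: algebra_simps)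
    finally show ?thesis by (simp add: e_def)
  qed
  have ext: "(\<Sum>j = 1..M - 1. f j) = (\<Sum>j<M. f j)" if "f 0 = 0" for f :: "nat \<Rightarrow> complex"
    using that M by (intro sum.mono_neutral_left) (auto, metis One_nat_def Suc_leI Suc_pred' atLeastAtMost_iff less_Suc_eq_le neq0_conv)
  have e_sum: "(\<Sum>j<M. e c j) = (if int M dvd c then of_nat M else 0)" for c
    unfolding e_def using zeta_orthogonality[OF M, of "- c"] by simp
  have "(\<Sum>j = 1..M - 1. zeta M powi (- (a * int j)) * ((1 + zeta M ^ j) * overrank_gf d (zeta M ^ j) q)) =
      (\<Sum>j = 1..M - 1. - (e a j * (1 - zeta M ^ j)) + 2 * (e a j * (1 - zeta M ^ j) * A j) +
        2 * s * (e a j * zeta M ^ j * (1 - zeta M ^ j) * B j))"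
    by (rule sum.cong) (simp_all only: gf e_def[symmetric], simp add: algebra_simps)
  also have "\<dots> = - (\<Sum>j = 1..M - 1. e a j * (1 - zeta M ^ j)) + 2 * (\<Sum>j = 1..M - 1. e a j * (1 - zeta M ^ j) * A j) +
        2 * s * (\<Sum>j = 1..M - 1. e a j * zeta M ^ j * (1 - zeta M ^ j) * B j)"
    by (simp only: sum.distrib sum_negf sum_distrib_left)
  also have "(\<Sum>j = 1..M - 1. e a j * (1 - zeta M ^ j)) = (\<Sum>j<M. e a j - e (int k) j)"
    by (subst ext) (simp_all add: right_diff_distrib ee)
  \<comment> \<open>By orthogonality the kernel of residue a sums to 0, because 0 < a < M, and that
    of a - 1 to M exactly if a = 1: the origin of the indicator term.\<close>
  also have "\<dots> = - (of_nat M * of_bool (a = 1))"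
  proof -
    have "\<not> int M dvd a" using a zdvd_not_zless[of a "int M"] by simp
    moreover have "int M dvd int k \<longleftrightarrow> a = 1"
      using a by (auto dest: dvd_imp_le)
    ultimately show ?thesis by (simp add: sum_subtractf e_sum)
  qed
  also have "(\<Sum>j = 1..M - 1. e a j * (1 - zeta M ^ j) * A j) = (\<Sum>j<M. e a j * A j) - (\<Sum>j<M. e (int k) j * A j)"
    by (subst ext) (simp_all add: right_diff_distrib left_diff_distrib ee sum_subtractf)
  finally have total: "(\<Sum>j = 1..M - 1. zeta M powi (- (a * int j)) * ((1 + zeta M ^ j) * overrank_gf d (zeta M ^ j) q)) =
      - (- (of_nat M * of_bool (a = 1))) + 2 * ((\<Sum>j<M. e a j * A j) - (\<Sum>j<M. e (int k) j * A j)) +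
      2 * s * (\<Sum>j = 1..M - 1. e a j * zeta M ^ j * (1 - zeta M ^ j) * B j)" .
  have "1 / m * (- (- (m * b)) + 2 * (u - v) + 2 * s * w) = b + 2 * (u / m) - 2 * (v / m) + 2 / m * s * w"
    if "m \<noteq> 0" for m b u v w :: complex
    using that by (simp add: field_simps)
  then have main: "1 / of_nat M * (\<Sum>j = 1..M - 1. zeta M powi (- (a * int j)) * ((1 + zeta M ^ j) * overrank_gf d (zeta M ^ j) q)) =
      of_bool (a = 1) + 2 * ((\<Sum>j<M. e a j * A j) / of_nat M) - 2 * ((\<Sum>j<M. e (int k) j * A j) / of_nat M) +
      2 / of_nat M * s * (\<Sum>j = 1..M - 1. e a j * zeta M ^ j * (1 - zeta M ^ j) * B j)"
    unfolding total using M by simp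
  have A1: "(\<Sum>j<M. e a j * A j) / of_nat M =
      (-1) powi (int N * a) * q powi (- (int (N\<^sup>2) * a ^ 2)) *
      appell_lerch ((-1) ^ (1 + N * M) * q powi (int (N\<^sup>2) * (int M ^ 2 - 2 * int M * a)))
        (q ^ (2 * N\<^sup>2 * M\<^sup>2)) z' + Psi M a X (-1) z' P"
    using appell_lerch_average_closed_form[OF q d(2) M a(2) generic'[unfolded a(1)]] M
    unfolding e_def A_def X_def P_def a(1) by simp
  have a1: "a - 1 = int k" using a by simp
  have A2: "(\<Sum>j<M. e (int k) j * A j) / of_nat M =
      (-1) powi (int N * (a - 1)) * q powi (- (int (N\<^sup>2) * (a - 1) ^ 2)) *
      appell_lerch ((-1) ^ (1 + N * M) * q powi (int (N\<^sup>2) * (int M ^ 2 - 2 * int M * (a - 1))))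
        (q ^ (2 * N\<^sup>2 * M\<^sup>2)) z'' + Psi M (a - 1) X (-1) z'' P"
    using appell_lerch_average_closed_form[OF q d(2) M Suc_lessD[OF a(2)] generic''[unfolded a1]] M
    unfolding e_def A_def X_def P_def a1 by simp
  have sq: "(a - 1) ^ 2 = a ^ 2 - 2 * a + 1"
    by (simp add: power2_eq_square algebra_simps)
  have sgn: "(-1 :: complex) powi (int N * (a - 1) + 1) = - ((-1) powi (int N * (a - 1)))"
    by (simp add: power_int_add)
  have eB: "e a j * zeta M ^ j * (1 - zeta M ^ j) * B j = zeta M powi (int j - a * int j) * (1 - zeta M ^ j) * B j" for j
    unfolding e_def by (simp add: power_int_diff power_int_minus field_simps)
  show ?thesis
    unfolding main A1 A2 sq sgn eB B_def[symmetric] X_def[symmetric] P_def[symmetric]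
    by (simp add: s_def algebra_simps)
qed

section \<open>Overpartitions with bounded parts\<close>

definition bounded_overpartitions :: "nat \<Rightarrow> nat \<Rightarrow> (nat multiset \<times> nat set) set" where
  "bounded_overpartitions K n = {(P, S) \<in> overpartitions n. set_mset P \<subseteq> {..K}}"

definition plain_overpartitions :: "nat \<Rightarrow> nat \<Rightarrow> (nat multiset \<times> nat set) set" where
  "plain_overpartitions K n = {(P, S) \<in> bounded_overpartitions (Suc K) n. Suc K \<notin> S}"

lemma bounded_overpartitions_0:
  "bounded_overpartitions 0 n = (if n = 0 then {({#}, {})} else {})"
proof -
  have "P = {#}" if "0 \<notin># P" "set_mset P \<subseteq> {0}" for P :: "nat multiset"
    using that by (metis insertI1 set_mset_eq_empty_iff subset_singletonD)
  then have "p \<in> bounded_overpartitions 0 n \<longleftrightarrow> p = ({#}, {}) \<and> n = 0" for p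
    unfolding bounded_overpartitions_def overpartitions_def by (cases p) fastforce
  then show ?thesis by auto
qed

lemma plain_overpartitions_split:
  "plain_overpartitions K n = bounded_overpartitions K n \<union> {(P, S) \<in> plain_overpartitions K n. Suc K \<in># P}"
  "bounded_overpartitions K n \<inter> {(P, S) \<in> plain_overpartitions K n. Suc K \<in># P} = {}"
  by (auto simp: plain_overpartitions_def bounded_overpartitions_def overpartitions_def atMost_Suc
      le_Suc_eq subset_iff)

text \<open>As K + 1 is not overlined, one copy can be removed, even the last, without leaving a
  stray element in \<open>S\<close>.\<close>

lemma bij_betw_remove_part:
  "bij_betw (\<lambda>(P, S). (P - {#Suc K#}, S))
    {(P, S) \<in> plain_overpartitions K (n + Suc K). Suc K \<in># P} (plain_overpartitions K n)"
proof (rule bij_betw_byWitness[where f' = "\<lambda>(P, S). (add_mset (Suc K) P, S)"])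
  show "\<forall>a\<in>{(P, S) \<in> plain_overpartitions K (n + Suc K). Suc K \<in># P}.
      (case case a of (P, S) \<Rightarrow> (P - {#Suc K#}, S) of (P, S) \<Rightarrow> (add_mset (Suc K) P, S)) = a"
    by auto
  show "(\<lambda>(P, S). (P - {#Suc K#}, S)) ` {(P, S) \<in> plain_overpartitions K (n + Suc K). Suc K \<in># P}
      \<subseteq> plain_overpartitions K n"
  proof (clarsimp)
    fix P S assume "(P, S) \<in> plain_overpartitions K (Suc (n + K))" and mem: "Suc K \<in># P"
    then have P: "0 \<notin># P" "sum_mset P = n + Suc K" "S \<subseteq> set_mset P" "set_mset P \<subseteq> {..Suc K}" "Suc K \<notin> S"
      by (auto simp: plain_overpartitions_def bounded_overpartitions_def overpartitions_def)
    obtain R where R: "P = add_mset (Suc K) R"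
      using mem by (metis insert_DiffM)
    show "(P - {#Suc K#}, S) \<in> plain_overpartitions K n"
      using P unfolding R
      by (auto simp: plain_overpartitions_def bounded_overpartitions_def overpartitions_def)
  qed
qed (auto simp: plain_overpartitions_def bounded_overpartitions_def overpartitions_def)

lemma remove_part_empty:
  assumes "n < Suc K"
  shows "{(P, S) \<in> plain_overpartitions K n. Suc K \<in># P} = {}"
proof -
  have "Suc K \<le> n" if "sum_mset P = n" "Suc K \<in># P" for P
    using that by (metis multi_member_split le_add1 sum_mset.add_mset)
  then show ?thesis using assms
    by (fastforce simp: plain_overpartitions_def bounded_overpartitions_def overpartitions_def)
qed

lemma bij_betw_overline_part:
  "bij_betw (\<lambda>(P, S). (P, insert (Suc K) S))
    {(P, S) \<in> plain_overpartitions K n. Suc K \<in># P}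
    {(P, S) \<in> bounded_overpartitions (Suc K) n. Suc K \<in> S}"
  by (rule bij_betw_byWitness[where f' = "\<lambda>(P, S). (P, S - {Suc K})"])
     (auto simp: plain_overpartitions_def bounded_overpartitions_def overpartitions_def)

text \<open>Finiteness must precede any additivity of \<open>card\<close>. It follows the same
  decomposition: induction on K, and inside it strong induction on n, since removing a part K + 1
  lowers n.\<close>

lemma finite_bounded_overpartitions: "finite (bounded_overpartitions K n)"
  and finite_plain_overpartitions: "finite (plain_overpartitions K n)"
proof -
  have plain: "finite (plain_overpartitions K n)" if "\<And>n. finite (bounded_overpartitions K n)" for K n
  proof (induction n rule: less_induct)
    case (less n)
    have "finite {(P, S) \<in> plain_overpartitions K n. Suc K \<in># P}"
    proof (cases "n < Suc K")
      case True
      then show ?thesis by (simp only: remove_part_empty finite.emptyI)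
    next
      case False
      then have "n = (n - Suc K) + Suc K" by simp
      then show ?thesis
        using bij_betw_finite[OF bij_betw_remove_part[of K "n - Suc K"]] less.IH[of "n - Suc K"] False by simp
    qed
    then show ?case
      by (subst plain_overpartitions_split(1)) (rule finite_UnI[OF that])
  qed
  have bounded: "finite (bounded_overpartitions K n)" for K n
  proof (induction K arbitrary: n)
    case 0
    then show ?case by (simp add: bounded_overpartitions_0)
  next
    case (Suc K)
    have f: "finite (plain_overpartitions K n)" by (rule plain[OF Suc.IH])
    then have "finite {(P, S) \<in> plain_overpartitions K n. Suc K \<in># P}"
      by (rule rev_finite_subset) auto
    then have fW: "finite {(P, S) \<in> bounded_overpartitions (Suc K) n. Suc K \<in> S}"
      using bij_betw_finite[OF bij_betw_overline_part] by blast
    have "bounded_overpartitions (Suc K) n = plain_overpartitions K n \<union>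
        {(P, S) \<in> bounded_overpartitions (Suc K) n. Suc K \<in> S}"
      by (auto simp: plain_overpartitions_def)
    from arg_cong[OF this, of finite] show ?case
      using f fW by (simp only: finite_Un simp_thms)
  qed
  show "finite (bounded_overpartitions K n)" "finite (plain_overpartitions K n)"
    using bounded plain by blast+
qed

lemma card_plain_overpartitions:
  "card (plain_overpartitions K n) =
    card (bounded_overpartitions K n) + card {(P, S) \<in> plain_overpartitions K n. Suc K \<in># P}"
proof -
  have fin: "finite {(P, S) \<in> plain_overpartitions K n. Suc K \<in># P}"
    using finite_plain_overpartitions[of K n] by (auto elim: rev_finite_subset)
  have "card (plain_overpartitions K n) =
      card (bounded_overpartitions K n \<union> {(P, S) \<in> plain_overpartitions K n. Suc K \<in># P})"
    by (rule arg_cong[OF plain_overpartitions_split(1)])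
  also have "\<dots> = card (bounded_overpartitions K n) + card {(P, S) \<in> plain_overpartitions K n. Suc K \<in># P}"
    by (rule card_Un_disjoint[OF finite_bounded_overpartitions fin plain_overpartitions_split(2)])
  finally show ?thesis .
qed

lemma card_bounded_overpartitions_Suc:
  "card (bounded_overpartitions (Suc K) n) =
    card (bounded_overpartitions K n) + 2 * card {(P, S) \<in> plain_overpartitions K n. Suc K \<in># P}"
proof -
  let ?U = "{(P, S) \<in> plain_overpartitions K n. Suc K \<in># P}"
  let ?W = "{(P, S) \<in> bounded_overpartitions (Suc K) n. Suc K \<in> S}"
  have fin: "finite ?U" "finite ?W"
    using finite_plain_overpartitions[of K n] finite_bounded_overpartitions[of "Suc K" n]
    by (auto elim: rev_finite_subset)
  have un: "bounded_overpartitions (Suc K) n = plain_overpartitions K n \<union> ?W"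
    and disj: "plain_overpartitions K n \<inter> ?W = {}"
    by (auto simp: plain_overpartitions_def)
  have "card (bounded_overpartitions (Suc K) n) = card (plain_overpartitions K n \<union> ?W)"
    by (rule arg_cong[OF un])
  also have "\<dots> = card (plain_overpartitions K n) + card ?W"
    by (rule card_Un_disjoint[OF finite_plain_overpartitions fin(2) disj])
  also have "card ?W = card ?U"
    using bij_betw_same_card[OF bij_betw_overline_part[of K n]] by simp
  also have "card (plain_overpartitions K n) = card (bounded_overpartitions K n) + card ?U"
    by (rule card_plain_overpartitions)
  finally show ?thesis by simp
qed

lemma bounded_overpartitions_eq: "n \<le> K \<Longrightarrow> bounded_overpartitions K n = overpartitions n"
proof -
  assume "n \<le> K"
  moreover have "x \<le> sum_mset P" if "x \<in># P" for x and P :: "nat multiset"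
    using that by (metis multi_member_split le_add1 sum_mset.add_mset)
  ultimately show ?thesis
    by (fastforce simp: bounded_overpartitions_def overpartitions_def)
qed

lemma card_bounded_overpartitions_le: "card (bounded_overpartitions K n) \<le> pbar n"
proof -
  have "finite (overpartitions n)"
    using finite_bounded_overpartitions[of n n] by (simp add: bounded_overpartitions_eq)
  then show ?thesis
    unfolding pbar_def by (rule card_mono) (auto simp: bounded_overpartitions_def)
qed

text \<open>Over an arbitrary field, as it is used with complex coefficients for evaluation and with
  Laurent series as coefficients for \<open>overrank_fps\<close>.\<close>

definition bounded_overpartition_fps :: "nat \<Rightarrow> 'a :: field fps" where
  "bounded_overpartition_fps K = Abs_fps (\<lambda>n. of_nat (card (bounded_overpartitions K n)))"

lemma bounded_overpartition_fps_0: "bounded_overpartition_fps 0 = 1"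
  by (rule fps_ext) (simp add: bounded_overpartition_fps_def bounded_overpartitions_0)

lemma bounded_overpartition_fps_Suc:
  "bounded_overpartition_fps (Suc K) * (1 - fps_X ^ Suc K) =
    bounded_overpartition_fps K * (1 + fps_X ^ Suc K :: 'a :: field fps)"
proof -
  define u where "u n = card {(P, S) \<in> plain_overpartitions K n. Suc K \<in># P}" for n
  define U V :: "'a fps" where
    "U = Abs_fps (\<lambda>n. of_nat (u n))" and "V = Abs_fps (\<lambda>n. of_nat (card (plain_overpartitions K n)))"
  let ?G = "bounded_overpartition_fps :: nat \<Rightarrow> 'a fps"
  let ?Y = "fps_X ^ Suc K :: 'a fps"
  have u: "u n = (if n < Suc K then 0 else card (plain_overpartitions K (n - Suc K)))" for n
  proof (cases "n < Suc K")
    case False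
    then have "n = (n - Suc K) + Suc K" by simp
    then show ?thesis
      using bij_betw_same_card[OF bij_betw_remove_part[of K "n - Suc K"]] False by (simp add: u_def)
  qed (simp add: u_def remove_part_empty)
  have 1: "U = ?Y * V"
    by (rule fps_ext) (simp add: U_def V_def u fps_X_power_mult_nth del: power_Suc)
  have 2: "V = ?G K + U"
    by (rule fps_ext) (simp add: U_def V_def u_def bounded_overpartition_fps_def card_plain_overpartitions)
  have 3: "?G (Suc K) = ?G K + 2 * U"
  proof (rule fps_ext)
    fix n
    have "2 * U = U + U" by simp
    then show "?G (Suc K) $ n = (?G K + 2 * U) $ n"
      by (simp add: U_def u_def bounded_overpartition_fps_def card_bounded_overpartitions_Suc)
  qed
  have VY: "V * (1 - ?Y) = ?G K"
    using 1 2 by (simp add: algebra_simps del: power_Suc)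
  have "?G (Suc K) * (1 - ?Y) = ?G K * (1 - ?Y) + 2 * ?Y * (V * (1 - ?Y))"
    unfolding 3 1 by (simp add: algebra_simps del: power_Suc)
  also have "\<dots> = ?G K * (1 + ?Y)"
    unfolding VY by (simp add: algebra_simps del: power_Suc)
  finally show ?thesis .
qed

lemma bounded_overpartition_fps_prod:
  "bounded_overpartition_fps K * (\<Prod>k<K. 1 - fps_X * fps_X ^ k) =
    (\<Prod>k<K. 1 - - fps_X * fps_X ^ k :: 'a :: field fps)"
proof (induction K)
  case (Suc K)
  have "bounded_overpartition_fps (Suc K) * (\<Prod>k<Suc K. 1 - fps_X * fps_X ^ k) =
      bounded_overpartition_fps (Suc K) * (1 - fps_X ^ Suc K) * (\<Prod>k<K. 1 - fps_X * fps_X ^ k :: 'a fps)"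
    by (simp add: mult_ac)
  also have "\<dots> = (1 + fps_X ^ Suc K) * (bounded_overpartition_fps K * (\<Prod>k<K. 1 - fps_X * fps_X ^ k))"
    unfolding bounded_overpartition_fps_Suc by (simp only: mult_ac)
  also have "\<dots> = (\<Prod>k<Suc K. 1 - - fps_X * fps_X ^ k)"
    unfolding Suc.IH by simp
  finally show ?case .
qed (simp add: bounded_overpartition_fps_0)

text \<open>In the q-adic topology the factor with index n changes only coefficients above n, so
  every coefficient stabilises. The values c = 1 and c = -1 give the two products of the
  overpartition quotient.\<close>

lemma qpoch_fps_nth:
  fixes c :: "'a :: field"
  defines "x \<equiv> fps_const c * fps_X"
  assumes "m \<le> n"
  shows "fps_nth (qpoch x fps_X) m = fps_nth (\<Prod>k<n. 1 - x * fps_X ^ k) m"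
proof -
  define F where "F n = (\<Prod>k<n. 1 - x * fps_X ^ k)" for n
  define L where "L = Abs_fps (\<lambda>m. fps_nth (F m) m)"
  have F_Suc: "fps_nth (F (Suc n)) m = fps_nth (F n) m" if "m \<le> n" for m n
  proof -
    have "F (Suc n) = F n - fps_X ^ Suc n * (fps_const c * F n)"
      by (simp add: F_def x_def algebra_simps)
    then show ?thesis
      using that by (simp add: fps_X_power_mult_nth del: power_Suc)
  qed
  have F_stable: "fps_nth (F n) m = fps_nth L m" if "m \<le> n" for m n
    using that by (induction n rule: dec_induct) (simp_all add: L_def F_Suc)
  have "F \<longlonglongrightarrow> L"
    by (rule tendsto_fpsI) (auto intro!: eventually_sequentiallyI F_stable)
  then have "(\<lambda>n. F (Suc n)) \<longlonglongrightarrow> L"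
    by (rule LIMSEQ_Suc)
  \<comment> \<open>Convergence of an infinite product demands a nonzero limit; the constant
    coefficient 1 provides it.\<close>
  moreover have "fps_nth L 0 = 1"
    by (simp add: L_def F_def)
  then have "L \<noteq> 0" by auto
  ultimately have "(\<lambda>k. 1 - x * fps_X ^ k) has_prod L"
    unfolding has_prod_def raw_has_prod_def F_def by (simp add: lessThan_Suc_atMost)
  then have "qpoch x fps_X = L"
    unfolding qpoch_def by (rule has_prod_unique[symmetric])
  then show ?thesis
    using F_stable[OF assms(2)] by (simp add: F_def)
qed

text \<open>The coefficient of q^m sees only parts up to m, so the finite product identity for K = m
  decides it.\<close>

lemma overpartition_fps_quotient:
  "qpoch (- fps_X) fps_X / qpoch fps_X fps_X = Abs_fps (\<lambda>n. of_nat (pbar n) :: 'a :: field)"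
proof -
  define A B P :: "'a fps" where "A = qpoch (- fps_X) fps_X" and "B = qpoch fps_X fps_X"
    and "P = Abs_fps (\<lambda>n. of_nat (pbar n))"
  have A: "fps_nth A m = fps_nth (\<Prod>k<n. 1 - - fps_X * fps_X ^ k) m" if "m \<le> n" for m n
    using qpoch_fps_nth[OF that, of "-1 :: 'a"] by (simp add: A_def flip: fps_const_neg)
  have B: "fps_nth B m = fps_nth (\<Prod>k<n. 1 - fps_X * fps_X ^ k) m" if "m \<le> n" for m n
    using qpoch_fps_nth[OF that, of "1 :: 'a"] by (simp add: B_def)
  have P: "fps_nth P m = fps_nth (bounded_overpartition_fps n) m" if "m \<le> n" for m n
    using that by (simp add: P_def bounded_overpartition_fps_def bounded_overpartitions_eq pbar_def)
  have "P * B = A"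
  proof (rule fps_ext)
    fix m
    have "fps_nth (P * B) m = fps_nth (bounded_overpartition_fps m * (\<Prod>k<m. 1 - fps_X * fps_X ^ k)) m"
      unfolding fps_mult_nth by (intro sum.cong arg_cong2[of _ _ _ _ "(*)"] P B) auto
    then show "fps_nth (P * B) m = fps_nth A m"
      unfolding bounded_overpartition_fps_prod by (simp add: A[of m m])
  qed
  moreover have "fps_nth B 0 = 1" using B[of 0 0] by simp
  ultimately have "A / B = P"
    by (metis fps_divide_unit inverse_mult_eq_1' mult.assoc mult.right_neutral zero_neq_one)
  then show ?thesis by (simp add: A_def B_def P_def)
qed

section \<open>Coefficients of the rank generating function\<close>

text \<open>The expansion of 1/(1 - c q^k). With explicit coefficients it stays visible that
  everything built from it depends on c through finitely many powers.\<close>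

definition geometric_fps :: "'a :: field \<Rightarrow> nat \<Rightarrow> 'a fps" where
  "geometric_fps c k = Abs_fps (\<lambda>m. if k dvd m then c ^ (m div k) else 0)"

lemma geometric_fps_mult:
  assumes "k > 0"
  shows "(1 - fps_const c * fps_X ^ k) * geometric_fps c k = 1"
proof (rule fps_ext)
  fix m
  have "(1 - fps_const c * fps_X ^ k) * geometric_fps c k =
      geometric_fps c k - fps_const c * (fps_X ^ k * geometric_fps c k)"
    by (simp add: algebra_simps)
  moreover have "geometric_fps c k $ m - c * (if m < k then 0 else geometric_fps c k $ (m - k)) = (1 :: 'a fps) $ m"
  proof (cases "m < k")
    case True
    then have "k dvd m \<longleftrightarrow> m = 0" using assms by (auto dest: dvd_imp_le)
    then show ?thesis using True by (simp add: geometric_fps_def)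
  next
    case False
    then obtain r where r: "m = k + r" using le_Suc_ex by (metis not_le)
    have "k dvd k + r \<longleftrightarrow> k dvd r" "(k + r) div k = Suc (r div k)" "m \<noteq> 0"
      using assms r by auto
    then show ?thesis using r assms by (simp add: geometric_fps_def)
  qed
  ultimately show "((1 - fps_const c * fps_X ^ k) * geometric_fps c k) $ m = (1 :: 'a fps) $ m"
    by (simp add: fps_X_power_mult_nth)
qed

definition rank_term :: "'a :: field \<Rightarrow> nat \<Rightarrow> nat \<Rightarrow> 'a fps" where
  "rank_term c d i = fps_const ((1 - c) * (1 - inverse c) * (-1) ^ Suc i) *
    (fps_X ^ ((Suc i)\<^sup>2 + d * Suc i) *
      (geometric_fps c (d * Suc i) * geometric_fps (inverse c) (d * Suc i)))"

definition rank_coeff :: "'a :: field \<Rightarrow> nat \<Rightarrow> nat \<Rightarrow> 'a" where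
  "rank_coeff c d m = (\<Sum>i\<le>m. rank_term c d i $ m)"

text \<open>The coefficient of q^m in O_d(c;q), as a finite expression in \<open>c\<close> and
  \<open>inverse c\<close>. The same formula is used for \<open>c = fls_X\<close> and for complex
  roots of unity, which connects the formal and the analytic side.\<close>

definition overrank_coeff :: "'a :: field \<Rightarrow> nat \<Rightarrow> nat \<Rightarrow> 'a" where
  "overrank_coeff c d m =
    (\<Sum>k\<le>m. of_nat (pbar k) * ((if m - k = 0 then 1 else 0) + 2 * rank_coeff c d (m - k)))"

lemma rank_term_nth_eq_0: "m \<le> i \<Longrightarrow> rank_term c d i $ m = 0"
proof -
  assume "m \<le> i"
  also have "i < (Suc i)\<^sup>2 + d * Suc i" by (simp add: power2_eq_square)
  finally show ?thesis by (simp add: rank_term_def fps_X_power_mult_nth)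
qed

text \<open>The denominator has a nonzero constant coefficient, so the division of formal power
  series is multiplication by its inverse, the product of two geometric series.\<close>

lemma rank_term_altdef:
  fixes c :: "'a :: field" and i :: nat
  assumes "d > 0"
  defines "z \<equiv> fps_const c" and "n \<equiv> Suc i"
  shows "(1 - z) * (1 - inverse z) * (-1) ^ n * fps_X ^ (n\<^sup>2 + d * n)
        / ((1 - z * fps_X ^ (d * n)) * (1 - inverse z * fps_X ^ (d * n))) = rank_term c d i"
proof -
  let ?k = "d * n"
  define D where "D = (1 - z * fps_X ^ ?k) * (1 - inverse z * fps_X ^ ?k)"
  define U where "U = geometric_fps c ?k * geometric_fps (inverse c) ?k"
  have k: "?k > 0" using assms by simp
  have "D * U = ((1 - fps_const c * fps_X ^ ?k) * geometric_fps c ?k) *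
      ((1 - fps_const (inverse c) * fps_X ^ ?k) * geometric_fps (inverse c) ?k)"
    by (simp add: D_def U_def z_def fps_const_inverse mult_ac)
  then have DU: "D * U = 1" by (simp only: geometric_fps_mult[OF k] mult_1)
  then have "D $ 0 * U $ 0 = 1" by (metis fps_mult_nth_0 fps_one_nth)
  then have D0: "D $ 0 \<noteq> 0" by auto
  have "inverse D = U"
    using DU D0 by (metis fps_inverse_unique)
  then have "A / D = A * U" for A
    using fps_divide_unit[OF D0] by simp
  moreover have "rank_term c d i = (1 - z) * (1 - inverse z) * (-1) ^ n * fps_X ^ (n\<^sup>2 + d * n) * U"
  proof -
    have "fps_const ((1 - c) * (1 - inverse c) * (-1) ^ Suc i) = (1 - z) * (1 - inverse z) * (-1) ^ n"
    proof -
      have "(-1 :: 'a fps) = fps_const (-1)" by simp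
      then show ?thesis
        unfolding z_def n_def fps_const_inverse
        by (simp only: fps_const_power fps_const_mult[symmetric] fps_const_sub[symmetric] fps_const_1_eq_1)
    qed
    then show ?thesis by (simp only: rank_term_def U_def n_def mult.assoc)
  qed
  ultimately show ?thesis by (simp only: D_def)
qed

lemma rank_term_sums: "rank_term c d sums Abs_fps (rank_coeff c d)"
  unfolding sums_def
proof (rule tendsto_fpsI)
  fix m
  show "eventually (\<lambda>n. (\<Sum>i<n. rank_term c d i) $ m = Abs_fps (rank_coeff c d) $ m) sequentially"
  proof (rule eventually_sequentiallyI[of "Suc m"])
    fix n assume "Suc m \<le> n"
    then have "(\<Sum>i<n. rank_term c d i $ m) = (\<Sum>i\<le>m. rank_term c d i $ m)"
      by (intro sum.mono_neutral_right) (auto simp: rank_term_nth_eq_0)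
    then show "(\<Sum>i<n. rank_term c d i) $ m = Abs_fps (rank_coeff c d) $ m"
      by (simp add: fps_sum_nth rank_coeff_def)
  qed
qed

lemma overrank_gf_fps_nth:
  assumes "d > 0"
  shows "overrank_gf d (fps_const c) fps_X $ m = overrank_coeff c d m"
proof -
  have "overrank_gf d (fps_const c) fps_X =
      Abs_fps (\<lambda>n. of_nat (pbar n)) * (1 + 2 * Abs_fps (rank_coeff c d))"
    unfolding overrank_gf_def overpartition_fps_quotient Let_def rank_term_altdef[OF assms]
    by (simp only: sums_unique[OF rank_term_sums, symmetric])
  also have "2 * Abs_fps (rank_coeff c d) = fps_const 2 * Abs_fps (rank_coeff c d)"
    by (simp add: numeral_fps_const)
  finally have gf: "overrank_gf d (fps_const c) fps_X =
      Abs_fps (\<lambda>n. of_nat (pbar n)) * (1 + fps_const 2 * Abs_fps (rank_coeff c d))" .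
  have "(1 + fps_const 2 * Abs_fps (rank_coeff c d)) $ n = (if n = 0 then 1 else 0) + 2 * rank_coeff c d n" for n
    by (simp only: fps_add_nth fps_mult_left_const_nth fps_one_nth fps_nth_Abs_fps)
  then show ?thesis
    unfolding gf fps_mult_nth overrank_coeff_def atLeast0AtMost by (simp only: fps_nth_Abs_fps)
qed

text \<open>The value at \<open>0\<close> is left open because \<open>0 powi k\<close> is not multiplicative in \<open>k\<close>.\<close>

inductive laurent_eval :: "complex fls \<Rightarrow> (complex \<Rightarrow> complex) \<Rightarrow> bool" where
  zero: "laurent_eval 0 (\<lambda>_. 0)"
| monom_add: "laurent_eval L f \<Longrightarrow>
    laurent_eval (fls_const c * fls_X_intpow k + L) (\<lambda>\<omega>. c * \<omega> powi k + f \<omega>)"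
| cong: "laurent_eval L f \<Longrightarrow> (\<And>\<omega>. \<omega> \<noteq> 0 \<Longrightarrow> f \<omega> = g \<omega>) \<Longrightarrow> laurent_eval L g"

lemma laurent_eval_monom: "laurent_eval (fls_const c * fls_X_intpow k) (\<lambda>\<omega>. c * \<omega> powi k)"
  using laurent_eval.monom_add[OF laurent_eval.zero, of c k] by simp

lemma laurent_eval_const: "laurent_eval (fls_const c) (\<lambda>_. c)"
  using laurent_eval_monom[of c 0] by simp

lemma laurent_eval_0: "laurent_eval 0 (\<lambda>_. 0)"
  by (rule laurent_eval.zero)

lemma laurent_eval_1: "laurent_eval 1 (\<lambda>_. 1)"
  using laurent_eval_const[of 1] by simp

lemma laurent_eval_X: "laurent_eval fls_X (\<lambda>\<omega>. \<omega>)"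
  using laurent_eval_monom[of 1 1] by (simp add: fls_X_conv_shift_1)

lemma laurent_eval_inverse_X: "laurent_eval (inverse fls_X) inverse"
  using laurent_eval_monom[of 1 "-1"] by (simp add: power_int_minus fls_inverse_X fls_X_inv_conv_shift_1)

lemma laurent_eval_add:
  "laurent_eval L f \<Longrightarrow> laurent_eval K g \<Longrightarrow> laurent_eval (L + K) (\<lambda>\<omega>. f \<omega> + g \<omega>)"
proof (induction rule: laurent_eval.induct)
  case (monom_add L f c k)
  then show ?case
    using laurent_eval.monom_add[of "L + K" _ c k] by (simp add: add.assoc)
next
  case (cong L f f')
  show ?case
    by (rule laurent_eval.cong[OF cong.IH[OF cong.prems]]) (simp add: cong.hyps)
qed simp

lemma laurent_eval_monom_mult:
  "laurent_eval L f \<Longrightarrow>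
    laurent_eval (fls_const c * fls_X_intpow k * L) (\<lambda>\<omega>. c * \<omega> powi k * f \<omega>)"
proof (induction rule: laurent_eval.induct)
  case zero
  then show ?case using laurent_eval.zero by simp
next
  case (monom_add L f c' k')
  have "fls_const c * fls_X_intpow k * (fls_const c' * fls_X_intpow k' + L) =
      fls_const (c * c') * fls_X_intpow (k + k') + fls_const c * fls_X_intpow k * L"
    unfolding fls_X_intpow_times_fls_X_intpow[symmetric] fls_const_mult_const[symmetric]
    by (simp only: distrib_left mult_ac)
  then show ?case
    using laurent_eval.cong[OF laurent_eval.monom_add[OF monom_add.IH, of "c * c'" "k + k'"],
        of "\<lambda>\<omega>. c * \<omega> powi k * (c' * \<omega> powi k' + f \<omega>)"]
    by (simp add: power_int_add algebra_simps)
next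
  case (cong L f f')
  show ?case
    by (rule laurent_eval.cong[OF cong.IH]) (simp add: cong.hyps)
qed

lemma laurent_eval_mult:
  "laurent_eval L f \<Longrightarrow> laurent_eval K g \<Longrightarrow> laurent_eval (L * K) (\<lambda>\<omega>. f \<omega> * g \<omega>)"
proof (induction rule: laurent_eval.induct)
  case zero
  then show ?case using laurent_eval.zero by simp
next
  case (monom_add L f c k)
  show ?case
    using laurent_eval_add[OF laurent_eval_monom_mult[OF monom_add.prems, of c k] monom_add.IH[OF monom_add.prems]]
    by (simp only: distrib_right)
next
  case (cong L f f')
  show ?case
    by (rule laurent_eval.cong[OF cong.IH[OF cong.prems]]) (simp add: cong.hyps)
qed

lemma laurent_eval_diff:
  "laurent_eval L f \<Longrightarrow> laurent_eval K g \<Longrightarrow> laurent_eval (L - K) (\<lambda>\<omega>. f \<omega> - g \<omega>)"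
  using laurent_eval_add[OF _ laurent_eval_mult[OF laurent_eval_const[of "-1"]], of L f K g]
  by simp

lemma laurent_eval_power: "laurent_eval L f \<Longrightarrow> laurent_eval (L ^ n) (\<lambda>\<omega>. f \<omega> ^ n)"
  by (induction n) (simp_all add: laurent_eval_1 laurent_eval_mult)

lemma laurent_eval_sum:
  "(\<And>i. i \<in> I \<Longrightarrow> laurent_eval (L i) (f i)) \<Longrightarrow>
    laurent_eval (\<Sum>i\<in>I. L i) (\<lambda>\<omega>. \<Sum>i\<in>I. f i \<omega>)"
  by (induction I rule: infinite_finite_induct) (simp_all add: laurent_eval_0 laurent_eval_add)

lemma laurent_eval_of_nat: "laurent_eval (of_nat n) (\<lambda>_. of_nat n)"
  using laurent_eval_const[of "of_nat n"] by (simp add: fls_of_nat)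

lemma laurent_eval_numeral: "laurent_eval (numeral n) (\<lambda>_. numeral n)"
  using laurent_eval_of_nat[of "numeral n"] by simp

lemma laurent_eval_if:
  "laurent_eval L f \<Longrightarrow> laurent_eval K g \<Longrightarrow>
    laurent_eval (if b then L else K) (\<lambda>\<omega>. if b then f \<omega> else g \<omega>)"
  by simp

lemma laurent_eval_minus_1_power: "laurent_eval ((-1) ^ n) (\<lambda>_. (-1) ^ n)"
  using laurent_eval_power[OF laurent_eval_diff[OF laurent_eval_0 laurent_eval_1], of n] by simp

lemmas laurent_eval_intros = laurent_eval_0 laurent_eval_1 laurent_eval_X laurent_eval_inverse_X
  laurent_eval_numeral laurent_eval_of_nat laurent_eval_minus_1_power laurent_eval_if
  laurent_eval_sum laurent_eval_power laurent_eval_diff laurent_eval_add laurent_eval_mult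

text \<open>Unfolded down to coefficients, the expression uses only finite sums, products,
  constants, z and its inverse; hence it is a Laurent polynomial whose value at a nonzero point is
  the same expression there.\<close>

lemma laurent_eval_overrank_coeff:
  "laurent_eval (overrank_coeff fls_X d m) (\<lambda>\<omega>. overrank_coeff \<omega> d m)"
  unfolding overrank_coeff_def rank_coeff_def rank_term_def geometric_fps_def
    fps_mult_left_const_nth fps_X_power_mult_nth
  unfolding fps_mult_nth fps_nth_Abs_fps
  by (intro laurent_eval_intros)

text \<open>The root-of-unity filter. Induction over monomials gives the sum over the infinite
  residue class without any description of the support of \<open>L\<close>; roots of unity are
  nonzero, so the values of \<open>f\<close> used are those determined by \<open>L\<close>.\<close>

lemma laurent_eval_residue_class:
  assumes M: "M > 0" and L: "laurent_eval L f"
  shows "(fls_nth L has_sum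
    (\<Sum>j<M. zeta M powi (- (a * int j)) * f (zeta M ^ j)) / of_nat M) {k. [k = a] (mod int M)}"
  using L
proof (induction rule: laurent_eval.induct)
  case (monom_add L f c k)
  let ?R = "{k. [k = a] (mod int M)}"
  have nth: "fls_nth (fls_const c * fls_X_intpow k) i = (if i = k then c else 0)" for i
    by (simp add: fls_X_intpow_times_conv_shift)
  have 1: "((\<lambda>i. if i = k then c else 0) has_sum (if k \<in> ?R then c else 0)) ?R"
    by (rule has_sum_finite_neutralI[of "if k \<in> ?R then {k} else {}"]) auto
  have 2: "(\<Sum>j<M. zeta M powi (- (a * int j)) * (c * (zeta M ^ j) powi k)) / of_nat M = (if k \<in> ?R then c else 0)"
  proof -
    have "zeta M powi (- (a * int j)) * (c * (zeta M ^ j) powi k) = c * zeta M powi ((k - a) * int j)" for j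
    proof -
      have "(zeta M ^ j) powi k = zeta M powi (k * int j)"
        by (simp add: power_int_power mult.commute)
      moreover have "zeta M powi (- (a * int j)) * zeta M powi (k * int j) = zeta M powi ((k - a) * int j)"
        by (simp add: algebra_simps flip: power_int_add)
      ultimately show ?thesis by (simp add: mult.left_commute)
    qed
    then have "(\<Sum>j<M. zeta M powi (- (a * int j)) * (c * (zeta M ^ j) powi k)) =
        c * (if int M dvd k - a then of_nat M else 0)"
      by (simp only: zeta_orthogonality[OF M] sum_distrib_left[symmetric])
    then show ?thesis
      using M by (simp add: cong_iff_dvd_diff)
  qed
  have "((\<lambda>i. (if i = k then c else 0) + fls_nth L i) has_sum
      (\<Sum>j<M. zeta M powi (- (a * int j)) * (c * (zeta M ^ j) powi k)) / of_nat M +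
      (\<Sum>j<M. zeta M powi (- (a * int j)) * f (zeta M ^ j)) / of_nat M) ?R"
    unfolding 2 by (rule has_sum_add[OF 1 monom_add.IH])
  then show ?case
    by (simp only: nth[symmetric] fls_plus_nth[symmetric] distrib_left sum.distrib add_divide_distrib)
next
  case (cong L f g)
  then show ?case by simp
qed simp

section \<open>Evaluation of the formal series\<close>

text \<open>Absolute convergence of \<open>f\<close> at \<open>q\<close> to \<open>v\<close>, with a
  bound for the sum of absolute values. The bound adds under sums and multiplies under products, so
  it can be carried along and later used to exchange summations.\<close>

definition has_eval :: "complex fps \<Rightarrow> complex \<Rightarrow> complex \<Rightarrow> real \<Rightarrow> bool" where
  "has_eval f q v B \<longleftrightarrow> summable (\<lambda>n. norm (f $ n * q ^ n)) \<and>
    (\<Sum>n. norm (f $ n * q ^ n)) \<le> B \<and> (\<lambda>n. f $ n * q ^ n) sums v"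

lemma has_eval_const: "has_eval (fps_const c) q c (norm c)"
proof -
  have "(\<lambda>n. fps_const c $ n * q ^ n) sums (fps_const c $ 0 * q ^ 0)"
    using sums_finite[of "{0}" "\<lambda>n. fps_const c $ n * q ^ n"] by simp
  moreover have "(\<lambda>n. norm (fps_const c $ n * q ^ n)) sums norm (fps_const c $ 0 * q ^ 0)"
    using sums_finite[of "{0}" "\<lambda>n. norm (fps_const c $ n * q ^ n)"] by simp
  ultimately show ?thesis
    unfolding has_eval_def by (auto simp: sums_iff)
qed

lemma has_eval_X_power: "has_eval (fps_X ^ k) q (q ^ k) (norm q ^ k)"
proof -
  have "(\<lambda>n. fps_X ^ k $ n * q ^ n) sums (fps_X ^ k $ k * q ^ k)"
    using sums_finite[of "{k}" "\<lambda>n. fps_X ^ k $ n * q ^ n"] by (simp add: fps_X_power_nth)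
  moreover have "(\<lambda>n. norm (fps_X ^ k $ n * q ^ n)) sums norm (fps_X ^ k $ k * q ^ k)"
    using sums_finite[of "{k}" "\<lambda>n. norm (fps_X ^ k $ n * q ^ n)"] by (simp add: fps_X_power_nth)
  ultimately show ?thesis
    unfolding has_eval_def by (auto simp: sums_iff norm_power fps_X_power_nth)
qed

lemma has_eval_add:
  assumes "has_eval f q v B" "has_eval g q w C"
  shows "has_eval (f + g) q (v + w) (B + C)"
proof -
  have s: "summable (\<lambda>n. norm (f $ n * q ^ n) + norm (g $ n * q ^ n))"
    using assms by (intro summable_add) (auto simp: has_eval_def)
  have le: "norm ((f + g) $ n * q ^ n) \<le> norm (f $ n * q ^ n) + norm (g $ n * q ^ n)" for n
    by (simp add: distrib_right norm_triangle_ineq)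
  have s': "summable (\<lambda>n. norm ((f + g) $ n * q ^ n))"
    using s le by (intro summable_comparison_test'[OF s]) (use le in \<open>simp only: real_norm_def abs_norm_cancel\<close>)
  have "(\<Sum>n. norm ((f + g) $ n * q ^ n)) \<le> (\<Sum>n. norm (f $ n * q ^ n) + norm (g $ n * q ^ n))"
    by (rule suminf_le[OF le s' s])
  also have "\<dots> \<le> B + C"
    using assms by (subst suminf_add[symmetric]) (auto simp: has_eval_def)
  finally show ?thesis
    using assms s' sums_add[of "\<lambda>n. f $ n * q ^ n" v "\<lambda>n. g $ n * q ^ n" w]
    by (simp add: has_eval_def distrib_right)
qed

lemma has_eval_mult:
  assumes "has_eval f q v B" "has_eval g q w C"
  shows "has_eval (f * g) q (v * w) (B * C)"
proof -
  define a b where "a n = f $ n * q ^ n" and "b n = g $ n * q ^ n" for n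
  have ab: "summable (\<lambda>n. norm (a n))" "summable (\<lambda>n. norm (b n))" "suminf a = v" "suminf b = w"
    "(\<Sum>n. norm (a n)) \<le> B" "(\<Sum>n. norm (b n)) \<le> C"
    using assms by (auto simp: has_eval_def a_def[abs_def] b_def[abs_def] sums_iff)
  have nth: "(f * g) $ n * q ^ n = (\<Sum>i\<le>n. a i * b (n - i))" for n
  proof -
    have "f $ i * g $ (n - i) * q ^ n = a i * b (n - i)" if "i \<le> n" for i
      using that power_add[of q i "n - i"] by (simp add: a_def b_def)
    then show ?thesis
      by (simp add: fps_mult_nth sum_distrib_right atLeast0AtMost)
  qed
  define c where "c n = (\<Sum>i\<le>n. norm (a i) * norm (b (n - i)))" for n
  have c: "c sums ((\<Sum>n. norm (a n)) * (\<Sum>n. norm (b n)))"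
    using Cauchy_product_sums[of "\<lambda>n. norm (a n)" "\<lambda>n. norm (b n)"] ab unfolding c_def[abs_def] by simp
  have le: "norm ((f * g) $ n * q ^ n) \<le> c n" for n
    unfolding nth c_def by (rule order_trans[OF norm_sum]) (simp add: norm_mult)
  have s: "summable (\<lambda>n. norm ((f * g) $ n * q ^ n))"
    by (rule summable_comparison_test'[OF sums_summable[OF c]]) (use le in \<open>simp only: real_norm_def abs_norm_cancel\<close>)
  have "(\<Sum>n. norm ((f * g) $ n * q ^ n)) \<le> suminf c"
    by (rule suminf_le[OF le s sums_summable[OF c]])
  also have "\<dots> = (\<Sum>n. norm (a n)) * (\<Sum>n. norm (b n))"
    using c by (simp add: sums_iff)
  also have "\<dots> \<le> B * C"
    using ab by (intro mult_mono) (auto intro: suminf_nonneg order_trans[OF suminf_nonneg])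
  finally show ?thesis
    using s Cauchy_product_sums[OF ab(1,2)] ab(3,4) unfolding has_eval_def nth by simp
qed

text \<open>The bound depends neither on \<open>c\<close> nor on \<open>k\<close>; this makes the
  bounds for the rank terms summable over the outer index.\<close>

lemma has_eval_geometric:
  assumes "norm c \<le> 1" "norm q < 1" "k > 0"
  shows "has_eval (geometric_fps c k) q (1 / (1 - c * q ^ k)) (1 / (1 - norm q))"
proof -
  have geo: "(\<lambda>n. norm q ^ n) sums (1 / (1 - norm q))"
    using assms by (intro geometric_sums) auto
  have le: "norm (geometric_fps c k $ n * q ^ n) \<le> norm q ^ n" for n
    using assms power_le_one[of "norm c" "n div k"]
    by (simp add: geometric_fps_def norm_mult norm_power mult_left_le_one_le)
  have s: "summable (\<lambda>n. norm (geometric_fps c k $ n * q ^ n))"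
    by (rule summable_comparison_test'[OF sums_summable[OF geo]]) (use le in \<open>simp only: real_norm_def abs_norm_cancel\<close>)
  have "(\<Sum>n. norm (geometric_fps c k $ n * q ^ n)) \<le> 1 / (1 - norm q)"
    using suminf_le[OF le s sums_summable[OF geo]] geo by (simp add: sums_iff)
  moreover have "(\<lambda>n. geometric_fps c k $ n * q ^ n) sums (1 / (1 - c * q ^ k))"
  proof (subst sums_mono_reindex[of "\<lambda>l. k * l", symmetric])
    show "strict_mono (\<lambda>l. k * l)" using assms by (simp add: strict_mono_def)
    show "geometric_fps c k $ n * q ^ n = 0" if "n \<notin> range (\<lambda>l. k * l)" for n
      using that by (auto simp: geometric_fps_def dvd_def)
    have "norm (c * q ^ k) < 1"
    proof -
      have "norm q ^ k < 1" using assms by (simp add: power_less_one_iff)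
      moreover have "norm c * norm q ^ k \<le> 1 * norm q ^ k" using assms by (intro mult_right_mono) auto
      ultimately show ?thesis by (simp add: norm_mult norm_power)
    qed
    from geometric_sums[OF this]
    show "(\<lambda>l. geometric_fps c k $ (k * l) * q ^ (k * l)) sums (1 / (1 - c * q ^ k))"
      using assms by (simp add: geometric_fps_def power_mult_distrib power_mult)
  qed
  ultimately show ?thesis using s by (simp add: has_eval_def)
qed

section \<open>Convergence of the overpartition series and of the rank series\<close>

lemma bounded_overpartition_fps_rec:
  "bounded_overpartition_fps (Suc K) =
    bounded_overpartition_fps K * (fps_const 1 + fps_X ^ Suc K) * geometric_fps (1 :: 'a :: field) (Suc K)"
proof -
  have g: "(1 - fps_X ^ Suc K) * geometric_fps (1 :: 'a) (Suc K) = 1"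
    using geometric_fps_mult[of "Suc K" "1 :: 'a"] by simp
  have "bounded_overpartition_fps (Suc K) =
      bounded_overpartition_fps (Suc K) * (1 - fps_X ^ Suc K) * geometric_fps (1 :: 'a) (Suc K)"
    using g by (metis mult.assoc mult.right_neutral)
  then show ?thesis
    unfolding bounded_overpartition_fps_Suc by simp
qed

lemma has_eval_bounded_overpartition:
  fixes q :: complex
  assumes q: "norm q < 1"
  shows "\<exists>B. has_eval (bounded_overpartition_fps K) q
    ((\<Prod>k<K. 1 - - q * q ^ k) / (\<Prod>k<K. 1 - q * q ^ k)) B"
proof (induction K)
  case 0
  then show ?case using has_eval_const[of 1 q] by (auto simp: bounded_overpartition_fps_0)
next
  case (Suc K)
  then obtain B where B: "has_eval (bounded_overpartition_fps K) q
    ((\<Prod>k<K. 1 - - q * q ^ k) / (\<Prod>k<K. 1 - q * q ^ k)) B" by blast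
  have "has_eval (bounded_overpartition_fps K * (fps_const 1 + fps_X ^ Suc K) * geometric_fps 1 (Suc K)) q
      ((\<Prod>k<K. 1 - - q * q ^ k) / (\<Prod>k<K. 1 - q * q ^ k) * (1 + q ^ Suc K) * (1 / (1 - 1 * q ^ Suc K)))
      (B * (norm (1 :: complex) + norm q ^ Suc K) * (1 / (1 - norm q)))"
    using q by (intro has_eval_mult has_eval_add has_eval_const has_eval_X_power has_eval_geometric B) auto
  then show ?case
    unfolding bounded_overpartition_fps_rec by (auto simp: mult_ac)
qed

text \<open>No growth estimate for \<open>pbar\<close> enters: its partial sums are dominated by the
  finite products at |q|, which converge and are thus bounded. Once the series converges absolutely,
  it dominates the series for bounded parts, and the bound K can tend to infinity.\<close>

lemma pbar_has_eval:
  fixes q :: complex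
  assumes q: "norm q < 1"
  shows "summable (\<lambda>n. norm (of_nat (pbar n) * q ^ n))"
    and "(\<lambda>n. of_nat (pbar n) * q ^ n) sums (qpoch (- q) q / qpoch q q)"
proof -
  define V where "V x K = (\<Prod>k<K. 1 - - x * x ^ k) / (\<Prod>k<K. 1 - x * x ^ k)" for x :: complex and K
  have V_lim: "V x \<longlonglongrightarrow> qpoch (- x) x / qpoch x x" if "norm x < 1" for x
    unfolding V_def[abs_def] using that by (intro tendsto_intros qpoch_LIMSEQ qpoch_base_nz)
  have ev: "summable (\<lambda>n. norm (of_nat (card (bounded_overpartitions K n)) * x ^ n))"
    "(\<lambda>n. of_nat (card (bounded_overpartitions K n)) * x ^ n) sums V x K" if "norm x < 1" for x K
    using has_eval_bounded_overpartition[OF that, of K] that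
    by (auto simp: has_eval_def bounded_overpartition_fps_def V_def)
  \<comment> \<open>At the nonnegative real point |q| all terms are nonnegative, so the norm of
    \<open>V x N\<close> is itself the sum of absolute values.\<close>
  define x where "x = complex_of_real (norm q)"
  have x: "norm x < 1" using q by (simp add: x_def)
  obtain C where C: "\<And>K. norm (V x K) \<le> C"
    using convergent_imp_Bseq[of "V x"] V_lim[OF x] unfolding convergent_def Bseq_def by metis
  have "(\<Sum>n<N. norm (of_nat (pbar n) * q ^ n)) \<le> C" for N
  proof -
    have s: "summable (\<lambda>n. real (card (bounded_overpartitions N n)) * norm q ^ n)"
      using ev(1)[OF q, of N] by (simp add: norm_mult norm_power)
    have "(\<Sum>n<N. norm (of_nat (pbar n) * q ^ n)) = (\<Sum>n<N. real (card (bounded_overpartitions N n)) * norm q ^ n)"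
      by (intro sum.cong) (auto simp: norm_mult norm_power pbar_def bounded_overpartitions_eq)
    also have "\<dots> \<le> (\<Sum>n. real (card (bounded_overpartitions N n)) * norm q ^ n)"
      by (intro sum_le_suminf s) auto
    also have "\<dots> = norm (V x N)"
    proof -
      have "(\<lambda>n. complex_of_real (real (card (bounded_overpartitions N n)) * norm q ^ n)) sums V x N"
        using ev(2)[OF x, of N] by (simp add: x_def)
      then have "V x N = complex_of_real (\<Sum>n. real (card (bounded_overpartitions N n)) * norm q ^ n)"
        using sums_of_real[OF summable_sums[OF s], where 'a = complex] sums_unique2 by blast
      moreover have "(\<Sum>n. real (card (bounded_overpartitions N n)) * norm q ^ n) \<ge> 0"
        by (intro suminf_nonneg s) auto
      ultimately show ?thesis by simp
    qed
    also have "\<dots> \<le> C" by (rule C)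
    finally show ?thesis .
  qed
  then show summ: "summable (\<lambda>n. norm (of_nat (pbar n) * q ^ n))"
    by (intro bounded_imp_summable[of _ C]) (auto simp: lessThan_Suc_atMost[symmetric] simp del: sum.lessThan_Suc)
  have summ': "(\<lambda>n. norm (of_nat (pbar n) * q ^ n)) summable_on UNIV"
    using summ by (subst summable_on_UNIV_nonneg_real_iff) auto
  have "(\<lambda>K. \<Sum>\<^sub>\<infinity>n\<in>UNIV. of_nat (card (bounded_overpartitions K n)) * q ^ n) \<longlonglongrightarrow>
      (\<Sum>\<^sub>\<infinity>n\<in>UNIV. of_nat (pbar n) * q ^ n)"
  proof (rule tendsto_infsum_dominated[OF _ _ summ'])
    show "(\<lambda>K. of_nat (card (bounded_overpartitions K n)) * q ^ n) \<longlonglongrightarrow> of_nat (pbar n) * q ^ n" for n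
      by (rule tendsto_eventually)
         (auto intro!: eventually_sequentiallyI[of n] simp: bounded_overpartitions_eq pbar_def)
    show "norm (of_nat (card (bounded_overpartitions K n)) * q ^ n) \<le> norm (of_nat (pbar n) * q ^ n)" for K n
      using card_bounded_overpartitions_le[of K n] by (simp add: norm_mult mult_right_mono)
  qed
  moreover have "(\<Sum>\<^sub>\<infinity>n\<in>UNIV. of_nat (card (bounded_overpartitions K n)) * q ^ n) = V q K" for K
  proof -
    have "((\<lambda>n. of_nat (card (bounded_overpartitions K n)) * q ^ n) has_sum V q K) UNIV"
      using ev[OF q, of K] by (rule norm_summable_imp_has_sum)
    then show ?thesis by (rule infsumI)
  qed
  ultimately have "(\<Sum>\<^sub>\<infinity>n\<in>UNIV. of_nat (pbar n) * q ^ n) = qpoch (- q) q / qpoch q q"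
    using LIMSEQ_unique[OF _ V_lim[OF q]] by simp
  moreover have "(\<lambda>n. of_nat (pbar n) * q ^ n) sums (\<Sum>\<^sub>\<infinity>n\<in>UNIV. of_nat (pbar n) * q ^ n)"
    by (intro has_sum_imp_sums has_sum_infsum abs_summable_summable[OF summ'])
  ultimately show "(\<lambda>n. of_nat (pbar n) * q ^ n) sums (qpoch (- q) q / qpoch q q)"
    by simp
qed

text \<open>The formal coefficients collect powers of q across all n, the analytic series sums over
  n first. The exchange is Fubini, justified by the absolute bound \<open>C * norm q ^ i\<close> for
  the i-th term.\<close>

lemma rank_coeff_sums:
  fixes q \<omega> :: complex
  assumes q: "norm q < 1" and \<omega>: "norm \<omega> = 1" and d: "d > 0"
  shows "summable (\<lambda>m. norm (rank_coeff \<omega> d m * q ^ m))"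
    and "(\<lambda>m. rank_coeff \<omega> d m * q ^ m) sums
      (\<Sum>i. let n = Suc i in (1 - \<omega>) * (1 - inverse \<omega>) * (-1) ^ n * q ^ (n\<^sup>2 + d * n)
        / ((1 - \<omega> * q ^ (d * n)) * (1 - inverse \<omega> * q ^ (d * n))))"
proof -
  define T where "T i = (let n = Suc i in (1 - \<omega>) * (1 - inverse \<omega>) * (-1) ^ n * q ^ (n\<^sup>2 + d * n)
        / ((1 - \<omega> * q ^ (d * n)) * (1 - inverse \<omega> * q ^ (d * n))))" for i
  define f where "f i m = rank_term \<omega> d i $ m * q ^ m" for i m
  define C where "C = norm ((1 - \<omega>) * (1 - inverse \<omega>)) * (1 / (1 - norm q) * (1 / (1 - norm q)))"
  have ev: "has_eval (rank_term \<omega> d i) q (T i) (C * norm q ^ i)" for i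
  proof -
    let ?n = "Suc i"
    have "has_eval (rank_term \<omega> d i) q
        ((1 - \<omega>) * (1 - inverse \<omega>) * (-1) ^ ?n * (q ^ (?n\<^sup>2 + d * ?n) *
          (1 / (1 - \<omega> * q ^ (d * ?n)) * (1 / (1 - inverse \<omega> * q ^ (d * ?n))))))
        (norm ((1 - \<omega>) * (1 - inverse \<omega>) * (-1) ^ ?n) * (norm q ^ (?n\<^sup>2 + d * ?n) *
          (1 / (1 - norm q) * (1 / (1 - norm q)))))"
      unfolding rank_term_def using q \<omega> d
      by (intro has_eval_mult has_eval_const has_eval_X_power has_eval_geometric) (auto simp: norm_inverse)
    moreover have "(1 - \<omega>) * (1 - inverse \<omega>) * (-1) ^ ?n * (q ^ (?n\<^sup>2 + d * ?n) *
          (1 / (1 - \<omega> * q ^ (d * ?n)) * (1 / (1 - inverse \<omega> * q ^ (d * ?n))))) = T i"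
      by (simp add: T_def Let_def)
    moreover have "norm ((1 - \<omega>) * (1 - inverse \<omega>) * (-1) ^ ?n) * (norm q ^ (?n\<^sup>2 + d * ?n) *
          (1 / (1 - norm q) * (1 / (1 - norm q)))) \<le> C * norm q ^ i"
    proof -
      have "norm q ^ (?n\<^sup>2 + d * ?n) \<le> norm q ^ i"
        using q by (intro power_decreasing) (auto simp: power2_eq_square)
      then have "norm ((1 - \<omega>) * (1 - inverse \<omega>)) * (1 / (1 - norm q) * (1 / (1 - norm q))) * norm q ^ (?n\<^sup>2 + d * ?n) \<le> C * norm q ^ i"
        unfolding C_def using q by (intro mult_left_mono) auto
      then show ?thesis by (simp add: norm_mult norm_power mult_ac)
    qed
    ultimately show ?thesis by (auto simp: has_eval_def)
  qed
  have inner: "(f i has_sum T i) UNIV" for i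
    using ev[of i] unfolding has_eval_def f_def[abs_def] by (auto intro: norm_summable_imp_has_sum)
  have inner': "((\<lambda>m. norm (f i m)) has_sum (\<Sum>m. norm (f i m))) UNIV" for i
    using ev[of i] unfolding has_eval_def f_def[abs_def]
    by (intro norm_summable_imp_has_sum) (auto simp: summable_sums)
  have outer: "(\<lambda>i. \<Sum>m. norm (f i m)) summable_on UNIV"
  proof -
    have "summable (\<lambda>i. C * norm q ^ i)"
      using q by (intro summable_mult) auto
    then have dom: "(\<lambda>i. C * norm q ^ i) summable_on UNIV"
      using q by (subst summable_on_UNIV_nonneg_real_iff) (auto simp: C_def)
    have le: "(\<Sum>m. norm (f i m)) \<le> C * norm q ^ i" "0 \<le> (\<Sum>m. norm (f i m))" for i
      using ev[of i] unfolding has_eval_def f_def by (auto intro: suminf_nonneg)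
    show ?thesis
      by (rule summable_on_comparison_test[OF dom le])
  qed
  have "(\<lambda>p. norm (case p of (i, m) \<Rightarrow> f i m)) summable_on (UNIV \<times> UNIV)"
    by (rule summable_on_SigmaI[OF _ outer]) (use inner' in auto)
  then have "(\<lambda>(i, m). f i m) summable_on (UNIV \<times> UNIV)"
    by (rule abs_summable_summable)
  then obtain S where S: "((\<lambda>(i, m). f i m) has_sum S) (UNIV \<times> UNIV)"
    by (auto simp: summable_on_def)
  have "(T has_sum S) UNIV"
    by (rule has_sum_SigmaD[OF S]) (use inner in auto)
  then have S_eq: "suminf T = S"
    using has_sum_imp_sums sums_unique by metis
  have "((\<lambda>(m, i). f i m) has_sum S) (UNIV \<times> UNIV)"
    using S by (subst (asm) has_sum_swap) (simp add: case_prod_unfold)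
  then have R: "((\<lambda>m. rank_coeff \<omega> d m * q ^ m) has_sum S) UNIV"
  proof (rule has_sum_SigmaD)
    fix m
    have "((\<lambda>i. f i m) has_sum (\<Sum>i\<le>m. f i m)) UNIV"
      by (rule has_sum_finite_neutralI) (auto simp: f_def rank_term_nth_eq_0)
    then show "((\<lambda>i. case (m, i) of (m, i) \<Rightarrow> f i m) has_sum rank_coeff \<omega> d m * q ^ m) UNIV"
      by (simp add: f_def rank_coeff_def sum_distrib_right)
  qed
  then have "(\<lambda>m. norm (rank_coeff \<omega> d m * q ^ m)) summable_on UNIV"
    using has_sum_imp_summable[OF R] by (simp only: summable_on_iff_abs_summable_on_complex)
  then show "summable (\<lambda>m. norm (rank_coeff \<omega> d m * q ^ m))"
    by (rule summable_on_imp_summable)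
  show "(\<lambda>m. rank_coeff \<omega> d m * q ^ m) sums
      (\<Sum>i. let n = Suc i in (1 - \<omega>) * (1 - inverse \<omega>) * (-1) ^ n * q ^ (n\<^sup>2 + d * n)
        / ((1 - \<omega> * q ^ (d * n)) * (1 - inverse \<omega> * q ^ (d * n))))"
    using has_sum_imp_sums[OF R] unfolding S_eq[symmetric] T_def[abs_def] .
qed

lemma overrank_coeff_sums:
  fixes q \<omega> :: complex
  assumes q: "norm q < 1" and \<omega>: "norm \<omega> = 1" and d: "d > 0"
  shows "(\<lambda>m. overrank_coeff \<omega> d m * q ^ m) sums overrank_gf d \<omega> q"
proof -
  define a where "a n = of_nat (pbar n) * q ^ n" for n
  define b where "b n = (if n = 0 then 1 else 0) + 2 * (rank_coeff \<omega> d n * q ^ n)" for n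
  define R where "R = (\<Sum>i. let n = Suc i in (1 - \<omega>) * (1 - inverse \<omega>) * (-1) ^ n * q ^ (n\<^sup>2 + d * n)
        / ((1 - \<omega> * q ^ (d * n)) * (1 - inverse \<omega> * q ^ (d * n))))"
  have one: "(\<lambda>n. if n = 0 then 1 else 0 :: complex) sums 1"
    using sums_single[of 0 "\<lambda>_. 1 :: complex"] by simp
  have one': "summable (\<lambda>n. if n = 0 then 1 else 0 :: real)"
    using sums_summable[OF sums_single[of 0 "\<lambda>_. 1 :: real"]] by simp
  have b_sums: "b sums (1 + 2 * R)"
    unfolding b_def[abs_def] R_def by (intro sums_add sums_mult one rank_coeff_sums q \<omega> d)
  have b_summ: "summable (\<lambda>n. norm (b n))"
  proof (rule summable_comparison_test')
    show "summable (\<lambda>n. (if n = 0 then 1 else 0) + 2 * norm (rank_coeff \<omega> d n * q ^ n))"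
      by (intro summable_add summable_mult one' rank_coeff_sums q \<omega> d)
    show "norm (norm (b n)) \<le> (if n = 0 then 1 else 0) + 2 * norm (rank_coeff \<omega> d n * q ^ n)" for n
      unfolding b_def real_norm_def abs_norm_cancel
      by (rule order_trans[OF norm_triangle_ineq]) (simp add: norm_mult)
  qed
  have a: "summable (\<lambda>n. norm (a n))" "a sums (qpoch (- q) q / qpoch q q)"
    using pbar_has_eval[OF q] by (simp_all add: a_def[abs_def])
  have "(\<lambda>m. \<Sum>k\<le>m. a k * b (m - k)) sums (qpoch (- q) q / qpoch q q * (1 + 2 * R))"
    using Cauchy_product_sums[OF a(1) b_summ] a(2) b_sums by (simp add: sums_iff)
  moreover have "(\<Sum>k\<le>m. a k * b (m - k)) = overrank_coeff \<omega> d m * q ^ m" for m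
    unfolding overrank_coeff_def sum_distrib_right
  proof (rule sum.cong)
    fix k assume "k \<in> {..m}"
    then have "q ^ m = q ^ k * q ^ (m - k)" by (simp flip: power_add)
    then show "a k * b (m - k) = of_nat (pbar k) * ((if m - k = 0 then 1 else 0) + 2 * rank_coeff \<omega> d (m - k)) * q ^ m"
      by (simp add: a_def b_def algebra_simps)
  qed simp
  ultimately show ?thesis
    by (simp add: overrank_gf_def R_def)
qed

lemma overrank_coeff_1: "overrank_coeff 1 d m = of_nat (pbar m)"
proof -
  have "rank_coeff 1 d n = 0" for n :: nat
    by (simp add: rank_coeff_def rank_term_def)
  then have "overrank_coeff 1 d m = (\<Sum>k\<le>m. if k = m then of_nat (pbar k) else 0)"
    unfolding overrank_coeff_def by (intro sum.cong) auto
  then show ?thesis by simp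
qed

lemma Nbar_res_eq:
  assumes M: "M > 0" and d: "d > 0"
  shows "Nbar_res d a M n =
    (\<Sum>j<M. zeta M powi (- (a * int j)) * overrank_coeff (zeta M ^ j) d n) / of_nat M"
proof -
  have "Nbar d k n = fls_nth (overrank_coeff fls_X d n) k" for k
    by (simp add: Nbar_def overrank_fps_def overrank_gf_fps_nth[OF d])
  then show ?thesis
    unfolding Nbar_res_def
    using infsumI[OF laurent_eval_residue_class[OF M laurent_eval_overrank_coeff[of d n], of a]] by simp
qed

text \<open>At the trivial root the factor 1 - z annihilates every rank term and leaves
  \<open>pbar n\<close>; divided by M this is the subtracted term, so the sum starts at j =
  1.\<close>

lemma Dbar_eq:
  fixes q :: complex
  assumes q: "norm q < 1" and M: "M > 0" and d: "d > 0"
  shows "Dbar d a M q =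
    1 / of_nat M * (\<Sum>j = 1..M - 1. zeta M powi (- (a * int j)) * overrank_gf d (zeta M ^ j) q)"
proof -
  have coeff: "(Nbar_res d a M n - of_nat (pbar n) / of_nat M) * q ^ n =
      1 / of_nat M * (\<Sum>j = 1..M - 1. zeta M powi (- (a * int j)) * (overrank_coeff (zeta M ^ j) d n * q ^ n))" for n
  proof -
    have "{..<M} = insert 0 {1..M - 1}" using M by auto
    then have "(\<Sum>j<M. zeta M powi (- (a * int j)) * overrank_coeff (zeta M ^ j) d n) =
        of_nat (pbar n) + (\<Sum>j = 1..M - 1. zeta M powi (- (a * int j)) * overrank_coeff (zeta M ^ j) d n)"
      by (simp add: overrank_coeff_1)
    then show ?thesis
      unfolding Nbar_res_eq[OF M d]
      by (simp add: add_divide_distrib sum_distrib_left sum_distrib_right sum_divide_distrib mult_ac)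
  qed
  have "(\<lambda>n. 1 / of_nat M * (\<Sum>j = 1..M - 1. zeta M powi (- (a * int j)) * (overrank_coeff (zeta M ^ j) d n * q ^ n))) sums
      (1 / of_nat M * (\<Sum>j = 1..M - 1. zeta M powi (- (a * int j)) * overrank_gf d (zeta M ^ j) q))"
    by (intro sums_mult sums_sum overrank_coeff_sums q d) (simp add: norm_power)
  then show ?thesis
    unfolding Dbar_def coeff by (rule sums_unique[symmetric])
qed

theorem theorem1p2:
  fixes d M :: nat and a :: int and q z' z'' :: complex
  assumes "norm q < 1" and "q \<noteq> 0"
    and "d \<ge> 2" and "even d"
    and "M \<ge> 2" and "1 \<le> a" and "a \<le> int M - 1"
    and "z' \<noteq> 0" and "z'' \<noteq> 0"
    and "appell_lerch_generic
           ((-1) ^ (1 + d * M div 2) * q powi (int (d\<^sup>2 div 4) * (int M ^ 2 - 2 * int M * a)))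
           (q ^ (d\<^sup>2 * M\<^sup>2 div 2)) z'"
    and "appell_lerch_generic
           ((-1) ^ (1 + d * M div 2) * q powi (int (d\<^sup>2 div 4) * (int M ^ 2 - 2 * int M * (a - 1))))
           (q ^ (d\<^sup>2 * M\<^sup>2 div 2)) z''"
    and "Psi_generic M a ((-1) ^ (d div 2 + 1) * q ^ (d\<^sup>2 div 4)) (-1) z' (q ^ (d\<^sup>2 div 2))"
    and "Psi_generic M (a - 1) ((-1) ^ (d div 2 + 1) * q ^ (d\<^sup>2 div 4)) (-1) z'' (q ^ (d\<^sup>2 div 2))"
  shows "Dbar d a M q + Dbar d (a - 1) M q =
      of_bool (a = 1)
    + 2 * (-1) powi (int (d div 2) * a) * q powi (- (int (d\<^sup>2 div 4) * a ^ 2))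
        * appell_lerch
            ((-1) ^ (1 + d * M div 2) * q powi (int (d\<^sup>2 div 4) * (int M ^ 2 - 2 * int M * a)))
            (q ^ (d\<^sup>2 * M\<^sup>2 div 2)) z'
    + 2 * (-1) powi (int (d div 2) * (a - 1) + 1)
        * q powi (- (int (d\<^sup>2 div 4) * (a ^ 2 - 2 * a + 1)))
        * appell_lerch
            ((-1) ^ (1 + d * M div 2) * q powi (int (d\<^sup>2 div 4) * (int M ^ 2 - 2 * int M * (a - 1))))
            (q ^ (d\<^sup>2 * M\<^sup>2 div 2)) z''
    + 2 * Psi M a ((-1) ^ (d div 2 + 1) * q ^ (d\<^sup>2 div 4)) (-1) z' (q ^ (d\<^sup>2 div 2))
    - 2 * Psi M (a - 1) ((-1) ^ (d div 2 + 1) * q ^ (d\<^sup>2 div 4)) (-1) z'' (q ^ (d\<^sup>2 div 2))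
    + 2 / of_nat M * (-1) ^ (d div 2) * q powi (- int (d\<^sup>2 div 4))
        * (\<Sum>j = 1..M - 1.
             zeta M powi (int j - a * int j) * (1 - zeta M ^ j)
             * Psi (d div 2) 0
                 (exp (4 * of_real pi * \<i> * of_nat j / (of_nat d * of_nat M)) * q powi (1 - int d))
                 q (-1) (q ^ 2))"
proof -
  define N where "N = d div 2"
  have d: "d = 2 * N" "N > 0" using assms by (auto simp: N_def)
  define k where "k = nat (a - 1)"
  have a: "a = int (Suc k)" "Suc k < M" using assms by (auto simp: k_def)
  have M: "M > 0" using a by simp
  have arith: "d div 2 = N" "d\<^sup>2 div 4 = N\<^sup>2" "d\<^sup>2 div 2 = 2 * N\<^sup>2" "d * M div 2 = N * M"
    "d\<^sup>2 * M\<^sup>2 div 2 = 2 * N\<^sup>2 * M\<^sup>2"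
    by (simp_all add: d power_mult_distrib)
  \<comment> \<open>Passing from residue a to a - 1 multiplies the kernel by
    \<open>zeta M ^ j\<close>, which is the source of the factor 1 + z.\<close>
  have shift: "zeta M powi (- ((a - 1) * int j)) = zeta M powi (- (a * int j)) * zeta M ^ j" for j
  proof -
    have "zeta M powi (- (a * int j)) * zeta M ^ j = zeta M powi (- (a * int j) + int j)"
      by (simp only: power_int_add zeta_nz simp_thms power_int_of_nat)
    then show ?thesis by (simp add: left_diff_distrib)
  qed
  have "Dbar d a M q + Dbar d (a - 1) M q =
      1 / of_nat M * (\<Sum>j = 1..M - 1. zeta M powi (- (a * int j)) *
        ((1 + zeta M ^ j) * overrank_gf d (zeta M ^ j) q))"
  proof -
    have "d > 0" using d by simp
    note D = Dbar_eq[OF assms(1) M this, of a] Dbar_eq[OF assms(1) M this, of "a - 1"]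
    have "zeta M powi (- (a * int j)) * ((1 + zeta M ^ j) * overrank_gf d (zeta M ^ j) q) =
        zeta M powi (- (a * int j)) * overrank_gf d (zeta M ^ j) q +
        zeta M powi (- (a * int j)) * zeta M ^ j * overrank_gf d (zeta M ^ j) q" for j
      by (simp add: algebra_simps)
    then show ?thesis
      by (simp only: D shift sum.distrib distrib_left[of "1 / of_nat M"])
  qed
  also note rank_residue_identity[OF assms(1,2) d a assms(12,13)[unfolded arith]]
  finally show ?thesis
    unfolding arith .
qed

end
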